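(* The corona functor $\nu':\mathrm{mCoarse}\to\mathrm{Top}$, from the category of metric spaces and coarse maps modulo closeness to the category of topological spaces and continuous maps, preserves and reflects finite coproducts.
   Context: All metrics take finite values. For a metric space $X$, an entourage is a set $E\subseteq X^2$ with $\sup_{(x,y)\in E}d(x,y)<\infty$; a subset $B\subseteq X$ is bounded if $B^2$ is an entourage; $E[A]$ denotes the set of points of $X$ that are $E$-related to some point of $A$. A map $f:X\to Y$ is coarse if $(f\times f)(E)$ is an entourage for every entourage $E\subseteq X^2$ and $f^{-1}(B)$ is bounded for every bounded $B\subseteq Y$. Two maps $f,g:X\to Y$ are close if $\{(f(x),g(x)):x\in X\}$ is an entourage in $Y$. Subsets $A,B\subseteq X$ are coarsely disjoint, $A\not\curlywedge B$, if $E[A]\cap E[B]$ is bounded for every entourage $E$; otherwise they are close, $A\curlywedge B$. A coarse ultrafilter on $X$ is a system $\mathcal F$ of subsets of $X$ such that (1) $A,B\in\mathcal F$ implies $A\curlywedge B$; (2) if $A,B\subseteq X$ and $A\cup B\in\mathcal F$ then $A\in\mathcal F$ or $B\in\mathcal F$; (3) $X\in\mathcal F$. Two coarse ultrafilters $\mathcal F,\mathcal G$ are asymptotically alike, $\mathcal F\lambda\mathcal G$, if $A\curlywedge B$ for all $A\in\mathcal F$, $B\in\mathcal G$; this is an equivalence relation. The corona $\nu' X$ is the set of coarse ultrafilters on $X$ modulo $\lambda$. For $A\subseteq X$ let $\mathrm{cl}(A)\subseteq\nu' X$ be the set of classes having a representative $\mathcal F$ with $A\in\mathcal F$. For $\pi_1,\pi_2\subseteq\nu'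 X$ put $\pi_1\not\curlywedge\pi_2$ if there are $A,B\subseteq X$ with $A\not\curlywedge B$, $\pi_1\subseteq\mathrm{cl}(A)$, $\pi_2\subseteq\mathrm{cl}(B)$, and $\pi_1\curlywedge\pi_2$ otherwise; this is a separated proximity relation and $\nu' X$ carries the induced topology, in which the closure of $\pi$ is $\{x:\{x\}\curlywedge\pi\}$. A coarse map $f:X\to Y$ induces $\nu' f:\nu' X\to\nu' Y$, $[\mathcal F]\mapsto[f_*\mathcal F]$, where $f_*\mathcal F=\{A\subseteq Y:f^{-1}(A)\in\mathcal F\}$.
   Formalization: Metric spaces are taken to be nonempty: if the empty space is admitted, reflection fails, since a one-point space is not initial (it has no map to the empty space) although its corona, like that of the empty space, is empty. *)

theory Defs
  imports "HOL-Analysis.Analysis"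
begin

section \<open>Coarse geometry of metric spaces\<close>

definition entourage :: "'a metric \<Rightarrow> ('a \<times> 'a) set \<Rightarrow> bool" where
  "entourage X E \<longleftrightarrow> E \<subseteq> mspace X \<times> mspace X \<and> (\<exists>C. \<forall>(x, y) \<in> E. mdist X x y \<le> C)"

definition cbounded :: "'a metric \<Rightarrow> 'a set \<Rightarrow> bool" where
  "cbounded X B \<longleftrightarrow> entourage X (B \<times> B)"

definition coarse_map :: "'a metric \<Rightarrow> 'b metric \<Rightarrow> ('a \<Rightarrow> 'b) \<Rightarrow> bool" where
  "coarse_map X Y f \<longleftrightarrow>
     f \<in> mspace X \<rightarrow> mspace Y \<and>
     (\<forall>E. entourage X E \<longrightarrow> entourage Y (map_prod f f ` E)) \<and>
     (\<forall>B. cbounded Y B \<longrightarrow> cbounded X {x \<in> mspace X. f x \<in> B})"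

definition close_maps :: "'a metric \<Rightarrow> 'b metric \<Rightarrow> ('a \<Rightarrow> 'b) \<Rightarrow> ('a \<Rightarrow> 'b) \<Rightarrow> bool" where
  "close_maps X Y f g \<longleftrightarrow> entourage Y ((\<lambda>x. (f x, g x)) ` mspace X)"

(* The converse of an entourage is an entourage, so it does not matter on which side
   of E the relation is read in E `` A. *)
definition coarsely_disjoint :: "'a metric \<Rightarrow> 'a set \<Rightarrow> 'a set \<Rightarrow> bool" where
  "coarsely_disjoint X A B \<longleftrightarrow> (\<forall>E. entourage X E \<longrightarrow> cbounded X (E `` A \<inter> E `` B))"


section \<open>The category of metric spaces and coarse maps modulo closeness\<close>

(* Metric spaces are taken to be nonempty.  The one-point space is then initial; if the
   empty space were admitted, it alone would be initial, although the corona of every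
   bounded space is empty. *)
definition mcoarse_obj :: "'a metric \<Rightarrow> bool" where
  "mcoarse_obj X \<longleftrightarrow> mspace X \<noteq> {}"

definition close_rel :: "'a metric \<Rightarrow> 'b metric \<Rightarrow> (('a \<Rightarrow> 'b) \<times> ('a \<Rightarrow> 'b)) set" where
  "close_rel X Y = {(f, g). coarse_map X Y f \<and> coarse_map X Y g \<and> close_maps X Y f g}"

(* Values of f outside mspace X are irrelevant: functions agreeing on mspace X are close. *)
definition mcoarse_hom :: "'a metric \<Rightarrow> 'b metric \<Rightarrow> ('a \<Rightarrow> 'b) set set" where
  "mcoarse_hom X Y = {f. coarse_map X Y f} // close_rel X Y"

definition mcoarse_id :: "'a metric \<Rightarrow> ('a \<Rightarrow> 'a) set" where
  "mcoarse_id X = close_rel X X `` {id}"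

(* The class of g o f, for any representatives g and f (all the sets in the union agree). *)
definition mcoarse_comp ::
  "'a metric \<Rightarrow> 'c metric \<Rightarrow> ('b \<Rightarrow> 'c) set \<Rightarrow> ('a \<Rightarrow> 'b) set \<Rightarrow> ('a \<Rightarrow> 'c) set" where
  "mcoarse_comp X Z \<psi> \<phi> = (\<Union>g \<in> \<psi>. \<Union>f \<in> \<phi>. close_rel X Z `` {g \<circ> f})"

definition mcoarse_cocone ::
  "'i set \<Rightarrow> ('i \<Rightarrow> 'a metric) \<Rightarrow> 'b metric \<Rightarrow> ('i \<Rightarrow> ('a \<Rightarrow> 'b) set) \<Rightarrow> bool" where
  "mcoarse_cocone I X Z j \<longleftrightarrow>
     (\<forall>i \<in> I. mcoarse_obj (X i)) \<and> mcoarse_obj Z \<and> (\<forall>i \<in> I. j i \<in> mcoarse_hom (X i) Z)"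

(* The type argument is the universe from which the test spaces Y are drawn. *)
definition mcoarse_coproduct ::
  "'y itself \<Rightarrow> 'i set \<Rightarrow> ('i \<Rightarrow> 'a metric) \<Rightarrow> 'b metric \<Rightarrow> ('i \<Rightarrow> ('a \<Rightarrow> 'b) set) \<Rightarrow> bool" where
  "mcoarse_coproduct _ I X Z j \<longleftrightarrow>
     mcoarse_cocone I X Z j \<and>
     (\<forall>(Y :: 'y metric) g. mcoarse_cocone I X Y g \<longrightarrow>
        (\<exists>!h. h \<in> mcoarse_hom Z Y \<and> (\<forall>i \<in> I. mcoarse_comp (X i) Y h (j i) = g i)))"


section \<open>The category of topological spaces\<close>

definition top_hom :: "'a topology \<Rightarrow> 'b topology \<Rightarrow> ('a \<Rightarrow> 'b) set" where
  "top_hom S T = {f \<in> extensional (topspace S). continuous_map S T f}"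

definition top_id :: "'a topology \<Rightarrow> 'a \<Rightarrow> 'a" where
  "top_id S = restrict id (topspace S)"

definition top_comp :: "'a topology \<Rightarrow> ('b \<Rightarrow> 'c) \<Rightarrow> ('a \<Rightarrow> 'b) \<Rightarrow> 'a \<Rightarrow> 'c" where
  "top_comp S g f = compose (topspace S) g f"

definition top_cocone ::
  "'i set \<Rightarrow> ('i \<Rightarrow> 'a topology) \<Rightarrow> 'b topology \<Rightarrow> ('i \<Rightarrow> 'a \<Rightarrow> 'b) \<Rightarrow> bool" where
  "top_cocone I S T k \<longleftrightarrow> (\<forall>i \<in> I. k i \<in> top_hom (S i) T)"

definition top_coproduct ::
  "'t itself \<Rightarrow> 'i set \<Rightarrow> ('i \<Rightarrow> 'a topology) \<Rightarrow> 'b topology \<Rightarrow> ('i \<Rightarrow> 'a \<Rightarrow> 'b) \<Rightarrow> bool" where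
  "top_coproduct _ I S T k \<longleftrightarrow>
     top_cocone I S T k \<and>
     (\<forall>(W :: 't topology) g. top_cocone I S W g \<longrightarrow>
        (\<exists>!h. h \<in> top_hom T W \<and> (\<forall>i \<in> I. top_comp (S i) h (k i) = g i)))"


section \<open>The corona\<close>

definition coarse_ultrafilter :: "'a metric \<Rightarrow> 'a set set \<Rightarrow> bool" where
  "coarse_ultrafilter X \<F> \<longleftrightarrow>
     \<F> \<subseteq> Pow (mspace X) \<and>
     (\<forall>A \<in> \<F>. \<forall>B \<in> \<F>. \<not> coarsely_disjoint X A B) \<and>
     (\<forall>A B. A \<subseteq> mspace X \<and> B \<subseteq> mspace X \<and> A \<union> B \<in> \<F> \<longrightarrow> A \<in> \<F> \<or> B \<in> \<F>) \<and>
     mspace X \<in> \<F>"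

definition asymp_alike :: "'a metric \<Rightarrow> ('a set set \<times> 'a set set) set" where
  "asymp_alike X = {(\<F>, \<G>). coarse_ultrafilter X \<F> \<and> coarse_ultrafilter X \<G> \<and>
     (\<forall>A \<in> \<F>. \<forall>B \<in> \<G>. \<not> coarsely_disjoint X A B)}"

definition corona :: "'a metric \<Rightarrow> 'a set set set set" where
  "corona X = {\<F>. coarse_ultrafilter X \<F>} // asymp_alike X"

definition corona_cl :: "'a metric \<Rightarrow> 'a set \<Rightarrow> 'a set set set set" where
  "corona_cl X A = {p \<in> corona X. \<exists>\<F> \<in> p. A \<in> \<F>}"

definition corona_far :: "'a metric \<Rightarrow> 'a set set set set \<Rightarrow> 'a set set set set \<Rightarrow> bool" where
  "corona_far X \<pi>\<^sub>1 \<pi>\<^sub>2 \<longleftrightarrow>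
     (\<exists>A B. A \<subseteq> mspace X \<and> B \<subseteq> mspace X \<and> coarsely_disjoint X A B \<and>
        \<pi>\<^sub>1 \<subseteq> corona_cl X A \<and> \<pi>\<^sub>2 \<subseteq> corona_cl X B)"

(* The topology induced by the proximity: U is open iff every point near its complement
   lies in the complement. *)
definition corona_space :: "'a metric \<Rightarrow> 'a set set set topology" where
  "corona_space X =
     topology (\<lambda>U. U \<subseteq> corona X \<and> (\<forall>x \<in> U. corona_far X {x} (corona X - U)))"

definition pushforward ::
  "'a metric \<Rightarrow> 'b metric \<Rightarrow> ('a \<Rightarrow> 'b) \<Rightarrow> 'a set set \<Rightarrow> 'b set set" where
  "pushforward X Y f \<F> = {A. A \<subseteq> mspace Y \<and> {x \<in> mspace X. f x \<in> A} \<in> \<F>}"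

(* The class of the pushforward of F along f, for any representatives f and F
   (all the sets in the union agree). *)
definition corona_map ::
  "'a metric \<Rightarrow> 'b metric \<Rightarrow> ('a \<Rightarrow> 'b) set \<Rightarrow> 'a set set set \<Rightarrow> 'b set set set" where
  "corona_map X Y \<phi> =
     (\<lambda>p \<in> corona X. \<Union>f \<in> \<phi>. \<Union>\<F> \<in> p. asymp_alike Y `` {pushforward X Y f \<F>})"

definition corona_is_functor :: "'a itself \<Rightarrow> bool" where
  "corona_is_functor _ \<longleftrightarrow>
     (\<forall>(X :: 'a metric) (Y :: 'a metric) \<phi>.
        mcoarse_obj X \<and> mcoarse_obj Y \<and> \<phi> \<in> mcoarse_hom X Y \<longrightarrow>
        corona_map X Y \<phi> \<in> top_hom (corona_space X) (corona_space Y)) \<and>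
     (\<forall>X :: 'a metric. mcoarse_obj X \<longrightarrow>
        corona_map X X (mcoarse_id X) = top_id (corona_space X)) \<and>
     (\<forall>(X :: 'a metric) (Y :: 'a metric) (Z :: 'a metric) \<phi> \<psi>.
        mcoarse_obj X \<and> mcoarse_obj Y \<and> mcoarse_obj Z \<and>
        \<phi> \<in> mcoarse_hom X Y \<and> \<psi> \<in> mcoarse_hom Y Z \<longrightarrow>
        corona_map X Z (mcoarse_comp X Z \<psi> \<phi>) =
        top_comp (corona_space X) (corona_map Y Z \<psi>) (corona_map X Y \<phi>))"

(* The metric spaces of the diagram and of its cocones live on a common type 'a, and their
   coronas on 'a set set set.  In both definitions below the hypothesis only tests the
   universal property inside the universe of the diagram, whereas the conclusion tests it
   against spaces on an arbitrary type.  Each is thus stronger than the version whose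
   hypothesis tests against all spaces. *)
definition corona_preserves_finite_coproducts :: "'i itself \<Rightarrow> 'a itself \<Rightarrow> 't itself \<Rightarrow> bool" where
  "corona_preserves_finite_coproducts _ _ _ \<longleftrightarrow>
     (\<forall>(I :: 'i set) (X :: 'i \<Rightarrow> 'a metric) (Z :: 'a metric) j.
        finite I \<and> mcoarse_coproduct TYPE('a) I X Z j \<longrightarrow>
        top_coproduct TYPE('t) I (\<lambda>i. corona_space (X i)) (corona_space Z)
          (\<lambda>i. corona_map (X i) Z (j i)))"

definition corona_reflects_finite_coproducts :: "'i itself \<Rightarrow> 'a itself \<Rightarrow> 'y itself \<Rightarrow> bool" where
  "corona_reflects_finite_coproducts _ _ _ \<longleftrightarrow>
     (\<forall>(I :: 'i set) (X :: 'i \<Rightarrow> 'a metric) (Z :: 'a metric) j.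
        finite I \<and> mcoarse_cocone I X Z j \<and>
        top_coproduct TYPE('a set set set) I (\<lambda>i. corona_space (X i)) (corona_space Z)
          (\<lambda>i. corona_map (X i) Z (j i)) \<longrightarrow>
        mcoarse_coproduct TYPE('y) I X Z j)"

end

theory Submission
  imports Defs
begin

text \<open>Let \<open>f i : X i \<rightarrow> Z\<close> be a finite family of coarse maps.  It is a coproduct of metric spaces iff
  every \<open>f i\<close> is a coarse embedding, the images are pairwise coarsely disjoint, and they cover \<open>Z\<close>
  up to bounded distance (\<open>coarse_sum\<close>): one direction extends maps along nearest points, the other
  compares \<open>Z\<close> with the explicit coproduct, in which the summands are joined at one extra point.
  These three properties make the coronas of the \<open>X i\<close> disjoint, jointly covering and open in the
  corona of \<open>Z\<close>, which gives preservation.  Conversely, a topological coproduct is a bijection on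
  points; if one of the three properties failed, a free ultrafilter on \<open>\<nat>\<close> pushed along a
  suitable sequence would give a point violating injectivity or surjectivity.\<close>

section \<open>Quantitative forms of the coarse notions\<close>

text \<open>The hypotheses test a universal property only against spaces on \<open>'a\<close>, or
  topologies on \<open>'a set set set\<close>, so every comparison object has to be built there. The
  explicit coproduct fits into \<open>'a\<close> for reasons of cardinality if \<open>'a\<close> is
  infinite; if \<open>'a\<close> is finite, all distances are bounded and \<open>coarse_sum\<close>
  holds trivially. A second obstacle is that membership of a set in a coarse ultrafilter is not an
  invariant of its class. Points are therefore handled through their largest representative
  \<open>corona_sets p\<close>, for which a subset of the space is absent exactly when some member
  is coarsely disjoint from it. The recurring device is to separate two coarsely disjoint sets by a
  cover of the space into two parts, one of which must belong to any given ultrafilter. Finiteness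
  of the family turns one constant per summand into a common one and lets each point of the corona
  of \<open>Z\<close> choose a summand. If some \<open>f i\<close> is not an embedding, pairs with
  bounded image distance drift apart; properness forces both partners to infinity, and thinning
  makes the two ranges coarsely disjoint, so that they define different points with the same
  image.\<close>

lemma mdist_self [simp]: "x \<in> mspace m \<Longrightarrow> mdist m x x = 0"
  by simp

lemma cbounded_iff:
  assumes "p \<in> mspace X"
  shows "cbounded X S \<longleftrightarrow> S \<subseteq> mspace X \<and> (\<exists>C. \<forall>x\<in>S. mdist X p x \<le> C)"
proof
  assume L: "cbounded X S"
  then have S: "S \<subseteq> mspace X" and "\<exists>C. \<forall>x\<in>S. \<forall>y\<in>S. mdist X x y \<le> C"
    unfolding cbounded_def entourage_def by auto
  then obtain C where C: "\<forall>x\<in>S. \<forall>y\<in>S. mdist X x y \<le> C" by blast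
  have "\<exists>C. \<forall>x\<in>S. mdist X p x \<le> C"
  proof (cases "S = {}")
    case False
    then obtain y where y: "y \<in> S" by blast
    have "mdist X p x \<le> mdist X p y + C" if "x \<in> S" for x
      using mdist_triangle[of p X y x] C assms S y that by fastforce
    then show ?thesis by blast
  qed auto
  with S show "S \<subseteq> mspace X \<and> (\<exists>C. \<forall>x\<in>S. mdist X p x \<le> C)" by blast
next
  assume R: "S \<subseteq> mspace X \<and> (\<exists>C. \<forall>x\<in>S. mdist X p x \<le> C)"
  then obtain C where C: "\<forall>x\<in>S. mdist X p x \<le> C" and S: "S \<subseteq> mspace X" by blast
  have "mdist X x y \<le> C + C" if "x \<in> S" "y \<in> S" for x y
    using mdist_triangle[of x X p y] mdist_commute[of X x p] C that assms S
    by (smt (verit) subsetD)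
  then show "cbounded X S"
    unfolding cbounded_def entourage_def using S by (auto intro!: exI[of _ "C + C"])
qed

lemma close_maps_iff:
  assumes "f \<in> mspace X \<rightarrow> mspace Y" "g \<in> mspace X \<rightarrow> mspace Y"
  shows "close_maps X Y f g \<longleftrightarrow> (\<exists>C. \<forall>x\<in>mspace X. mdist Y (f x) (g x) \<le> C)"
  using assms unfolding close_maps_def entourage_def by (force simp: Pi_iff)

lemma coarse_map_iff:
  assumes p: "p \<in> mspace X" and q: "q \<in> mspace Y"
  shows "coarse_map X Y f \<longleftrightarrow> f \<in> mspace X \<rightarrow> mspace Y \<and>
    (\<forall>R. \<exists>C. \<forall>x\<in>mspace X. \<forall>y\<in>mspace X. mdist X x y \<le> R \<longrightarrow> mdist Y (f x) (f y) \<le> C) \<and>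
    (\<forall>R. \<exists>C. \<forall>x\<in>mspace X. mdist Y q (f x) \<le> R \<longrightarrow> mdist X p x \<le> C)"
    (is "?L \<longleftrightarrow> ?F \<and> ?B \<and> ?P")
proof
  assume L: ?L
  then have F: ?F by (simp add: coarse_map_def)
  moreover have ?B
  proof
    fix R
    have "entourage X {(x, y). x \<in> mspace X \<and> y \<in> mspace X \<and> mdist X x y \<le> R}"
      unfolding entourage_def by auto
    then have "entourage Y (map_prod f f ` {(x, y). x \<in> mspace X \<and> y \<in> mspace X \<and> mdist X x y \<le> R})"
      using L by (simp add: coarse_map_def)
    then obtain C where C: "\<forall>(u, v)\<in>map_prod f f ` {(x, y). x \<in> mspace X \<and> y \<in> mspace X \<and> mdist X x y \<le> R}.
        mdist Y u v \<le> C"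
      unfolding entourage_def by blast
    have "mdist Y (f x) (f y) \<le> C" if "x \<in> mspace X" "y \<in> mspace X" "mdist X x y \<le> R" for x y
    proof -
      have "(f x, f y) \<in> map_prod f f ` {(x, y). x \<in> mspace X \<and> y \<in> mspace X \<and> mdist X x y \<le> R}"
        using that by (intro image_eqI[of _ _ "(x, y)"]) auto
      from bspec[OF C this] show ?thesis by simp
    qed
    then show "\<exists>C. \<forall>x\<in>mspace X. \<forall>y\<in>mspace X. mdist X x y \<le> R \<longrightarrow> mdist Y (f x) (f y) \<le> C"
      by blast
  qed
  moreover have ?P
  proof
    fix R
    have "cbounded Y {y \<in> mspace Y. mdist Y q y \<le> R}"
      using q by (auto simp: cbounded_iff)
    then have "cbounded X {x \<in> mspace X. f x \<in> {y \<in> mspace Y. mdist Y q y \<le> R}}"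
      using L unfolding coarse_map_def by blast
    then show "\<exists>C. \<forall>x\<in>mspace X. mdist Y q (f x) \<le> R \<longrightarrow> mdist X p x \<le> C"
      using F p by (auto simp: cbounded_iff Pi_iff)
  qed
  ultimately show "?F \<and> ?B \<and> ?P" by blast
next
  assume R: "?F \<and> ?B \<and> ?P"
  have "entourage Y (map_prod f f ` E)" if E: "entourage X E" for E
  proof -
    obtain C where C: "\<forall>(x, y)\<in>E. mdist X x y \<le> C" and E': "E \<subseteq> mspace X \<times> mspace X"
      using E unfolding entourage_def by blast
    obtain D where D: "\<forall>x\<in>mspace X. \<forall>y\<in>mspace X. mdist X x y \<le> C \<longrightarrow> mdist Y (f x) (f y) \<le> D"
      using R by blast
    have "mdist Y (f x) (f y) \<le> D" if "(x, y) \<in> E" for x y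
      using C D E' that by blast
    moreover have "f x \<in> mspace Y" if "x \<in> mspace X" for x using R that by blast
    ultimately show ?thesis using E' unfolding entourage_def by (auto intro!: exI[of _ D])
  qed
  moreover have "cbounded X {x \<in> mspace X. f x \<in> B}" if cB: "cbounded Y B" for B
  proof -
    obtain K where K: "\<forall>y\<in>B. mdist Y q y \<le> K" using cB q by (auto simp: cbounded_iff)
    obtain C where "\<forall>x\<in>mspace X. mdist Y q (f x) \<le> K \<longrightarrow> mdist X p x \<le> C" using R by blast
    then show ?thesis using K p by (auto simp: cbounded_iff)
  qed
  ultimately show ?L using R unfolding coarse_map_def by blast
qed

text \<open>Points of \<open>A\<close> and \<open>B\<close> with a common \<open>E\<close>-neighbour
  are at most twice the width of \<open>E\<close> apart; conversely, one point of a near pair lies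
  in both neighbourhoods. Bounding \<open>a\<close> bounds its partner and their common neighbours
  as well.\<close>

lemma coarsely_disjoint_iff:
  assumes p: "p \<in> mspace X" and A: "A \<subseteq> mspace X" and B: "B \<subseteq> mspace X"
  shows "coarsely_disjoint X A B \<longleftrightarrow>
    (\<forall>R. \<exists>C. \<forall>a\<in>A. \<forall>b\<in>B. mdist X a b \<le> R \<longrightarrow> mdist X p a \<le> C)"
proof
  assume L: "coarsely_disjoint X A B"
  show "\<forall>R. \<exists>C. \<forall>a\<in>A. \<forall>b\<in>B. mdist X a b \<le> R \<longrightarrow> mdist X p a \<le> C"
  proof
    fix R
    \<comment> \<open>The \<open>max 0\<close> puts the diagonal into \<open>E\<close>, so that
      \<open>a\<close> itself belongs to both images under \<open>E\<close>.\<close>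
    define E where "E = {(x, y). x \<in> mspace X \<and> y \<in> mspace X \<and> mdist X x y \<le> max 0 R}"
    have "entourage X E" unfolding entourage_def E_def by auto
    then have "cbounded X (E `` A \<inter> E `` B)" using L by (simp add: coarsely_disjoint_def)
    then obtain C where C: "\<forall>x\<in>E `` A \<inter> E `` B. mdist X p x \<le> C"
      using p by (auto simp: cbounded_iff)
    have "mdist X p a \<le> C" if "a \<in> A" "b \<in> B" "mdist X a b \<le> R" for a b
    proof -
      have "a \<in> mspace X" "b \<in> mspace X" using that A B by auto
      then have "(a, a) \<in> E" "(b, a) \<in> E"
        using that mdist_commute[of X a b] by (simp_all add: E_def)
      then show ?thesis using C that by blast
    qed
    then show "\<exists>C. \<forall>a\<in>A. \<forall>b\<in>B. mdist X a b \<le> R \<longrightarrow> mdist X p a \<le> C" by blast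
  qed
next
  assume R: "\<forall>R. \<exists>C. \<forall>a\<in>A. \<forall>b\<in>B. mdist X a b \<le> R \<longrightarrow> mdist X p a \<le> C"
  show "coarsely_disjoint X A B"
    unfolding coarsely_disjoint_def
  proof (intro allI impI)
    fix E assume "entourage X E"
    then obtain D where E: "E \<subseteq> mspace X \<times> mspace X" and D: "\<forall>(x, y)\<in>E. mdist X x y \<le> D"
      unfolding entourage_def by blast
    obtain C where C: "\<forall>a\<in>A. \<forall>b\<in>B. mdist X a b \<le> D + D \<longrightarrow> mdist X p a \<le> C" using R by blast
    have "mdist X p z \<le> C + D" if "(a, z) \<in> E" "(b, z) \<in> E" "a \<in> A" "b \<in> B" for a b z
    proof -
      have m: "a \<in> mspace X" "b \<in> mspace X" "z \<in> mspace X" using that E by auto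
      have d: "mdist X a z \<le> D" "mdist X b z \<le> D" using that D by auto
      then have "mdist X a b \<le> D + D"
        using mdist_triangle[OF m(1,3,2)] mdist_commute[of X b z] by simp
      then have "mdist X p a \<le> C" using C that by blast
      then show ?thesis using mdist_triangle[OF p m(1,3)] d by simp
    qed
    then show "cbounded X (E `` A \<inter> E `` B)"
      using E p by (auto simp: cbounded_iff intro!: exI[of _ "C + D"])
  qed
qed

lemma coarsely_disjoint_sym: "coarsely_disjoint X A B \<Longrightarrow> coarsely_disjoint X B A"
  unfolding coarsely_disjoint_def by (simp add: Int_commute)

lemma coarsely_disjoint_mono:
  assumes "coarsely_disjoint X A B" "A' \<subseteq> A" "B' \<subseteq> B"
  shows "coarsely_disjoint X A' B'"
  unfolding coarsely_disjoint_def
proof (intro allI impI)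
  fix E assume "entourage X E"
  then have "cbounded X (E `` A \<inter> E `` B)"
    using assms(1) by (simp add: coarsely_disjoint_def)
  moreover have "E `` A' \<inter> E `` B' \<subseteq> E `` A \<inter> E `` B" using assms by blast
  ultimately show "cbounded X (E `` A' \<inter> E `` B')"
    unfolding cbounded_def entourage_def by blast
qed

lemma cbounded_Un:
  assumes "p \<in> mspace X" "cbounded X S" "cbounded X T"
  shows "cbounded X (S \<union> T)"
proof -
  obtain C D where "\<forall>x\<in>S. mdist X p x \<le> C" "\<forall>x\<in>T. mdist X p x \<le> D"
    using assms by (auto simp: cbounded_iff)
  then have "\<forall>x\<in>S \<union> T. mdist X p x \<le> max C D" by (auto simp: le_max_iff_disj)
  then show ?thesis using assms by (auto simp: cbounded_iff)
qed

lemma coarsely_disjoint_Un_right: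
  assumes X: "mspace X \<noteq> {}" and "coarsely_disjoint X A B" "coarsely_disjoint X A B'"
  shows "coarsely_disjoint X A (B \<union> B')"
  unfolding coarsely_disjoint_def
proof (intro allI impI)
  fix E assume E: "entourage X E"
  obtain p where p: "p \<in> mspace X" using X by blast
  have "E `` A \<inter> E `` (B \<union> B') = (E `` A \<inter> E `` B) \<union> (E `` A \<inter> E `` B')" by blast
  then show "cbounded X (E `` A \<inter> E `` (B \<union> B'))"
    using assms E by (simp add: coarsely_disjoint_def cbounded_Un[OF p])
qed

lemma coarsely_disjoint_Un_left:
  assumes "mspace X \<noteq> {}" "coarsely_disjoint X A B" "coarsely_disjoint X A' B"
  shows "coarsely_disjoint X (A \<union> A') B"
  using assms by (meson coarsely_disjoint_Un_right coarsely_disjoint_sym)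

lemma coarsely_disjoint_UN_right:
  assumes "mspace X \<noteq> {}" "finite I" "\<And>i. i \<in> I \<Longrightarrow> coarsely_disjoint X A (B i)"
  shows "coarsely_disjoint X A (\<Union>i\<in>I. B i)"
  using assms(2,3)
proof (induction I rule: finite_induct)
  case empty
  then show ?case by (simp add: coarsely_disjoint_def cbounded_def entourage_def)
next
  case (insert i I)
  then show ?case using coarsely_disjoint_Un_right[OF assms(1)] by simp
qed

lemma coarsely_disjoint_bounded:
  assumes p: "p \<in> mspace X" and "cbounded X A" "B \<subseteq> mspace X"
  shows "coarsely_disjoint X A B"
  using assms by (auto simp: coarsely_disjoint_iff[OF p] cbounded_iff[OF p])

text \<open>Each point is put on the side of the set it is farther away from; distances to the
  sets are compared without infima.\<close>

lemma coarsely_disjoint_separation: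
  assumes X: "mspace X \<noteq> {}" and A: "A \<subseteq> mspace X" and B: "B \<subseteq> mspace X"
    and AB: "coarsely_disjoint X A B"
  obtains C D where "C \<union> D = mspace X" "coarsely_disjoint X A C" "coarsely_disjoint X B D"
proof -
  obtain p where p: "p \<in> mspace X" using X by blast
  define C where "C = {x \<in> mspace X. \<forall>a\<in>A. \<exists>b\<in>B. mdist X x b \<le> mdist X x a}"
  define D where "D = {x \<in> mspace X. \<forall>b\<in>B. \<exists>a\<in>A. mdist X x a \<le> mdist X x b}"
  have sub: "C \<subseteq> mspace X" "D \<subseteq> mspace X" by (auto simp: C_def D_def)
  have "C \<union> D = mspace X"
  proof -
    have "x \<in> D" if "x \<in> mspace X" "x \<notin> C" for x
    proof -
      obtain a where "a \<in> A" "\<forall>b\<in>B. mdist X x b > mdist X x a"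
        using \<open>x \<notin> C\<close> \<open>x \<in> mspace X\<close> by (auto simp: C_def not_le)
      then have "\<forall>b\<in>B. \<exists>a\<in>A. mdist X x a \<le> mdist X x b" by (meson less_imp_le)
      then show ?thesis using \<open>x \<in> mspace X\<close> by (simp add: D_def)
    qed
    then show ?thesis using sub by blast
  qed
  moreover have "coarsely_disjoint X A C"
    unfolding coarsely_disjoint_iff[OF p A sub(1)]
  proof
    fix R
    obtain K where K: "\<forall>a\<in>A. \<forall>b\<in>B. mdist X a b \<le> R + R \<longrightarrow> mdist X p a \<le> K"
      using AB coarsely_disjoint_iff[OF p A B] by blast
    have "mdist X p a \<le> K" if ac: "a \<in> A" "c \<in> C" "mdist X a c \<le> R" for a c
    proof -
      \<comment> \<open>By the definition of \<open>C\<close>, some \<open>b\<close> is at least as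
        near to \<open>c\<close> as \<open>a\<close> is, so \<open>a\<close> and \<open>b\<close>
        are within \<open>R + R\<close> of each other.\<close>
      obtain b where b: "b \<in> B" "mdist X c b \<le> mdist X c a"
        using ac unfolding C_def by blast
      then have "mdist X a b \<le> R + R"
        using mdist_triangle[of a X c b] mdist_commute[of X a c] that A B sub by (auto simp: subset_iff)
      then show ?thesis using K that b by blast
    qed
    then show "\<exists>K. \<forall>a\<in>A. \<forall>b\<in>C. mdist X a b \<le> R \<longrightarrow> mdist X p a \<le> K" by blast
  qed
  moreover have "coarsely_disjoint X B D"
    unfolding coarsely_disjoint_iff[OF p B sub(2)]
  proof
    fix R
    obtain K where K: "\<forall>b\<in>B. \<forall>a\<in>A. mdist X b a \<le> R + R \<longrightarrow> mdist X p b \<le> K"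
      using coarsely_disjoint_sym[OF AB] coarsely_disjoint_iff[OF p B A] by blast
    have "mdist X p b \<le> K" if bd: "b \<in> B" "d \<in> D" "mdist X b d \<le> R" for b d
    proof -
      obtain a where a: "a \<in> A" "mdist X d a \<le> mdist X d b"
        using bd unfolding D_def by blast
      then have "mdist X b a \<le> R + R"
        using mdist_triangle[of b X d a] mdist_commute[of X b d] that A B sub by (auto simp: subset_iff)
      then show ?thesis using K that a by blast
    qed
    then show "\<exists>K. \<forall>a\<in>B. \<forall>b\<in>D. mdist X a b \<le> R \<longrightarrow> mdist X p a \<le> K" by blast
  qed
  ultimately show thesis using that by blast
qed

text \<open>Two close maps instead of one let a single estimate serve twice: with
  \<open>f = g\<close> it shows that pushforwards are coarse ultrafilters, in general that their
  class does not depend on the representatives. If \<open>x\<close> and \<open>y\<close> are within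
  \<open>R\<close>, then \<open>f x\<close> and \<open>g y\<close> are within \<open>S + K\<close>,
  which confines \<open>f x\<close> and, by properness, \<open>x\<close>.\<close>

lemma coarsely_disjoint_vimage:
  assumes X: "mspace X \<noteq> {}" and f: "coarse_map X Y f" and g: "coarse_map X Y g"
    and fg: "close_maps X Y f g"
    and A: "A \<subseteq> mspace Y" and B: "B \<subseteq> mspace Y" and AB: "coarsely_disjoint Y A B"
  shows "coarsely_disjoint X {x \<in> mspace X. f x \<in> A} {x \<in> mspace X. g x \<in> B}"
proof -
  obtain p where p: "p \<in> mspace X" using X by blast
  have fm: "f \<in> mspace X \<rightarrow> mspace Y" and gm: "g \<in> mspace X \<rightarrow> mspace Y"
    using f g by (auto simp: coarse_map_def)
  define q where "q = f p"
  have q: "q \<in> mspace Y" using fm p by (auto simp: q_def)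
  obtain K where K: "\<forall>x\<in>mspace X. mdist Y (f x) (g x) \<le> K"
    using fg close_maps_iff[OF fm gm] by blast
  show ?thesis
  proof (subst coarsely_disjoint_iff[OF p], blast, blast, rule allI)
    fix R
    obtain S where S: "\<forall>x\<in>mspace X. \<forall>y\<in>mspace X. mdist X x y \<le> R \<longrightarrow> mdist Y (f x) (f y) \<le> S"
      using f unfolding coarse_map_iff[OF p q] by blast
    obtain T where T: "\<forall>a\<in>A. \<forall>b\<in>B. mdist Y a b \<le> S + K \<longrightarrow> mdist Y q a \<le> T"
      using AB coarsely_disjoint_iff[OF q A B] by blast
    obtain U where U: "\<forall>x\<in>mspace X. mdist Y q (f x) \<le> T \<longrightarrow> mdist X p x \<le> U"
      using f unfolding coarse_map_iff[OF p q] by blast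
    have "mdist X p x \<le> U" if "x \<in> mspace X" "f x \<in> A" "y \<in> mspace X" "g y \<in> B" "mdist X x y \<le> R" for x y
    proof -
      have "mdist Y (f x) (g y) \<le> mdist Y (f x) (f y) + mdist Y (f y) (g y)"
        using that fm gm by (intro mdist_triangle) auto
      also have "\<dots> \<le> S + K" using S K that by (intro add_mono) auto
      finally show ?thesis using T U that by blast
    qed
    then show "\<exists>C. \<forall>a\<in>{x \<in> mspace X. f x \<in> A}. \<forall>b\<in>{x \<in> mspace X. g x \<in> B}.
        mdist X a b \<le> R \<longrightarrow> mdist X p a \<le> C" by blast
  qed
qed

section \<open>Closeness classes of coarse maps\<close>

lemma close_maps_refl: "f \<in> mspace X \<rightarrow> mspace Y \<Longrightarrow> close_maps X Y f f"
  by (auto simp: close_maps_iff Pi_iff intro!: exI[of _ 0])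

lemma close_rel_equiv: "equiv {f. coarse_map X Y f} (close_rel X Y)"
proof (rule equivI)
  show "close_rel X Y \<subseteq> {f. coarse_map X Y f} \<times> {f. coarse_map X Y f}"
    by (auto simp: close_rel_def)
  show "refl_on {f. coarse_map X Y f} (close_rel X Y)"
    by (auto simp: refl_on_def close_rel_def coarse_map_def intro!: close_maps_refl)
  show "sym (close_rel X Y)"
    by (auto simp: sym_def close_rel_def coarse_map_def close_maps_iff mdist_commute)
  show "trans (close_rel X Y)"
  proof (rule transI)
    fix f g h assume "(f, g) \<in> close_rel X Y" "(g, h) \<in> close_rel X Y"
    then have c: "coarse_map X Y f" "coarse_map X Y g" "coarse_map X Y h"
        "close_maps X Y f g" "close_maps X Y g h"
      by (auto simp: close_rel_def)
    then have m: "f \<in> mspace X \<rightarrow> mspace Y" "g \<in> mspace X \<rightarrow> mspace Y" "h \<in> mspace X \<rightarrow> mspace Y"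
      by (auto simp: coarse_map_def)
    obtain C D where CD: "\<forall>x\<in>mspace X. mdist Y (f x) (g x) \<le> C" "\<forall>x\<in>mspace X. mdist Y (g x) (h x) \<le> D"
      using c m by (auto simp: close_maps_iff)
    have "mdist Y (f x) (h x) \<le> C + D" if "x \<in> mspace X" for x
    proof -
      have "mdist Y (f x) (h x) \<le> mdist Y (f x) (g x) + mdist Y (g x) (h x)"
        using m that by (intro mdist_triangle) auto
      then show ?thesis using CD that by fastforce
    qed
    then show "(f, h) \<in> close_rel X Y" using c m by (auto simp: close_rel_def close_maps_iff)
  qed
qed

lemma mcoarse_homE:
  assumes "\<phi> \<in> mcoarse_hom X Y"
  obtains f where "coarse_map X Y f" "\<phi> = close_rel X Y `` {f}"
  using assms unfolding mcoarse_hom_def by (auto elim: quotientE)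

lemma mcoarse_homI: "coarse_map X Y f \<Longrightarrow> close_rel X Y `` {f} \<in> mcoarse_hom X Y"
  unfolding mcoarse_hom_def by (auto intro: quotientI)

lemma close_rel_class_eq:
  assumes "coarse_map X Y f" "coarse_map X Y g"
  shows "close_rel X Y `` {f} = close_rel X Y `` {g} \<longleftrightarrow> close_maps X Y f g"
  using eq_equiv_class_iff[OF close_rel_equiv, of f X Y g] assms by (auto simp: close_rel_def)

lemma coarse_map_comp:
  assumes "coarse_map X Y f" "coarse_map Y Z g"
  shows "coarse_map X Z (g \<circ> f)"
proof -
  have f: "f \<in> mspace X \<rightarrow> mspace Y" using assms by (simp add: coarse_map_def)
  have "entourage Z (map_prod (g \<circ> f) (g \<circ> f) ` E)" if "entourage X E" for E
  proof -
    have "map_prod (g \<circ> f) (g \<circ> f) ` E = map_prod g g ` (map_prod f f ` E)"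
      by (simp add: image_image map_prod_def case_prod_beta)
    then show ?thesis using assms that by (simp add: coarse_map_def)
  qed
  moreover have "cbounded X {x \<in> mspace X. (g \<circ> f) x \<in> B}" if "cbounded Z B" for B
  proof -
    have "{x \<in> mspace X. (g \<circ> f) x \<in> B} = {x \<in> mspace X. f x \<in> {y \<in> mspace Y. g y \<in> B}}"
      using f by auto
    moreover have "cbounded Y {y \<in> mspace Y. g y \<in> B}"
      using assms(2) that by (simp add: coarse_map_def)
    then have "cbounded X {x \<in> mspace X. f x \<in> {y \<in> mspace Y. g y \<in> B}}"
      using assms(1) unfolding coarse_map_def by blast
    ultimately show ?thesis by simp
  qed
  ultimately show ?thesis using assms by (auto simp: coarse_map_def Pi_iff)
qed

lemma close_maps_comp:
  assumes "coarse_map X Y f" "coarse_map X Y f'" "close_maps X Y f f'"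
    and "coarse_map Y Z g" "coarse_map Y Z g'" "close_maps Y Z g g'" and X: "mspace X \<noteq> {}"
  shows "close_maps X Z (g \<circ> f) (g' \<circ> f')"
proof -
  have m: "f \<in> mspace X \<rightarrow> mspace Y" "f' \<in> mspace X \<rightarrow> mspace Y"
    "g \<in> mspace Y \<rightarrow> mspace Z" "g' \<in> mspace Y \<rightarrow> mspace Z"
    using assms by (auto simp: coarse_map_def)
  obtain p where "p \<in> mspace X" using X by blast
  then have p: "f p \<in> mspace Y" "g (f p) \<in> mspace Z" using m by auto
  obtain C where C: "\<forall>x\<in>mspace X. mdist Y (f x) (f' x) \<le> C"
    using assms m by (auto simp: close_maps_iff)
  obtain D where D: "\<forall>y\<in>mspace Y. mdist Z (g y) (g' y) \<le> D"
    using assms m by (auto simp: close_maps_iff)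
  obtain K where K: "\<forall>x\<in>mspace Y. \<forall>y\<in>mspace Y. mdist Y x y \<le> C \<longrightarrow> mdist Z (g x) (g y) \<le> K"
    using assms(4) unfolding coarse_map_iff[OF p] by blast
  have "mdist Z ((g \<circ> f) x) ((g' \<circ> f') x) \<le> K + D" if "x \<in> mspace X" for x
  proof -
    have i: "f x \<in> mspace Y" "f' x \<in> mspace Y" using m that by auto
    then have "mdist Z (g (f x)) (g' (f' x)) \<le> mdist Z (g (f x)) (g (f' x)) + mdist Z (g (f' x)) (g' (f' x))"
      using m by (intro mdist_triangle) auto
    also have "\<dots> \<le> K + D" using K C D that i by (intro add_mono) auto
    finally show ?thesis by simp
  qed
  then show ?thesis using m by (subst close_maps_iff) auto
qed

lemma mcoarse_comp_class:
  assumes f: "coarse_map X Y f" and g: "coarse_map Y Z g" and X: "mspace X \<noteq> {}"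
  shows "mcoarse_comp X Z (close_rel Y Z `` {g}) (close_rel X Y `` {f}) = close_rel X Z `` {g \<circ> f}"
proof -
  have "close_rel X Z `` {g' \<circ> f'} = close_rel X Z `` {g \<circ> f}"
    if "g' \<in> close_rel Y Z `` {g}" "f' \<in> close_rel X Y `` {f}" for g' f'
  proof -
    have c: "coarse_map X Y f'" "coarse_map Y Z g'" "close_maps X Y f f'" "close_maps Y Z g g'"
      using that by (auto simp: close_rel_def)
    have "close_rel X Z `` {g \<circ> f} = close_rel X Z `` {g' \<circ> f'}"
      using close_maps_comp[OF f c(1,3) g c(2,4) X] c f g
      by (subst close_rel_class_eq) (auto intro: coarse_map_comp)
    then show ?thesis by simp
  qed
  moreover have "f \<in> close_rel X Y `` {f}" "g \<in> close_rel Y Z `` {g}"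
    using f g by (auto simp: close_rel_def coarse_map_def intro!: close_maps_refl)
  ultimately show ?thesis unfolding mcoarse_comp_def by blast
qed

section \<open>Coarse ultrafilters and the points of the corona\<close>

lemma coarse_ultrafilter_subset: "coarse_ultrafilter X \<F> \<Longrightarrow> A \<in> \<F> \<Longrightarrow> A \<subseteq> mspace X"
  by (auto simp: coarse_ultrafilter_def)

lemma coarse_ultrafilter_cases:
  assumes "coarse_ultrafilter X \<F>" "C \<union> D = mspace X"
  shows "C \<in> \<F> \<or> D \<in> \<F>"
  using assms unfolding coarse_ultrafilter_def by (metis Un_upper1 Un_upper2)

lemma coarse_ultrafilter_not_disjoint:
  "coarse_ultrafilter X \<F> \<Longrightarrow> A \<in> \<F> \<Longrightarrow> B \<in> \<F> \<Longrightarrow> \<not> coarsely_disjoint X A B"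
  by (auto simp: coarse_ultrafilter_def)

text \<open>Only transitivity needs an idea. If \<open>A\<close> and \<open>B\<close> were coarsely
  disjoint, they would be separated by a cover \<open>C \<union> D\<close>; the middle ultrafilter
  contains \<open>C\<close> or \<open>D\<close>, and either contradicts one of the two closeness
  assumptions.\<close>

lemma asymp_alike_equiv:
  assumes X: "mspace X \<noteq> {}"
  shows "equiv {\<F>. coarse_ultrafilter X \<F>} (asymp_alike X)"
proof (rule equivI)
  show "asymp_alike X \<subseteq> {\<F>. coarse_ultrafilter X \<F>} \<times> {\<F>. coarse_ultrafilter X \<F>}"
    by (auto simp: asymp_alike_def)
  show "refl_on {\<F>. coarse_ultrafilter X \<F>} (asymp_alike X)"
    by (auto simp: refl_on_def asymp_alike_def coarse_ultrafilter_def)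
  show "sym (asymp_alike X)"
    by (auto simp: sym_def asymp_alike_def dest: coarsely_disjoint_sym)
  show "trans (asymp_alike X)"
  proof (rule transI)
    fix \<F> \<G> \<H>
    assume "(\<F>, \<G>) \<in> asymp_alike X" "(\<G>, \<H>) \<in> asymp_alike X"
    then have u: "coarse_ultrafilter X \<F>" "coarse_ultrafilter X \<G>" "coarse_ultrafilter X \<H>"
      and FG: "\<And>A B. A \<in> \<F> \<Longrightarrow> B \<in> \<G> \<Longrightarrow> \<not> coarsely_disjoint X A B"
      and GH: "\<And>A B. A \<in> \<G> \<Longrightarrow> B \<in> \<H> \<Longrightarrow> \<not> coarsely_disjoint X A B"
      by (auto simp: asymp_alike_def)
    have "\<not> coarsely_disjoint X A B" if AB: "A \<in> \<F>" "B \<in> \<H>" for A B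
    proof
      assume "coarsely_disjoint X A B"
      then obtain C D where CD: "C \<union> D = mspace X" "coarsely_disjoint X A C" "coarsely_disjoint X B D"
        using coarsely_disjoint_separation[OF X] u AB by (metis coarse_ultrafilter_subset)
      then show False
        using coarse_ultrafilter_cases[OF u(2) CD(1)] FG GH AB coarsely_disjoint_sym by blast
    qed
    then show "(\<F>, \<H>) \<in> asymp_alike X" using u by (auto simp: asymp_alike_def)
  qed
qed

text \<open>A coarse ultrafilter need not be upward closed, and alike ones may contain different
  sets. Collecting every set that is close to all members produces the largest coarse ultrafilter in
  the class.\<close>

definition ultrafilter_hull :: "'a metric \<Rightarrow> 'a set set \<Rightarrow> 'a set set" where
  "ultrafilter_hull X \<F> = {A. A \<subseteq> mspace X \<and> (\<forall>B\<in>\<F>. \<not> coarsely_disjoint X A B)}"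

text \<open>Pairwise closeness follows from one separation, as for transitivity. For a union,
  suppose \<open>A\<close> and \<open>B\<close> are excluded by members \<open>A'\<close> and
  \<open>B'\<close>. Two separations give \<open>D\<close>, \<open>D'\<close> excluded from
  \<open>\<F>\<close> by these members, so the remaining part \<open>C \<inter> C'\<close> belongs
  to \<open>\<F>\<close>; it is coarsely disjoint from \<open>A\<close> and \<open>B\<close>, hence
  from \<open>A \<union> B\<close>.\<close>

lemma coarse_ultrafilter_hull:
  assumes X: "mspace X \<noteq> {}" and F: "coarse_ultrafilter X \<F>"
  shows "coarse_ultrafilter X (ultrafilter_hull X \<F>)"
proof -
  have "\<not> coarsely_disjoint X A B"
    if AB: "A \<in> ultrafilter_hull X \<F>" "B \<in> ultrafilter_hull X \<F>" for A B
  proof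
    assume "coarsely_disjoint X A B"
    then obtain C D where CD: "C \<union> D = mspace X" "coarsely_disjoint X A C" "coarsely_disjoint X B D"
      using coarsely_disjoint_separation[OF X, of A B] AB by (auto simp: ultrafilter_hull_def)
    then show False
      using coarse_ultrafilter_cases[OF F CD(1)] AB by (auto simp: ultrafilter_hull_def)
  qed
  moreover have "A \<in> ultrafilter_hull X \<F> \<or> B \<in> ultrafilter_hull X \<F>"
    if AB: "A \<subseteq> mspace X" "B \<subseteq> mspace X" "A \<union> B \<in> ultrafilter_hull X \<F>" for A B
  proof (rule ccontr)
    assume "\<not> ?thesis"
    then obtain A' B' where AB': "A' \<in> \<F>" "coarsely_disjoint X A A'" "B' \<in> \<F>" "coarsely_disjoint X B B'"
      using AB by (auto simp: ultrafilter_hull_def)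
    have sub: "A' \<subseteq> mspace X" "B' \<subseteq> mspace X" using F AB' by (auto dest: coarse_ultrafilter_subset)
    obtain C D where CD: "C \<union> D = mspace X" "coarsely_disjoint X A C" "coarsely_disjoint X A' D"
      using coarsely_disjoint_separation[OF X AB(1) sub(1) AB'(2)] by blast
    obtain C' D' where CD': "C' \<union> D' = mspace X" "coarsely_disjoint X B C'" "coarsely_disjoint X B' D'"
      using coarsely_disjoint_separation[OF X AB(2) sub(2) AB'(4)] by blast
    have "D \<notin> \<F>" "D' \<notin> \<F>"
      using coarse_ultrafilter_not_disjoint[OF F] AB' CD CD' by blast+
    moreover have "(C \<inter> C') \<union> (D \<union> D') = mspace X" using CD CD' by blast
    moreover have "D \<union> D' \<in> \<F> \<Longrightarrow> D \<in> \<F> \<or> D' \<in> \<F>"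
      using F CD(1) CD'(1) unfolding coarse_ultrafilter_def by (metis Un_upper2)
    ultimately have CC: "C \<inter> C' \<in> \<F>" using coarse_ultrafilter_cases[OF F] by blast
    have "coarsely_disjoint X A (C \<inter> C')" "coarsely_disjoint X B (C \<inter> C')"
      using CD(2) CD'(2) by (auto elim: coarsely_disjoint_mono)
    then have "coarsely_disjoint X (A \<union> B) (C \<inter> C')" by (rule coarsely_disjoint_Un_left[OF X])
    with CC AB(3) show False by (auto simp: ultrafilter_hull_def)
  qed
  moreover have "mspace X \<in> ultrafilter_hull X \<F>"
    using F by (auto simp: ultrafilter_hull_def coarse_ultrafilter_def)
  ultimately show ?thesis
    unfolding coarse_ultrafilter_def by (auto simp: ultrafilter_hull_def)
qed

lemma ultrafilter_hull_alike:
  assumes "mspace X \<noteq> {}" "coarse_ultrafilter X \<F>"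
  shows "(\<F>, ultrafilter_hull X \<F>) \<in> asymp_alike X"
  using assms(2) coarse_ultrafilter_hull[OF assms]
  by (auto simp: asymp_alike_def ultrafilter_hull_def dest: coarsely_disjoint_sym)

text \<open>The union of a class is its largest member, hence a canonical representative.\<close>

definition corona_sets :: "'a set set set \<Rightarrow> 'a set set" where
  "corona_sets p = \<Union>p"

lemma Union_asymp_alike:
  assumes "mspace X \<noteq> {}" "coarse_ultrafilter X \<F>"
  shows "\<Union>(asymp_alike X `` {\<F>}) = ultrafilter_hull X \<F>"
proof
  show "\<Union>(asymp_alike X `` {\<F>}) \<subseteq> ultrafilter_hull X \<F>"
    by (auto simp: asymp_alike_def ultrafilter_hull_def
        dest: coarsely_disjoint_sym coarse_ultrafilter_subset)
  show "ultrafilter_hull X \<F> \<subseteq> \<Union>(asymp_alike X `` {\<F>})"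
    using ultrafilter_hull_alike[OF assms] by blast
qed

lemma corona_classI: "coarse_ultrafilter X \<F> \<Longrightarrow> asymp_alike X `` {\<F>} \<in> corona X"
  unfolding corona_def by (auto intro: quotientI)

lemma corona_class_eq:
  assumes "mspace X \<noteq> {}" "coarse_ultrafilter X \<F>" "coarse_ultrafilter X \<G>"
  shows "asymp_alike X `` {\<F>} = asymp_alike X `` {\<G>} \<longleftrightarrow> (\<F>, \<G>) \<in> asymp_alike X"
  using eq_equiv_class_iff[OF asymp_alike_equiv[OF assms(1)]] assms by auto

lemma corona_rep:
  assumes X: "mspace X \<noteq> {}" and p: "p \<in> corona X"
  shows "coarse_ultrafilter X (corona_sets p)" "asymp_alike X `` {corona_sets p} = p"
    "corona_sets p = ultrafilter_hull X (corona_sets p)"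
proof -
  obtain \<F> where F: "coarse_ultrafilter X \<F>" and p': "p = asymp_alike X `` {\<F>}"
    using p unfolding corona_def by (auto elim: quotientE)
  have U: "corona_sets p = ultrafilter_hull X \<F>" unfolding p' corona_sets_def by (rule Union_asymp_alike[OF X F])
  show cu: "coarse_ultrafilter X (corona_sets p)" using U coarse_ultrafilter_hull[OF X F] by simp
  show pe: "asymp_alike X `` {corona_sets p} = p"
    using U ultrafilter_hull_alike[OF X F] p' corona_class_eq[OF X F cu] by simp
  show "corona_sets p = ultrafilter_hull X (corona_sets p)"
    using Union_asymp_alike[OF X cu] pe by (simp add: corona_sets_def)
qed

lemma corona_mem_not_disjoint:
  "mspace X \<noteq> {} \<Longrightarrow> p \<in> corona X \<Longrightarrow> A \<in> corona_sets p \<Longrightarrow> B \<in> corona_sets p \<Longrightarrow> \<not> coarsely_disjoint X A B"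
  by (rule coarse_ultrafilter_not_disjoint[OF corona_rep(1)])

text \<open>Maximality of the canonical representative turns absence of a set into a concrete
  witness. Most later arguments about points start from this \<open>B\<close>.\<close>

lemma corona_notin_iff:
  assumes "mspace X \<noteq> {}" "p \<in> corona X" "A \<subseteq> mspace X"
  shows "A \<notin> corona_sets p \<longleftrightarrow> (\<exists>B\<in>corona_sets p. coarsely_disjoint X A B)"
proof -
  have "A \<in> corona_sets p \<longleftrightarrow> A \<in> ultrafilter_hull X (corona_sets p)" using corona_rep(3)[OF assms(1,2)] by simp
  then show ?thesis using assms(3) by (simp add: ultrafilter_hull_def)
qed

lemma corona_mem_subset: "mspace X \<noteq> {} \<Longrightarrow> p \<in> corona X \<Longrightarrow> A \<in> corona_sets p \<Longrightarrow> A \<subseteq> mspace X"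
  by (rule coarse_ultrafilter_subset[OF corona_rep(1)])

lemma corona_mem_mono:
  assumes "mspace X \<noteq> {}" "p \<in> corona X" "A \<in> corona_sets p" "A \<subseteq> B" "B \<subseteq> mspace X"
  shows "B \<in> corona_sets p"
  using assms corona_notin_iff[of X p] corona_mem_not_disjoint[of X p] corona_mem_subset[of X p A]
    coarsely_disjoint_mono[of X B _ A] by (meson order_refl)

lemma corona_mem_Un:
  assumes X: "mspace X \<noteq> {}" and p: "p \<in> corona X" and "A \<subseteq> mspace X" "B \<subseteq> mspace X"
  shows "A \<union> B \<in> corona_sets p \<longleftrightarrow> A \<in> corona_sets p \<or> B \<in> corona_sets p"
proof
  assume "A \<union> B \<in> corona_sets p"
  then show "A \<in> corona_sets p \<or> B \<in> corona_sets p"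
    using corona_rep(1)[OF X p] assms(3,4) unfolding coarse_ultrafilter_def by blast
next
  assume "A \<in> corona_sets p \<or> B \<in> corona_sets p"
  then show "A \<union> B \<in> corona_sets p"
    using corona_mem_mono[OF X p, of _ "A \<union> B"] assms(3,4) by blast
qed

lemma corona_mem_UN:
  assumes "mspace X \<noteq> {}" "p \<in> corona X" "finite I" "\<And>i. i \<in> I \<Longrightarrow> A i \<subseteq> mspace X"
    "(\<Union>i\<in>I. A i) \<in> corona_sets p"
  obtains i where "i \<in> I" "A i \<in> corona_sets p"
proof -
  have "\<exists>i\<in>I. A i \<in> corona_sets p"
    using assms(3-5)
  proof (induction I rule: finite_induct)
    case empty
    \<comment> \<open>An empty union cannot be a member, because the empty set is coarsely disjoint
      from itself.\<close>
    moreover have "coarsely_disjoint X {} {}"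
      by (simp add: coarsely_disjoint_def cbounded_def entourage_def)
    ultimately show ?case using corona_mem_not_disjoint[OF assms(1,2), of "{}" "{}"] by simp
  next
    case (insert i I)
    then have "A i \<in> corona_sets p \<or> (\<Union>i\<in>I. A i) \<in> corona_sets p"
      using corona_mem_Un[OF assms(1,2), of "A i" "\<Union>i\<in>I. A i"] by auto
    then show ?case using insert by blast
  qed
  then show thesis using that by blast
qed

lemma corona_mem_mspace: "mspace X \<noteq> {} \<Longrightarrow> p \<in> corona X \<Longrightarrow> mspace X \<in> corona_sets p"
  using corona_rep(1)[of X p] by (simp add: coarse_ultrafilter_def)

lemma corona_not_mem_bounded:
  assumes X: "mspace X \<noteq> {}" and p: "p \<in> corona X" and A: "cbounded X A"
  shows "A \<notin> corona_sets p"
proof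
  assume m: "A \<in> corona_sets p"
  obtain z where z: "z \<in> mspace X" using X by blast
  have "coarsely_disjoint X A A"
    using coarsely_disjoint_bounded[OF z A] corona_mem_subset[OF X p m] by blast
  then show False using corona_mem_not_disjoint[OF X p m m] by blast
qed

lemma corona_eqI:
  assumes X: "mspace X \<noteq> {}" and "p \<in> corona X" "q \<in> corona X"
    and "\<And>A B. A \<in> corona_sets p \<Longrightarrow> B \<in> corona_sets q \<Longrightarrow> \<not> coarsely_disjoint X A B"
  shows "p = q"
proof -
  have "(corona_sets p, corona_sets q) \<in> asymp_alike X"
    unfolding asymp_alike_def using corona_rep(1)[OF X] assms by simp
  then show ?thesis
    using corona_class_eq[OF X] corona_rep assms by metis
qed

section \<open>The topology of the corona\<close>

lemma corona_cl_iff: "p \<in> corona_cl X A \<longleftrightarrow> p \<in> corona X \<and> A \<in> corona_sets p"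
  by (auto simp: corona_cl_def corona_sets_def)

text \<open>Maximality supplies the set on the side of \<open>p\<close>, so farness from a point is
  governed by the single set \<open>B\<close>. This is the form in which open sets are handled from
  here on.\<close>

lemma corona_far_point:
  assumes "mspace X \<noteq> {}" "p \<in> corona X"
  shows "corona_far X {p} S \<longleftrightarrow> (\<exists>B. B \<subseteq> mspace X \<and> B \<notin> corona_sets p \<and> S \<subseteq> corona_cl X B)"
proof
  assume "corona_far X {p} S"
  then show "\<exists>B. B \<subseteq> mspace X \<and> B \<notin> corona_sets p \<and> S \<subseteq> corona_cl X B"
    unfolding corona_far_def using corona_mem_not_disjoint[OF assms]
    by (simp add: corona_cl_iff) blast
next
  assume "\<exists>B. B \<subseteq> mspace X \<and> B \<notin> corona_sets p \<and> S \<subseteq> corona_cl X B"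
  then obtain B where B: "B \<subseteq> mspace X" "B \<notin> corona_sets p" "S \<subseteq> corona_cl X B" by blast
  then obtain A where "A \<in> corona_sets p" "coarsely_disjoint X B A"
    using corona_notin_iff[OF assms B(1)] by blast
  then show "corona_far X {p} S"
    unfolding corona_far_def using B assms coarsely_disjoint_sym[of X B A]
      corona_mem_subset[OF assms, of A]
    by (intro exI[of _ A] exI[of _ B]) (simp add: corona_cl_iff)
qed

text \<open>Before \<open>openin\<close> can be unfolded, the family in \<open>corona_space\<close>
  must be shown to be a topology. For an intersection the two witnesses are united: a point contains
  \<open>B \<union> C\<close> only if it contains \<open>B\<close> or \<open>C\<close>.\<close>

lemma openin_corona_space:
  assumes X: "mspace X \<noteq> {}"
  shows "openin (corona_space X) U \<longleftrightarrow> U \<subseteq> corona X \<and>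
    (\<forall>p\<in>U. \<exists>B. B \<subseteq> mspace X \<and> B \<notin> corona_sets p \<and> corona X - U \<subseteq> corona_cl X B)"
proof -
  define P where "P U \<longleftrightarrow> U \<subseteq> corona X \<and>
    (\<forall>p\<in>U. \<exists>B. B \<subseteq> mspace X \<and> B \<notin> corona_sets p \<and> corona X - U \<subseteq> corona_cl X B)" for U
  have eq: "(\<lambda>U. U \<subseteq> corona X \<and> (\<forall>x \<in> U. corona_far X {x} (corona X - U))) = P"
  proof
    fix U
    have "(\<forall>x\<in>U. corona_far X {x} (corona X - U)) \<longleftrightarrow>
        (\<forall>p\<in>U. \<exists>B. B \<subseteq> mspace X \<and> B \<notin> corona_sets p \<and> corona X - U \<subseteq> corona_cl X B)"
      if "U \<subseteq> corona X"
      by (intro ball_cong refl corona_far_point[OF X]) (use that in auto)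
    then show "(U \<subseteq> corona X \<and> (\<forall>x \<in> U. corona_far X {x} (corona X - U))) = P U"
      unfolding P_def by (intro conj_cong refl)
  qed
  have PD: "\<exists>B. B \<subseteq> mspace X \<and> B \<notin> corona_sets p \<and> corona X - U \<subseteq> corona_cl X B" if "P U" "p \<in> U" for U p
    using that by (simp add: P_def)
  have "istopology P"
    unfolding istopology_def
  proof (intro conjI allI impI)
    fix U V assume U: "P U" and V: "P V"
    show "P (U \<inter> V)"
      unfolding P_def
    proof (intro conjI ballI)
      show "U \<inter> V \<subseteq> corona X" using U by (auto simp: P_def)
      fix p assume p: "p \<in> U \<inter> V"
      then have pc: "p \<in> corona X" using U by (auto simp: P_def)
      obtain B where B: "B \<subseteq> mspace X" "B \<notin> corona_sets p" "corona X - U \<subseteq> corona_cl X B"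
        using PD[OF U, of p] p by blast
      obtain C where C: "C \<subseteq> mspace X" "C \<notin> corona_sets p" "corona X - V \<subseteq> corona_cl X C"
        using PD[OF V, of p] p by blast
      have "corona_cl X B \<union> corona_cl X C \<subseteq> corona_cl X (B \<union> C)"
        using corona_mem_Un[OF X] B(1) C(1) by (auto simp: corona_cl_iff)
      moreover have "B \<union> C \<notin> corona_sets p" using corona_mem_Un[OF X pc] B C by blast
      ultimately show "\<exists>B. B \<subseteq> mspace X \<and> B \<notin> corona_sets p \<and> corona X - U \<inter> V \<subseteq> corona_cl X B"
        using B(1,3) C(1,3) by (intro exI[of _ "B \<union> C"]) (simp add: Diff_Int subset_trans)
    qed
  next
    fix \<K> assume K: "\<forall>K\<in>\<K>. P K"
    show "P (\<Union>\<K>)"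
      unfolding P_def
    proof (intro conjI ballI)
      show "\<Union>\<K> \<subseteq> corona X" using K by (auto simp: P_def)
      fix p assume "p \<in> \<Union>\<K>"
      then obtain K where K': "K \<in> \<K>" "p \<in> K" by blast
      then obtain B where "B \<subseteq> mspace X" "B \<notin> corona_sets p" "corona X - K \<subseteq> corona_cl X B"
        using PD K by blast
      then show "\<exists>B. B \<subseteq> mspace X \<and> B \<notin> corona_sets p \<and> corona X - \<Union>\<K> \<subseteq> corona_cl X B"
        using K' by blast
    qed
  qed
  then show ?thesis
    unfolding corona_space_def eq by (simp add: topology_inverse' P_def)
qed

lemma topspace_corona_space:
  assumes X: "mspace X \<noteq> {}"
  shows "topspace (corona_space X) = corona X"
proof
  show "topspace (corona_space X) \<subseteq> corona X"
    using openin_topspace[of "corona_space X"] unfolding openin_corona_space[OF X] by blast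
  have "{} \<notin> corona_sets p" if "p \<in> corona X" for p
    using corona_not_mem_bounded[OF X that, of "{}"] by (simp add: cbounded_def entourage_def)
  then have "openin (corona_space X) (corona X)"
    unfolding openin_corona_space[OF X] by blast
  then show "corona X \<subseteq> topspace (corona_space X)" by (rule openin_subset)
qed

section \<open>Induced maps\<close>

lemma coarse_ultrafilter_pushforward:
  assumes X: "mspace X \<noteq> {}" and f: "coarse_map X Y f" and F: "coarse_ultrafilter X \<F>"
  shows "coarse_ultrafilter Y (pushforward X Y f \<F>)"
proof -
  have m: "f \<in> mspace X \<rightarrow> mspace Y" using f by (simp add: coarse_map_def)
  have "\<not> coarsely_disjoint Y A B" if "A \<in> pushforward X Y f \<F>" "B \<in> pushforward X Y f \<F>" for A B
    using that coarsely_disjoint_vimage[OF X f f close_maps_refl[OF m], of A B]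
      coarse_ultrafilter_not_disjoint[OF F] by (auto simp: pushforward_def)
  moreover have "A \<in> pushforward X Y f \<F> \<or> B \<in> pushforward X Y f \<F>"
    if AB: "A \<subseteq> mspace Y" "B \<subseteq> mspace Y" "A \<union> B \<in> pushforward X Y f \<F>" for A B
  proof -
    have "{x \<in> mspace X. f x \<in> A \<union> B} = {x \<in> mspace X. f x \<in> A} \<union> {x \<in> mspace X. f x \<in> B}" by blast
    then have "{x \<in> mspace X. f x \<in> A} \<union> {x \<in> mspace X. f x \<in> B} \<in> \<F>"
      using AB by (simp add: pushforward_def)
    moreover have "{x \<in> mspace X. f x \<in> A} \<subseteq> mspace X" "{x \<in> mspace X. f x \<in> B} \<subseteq> mspace X" by auto
    ultimately have "{x \<in> mspace X. f x \<in> A} \<in> \<F> \<or> {x \<in> mspace X. f x \<in> B} \<in> \<F>"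
      using F unfolding coarse_ultrafilter_def by blast
    then show ?thesis using AB by (simp add: pushforward_def)
  qed
  moreover have "{x \<in> mspace X. f x \<in> mspace Y} = mspace X" using m by auto
  then have "mspace Y \<in> pushforward X Y f \<F>"
    using F by (simp add: pushforward_def coarse_ultrafilter_def)
  moreover have "pushforward X Y f \<F> \<subseteq> Pow (mspace Y)" by (auto simp: pushforward_def)
  ultimately show ?thesis unfolding coarse_ultrafilter_def by blast
qed

lemma pushforward_alike:
  assumes X: "mspace X \<noteq> {}" and f: "coarse_map X Y f" and g: "coarse_map X Y g"
    and fg: "close_maps X Y f g" and FG: "(\<F>, \<G>) \<in> asymp_alike X"
  shows "(pushforward X Y f \<F>, pushforward X Y g \<G>) \<in> asymp_alike Y"
proof -
  have u: "coarse_ultrafilter X \<F>" "coarse_ultrafilter X \<G>"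
    and d: "\<And>A B. A \<in> \<F> \<Longrightarrow> B \<in> \<G> \<Longrightarrow> \<not> coarsely_disjoint X A B"
    using FG by (auto simp: asymp_alike_def)
  have "\<not> coarsely_disjoint Y A B" if "A \<in> pushforward X Y f \<F>" "B \<in> pushforward X Y g \<G>" for A B
    using that coarsely_disjoint_vimage[OF X f g fg, of A B] d by (auto simp: pushforward_def)
  then show ?thesis
    using coarse_ultrafilter_pushforward[OF X] f g u by (auto simp: asymp_alike_def)
qed

lemma corona_map_class:
  assumes X: "mspace X \<noteq> {}" and Y: "mspace Y \<noteq> {}"
    and f: "coarse_map X Y f" and F: "coarse_ultrafilter X \<F>"
  shows "corona_map X Y (close_rel X Y `` {f}) (asymp_alike X `` {\<F>}) =
    asymp_alike Y `` {pushforward X Y f \<F>}"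
proof -
  have "asymp_alike Y `` {pushforward X Y f' \<F>'} = asymp_alike Y `` {pushforward X Y f \<F>}"
    if "f' \<in> close_rel X Y `` {f}" "\<F>' \<in> asymp_alike X `` {\<F>}" for f' \<F>'
  proof -
    have c: "coarse_map X Y f'" "close_maps X Y f f'" "(\<F>, \<F>') \<in> asymp_alike X" "coarse_ultrafilter X \<F>'"
      using that by (auto simp: close_rel_def asymp_alike_def)
    then have "(pushforward X Y f \<F>, pushforward X Y f' \<F>') \<in> asymp_alike Y"
      by (intro pushforward_alike[OF X f])
    then show ?thesis
      using corona_class_eq[OF Y] coarse_ultrafilter_pushforward[OF X] f F c by metis
  qed
  moreover have "f \<in> close_rel X Y `` {f}"
    using f by (auto simp: close_rel_def coarse_map_def intro!: close_maps_refl)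
  moreover have "\<F> \<in> asymp_alike X `` {\<F>}"
    using F by (auto simp: asymp_alike_def coarse_ultrafilter_def)
  ultimately have "(\<Union>f' \<in> close_rel X Y `` {f}. \<Union>\<F>' \<in> asymp_alike X `` {\<F>}.
      asymp_alike Y `` {pushforward X Y f' \<F>'}) = asymp_alike Y `` {pushforward X Y f \<F>}"
    by blast
  then show ?thesis using corona_classI[OF F] unfolding corona_map_def by simp
qed

lemma corona_map_mem:
  assumes X: "mspace X \<noteq> {}" and Y: "mspace Y \<noteq> {}" and f: "coarse_map X Y f" and p: "p \<in> corona X"
  shows "corona_map X Y (close_rel X Y `` {f}) p \<in> corona Y"
  by (metis X Y f p corona_map_class corona_rep(1,2) coarse_ultrafilter_pushforward corona_classI)

text \<open>The canonical representative of the image point contains the pushforward but may be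
  strictly larger. A member of it may even miss the range of \<open>f\<close>, so membership passes
  through preimages in this direction only.\<close>

lemma corona_map_vimage:
  assumes X: "mspace X \<noteq> {}" and Y: "mspace Y \<noteq> {}" and f: "coarse_map X Y f" and p: "p \<in> corona X"
    and B: "B \<subseteq> mspace Y" "{x \<in> mspace X. f x \<in> B} \<in> corona_sets p"
  shows "B \<in> corona_sets (corona_map X Y (close_rel X Y `` {f}) p)"
proof -
  have u: "coarse_ultrafilter X (corona_sets p)" using corona_rep[OF X p] by blast
  have v: "coarse_ultrafilter Y (pushforward X Y f (corona_sets p))"
    by (rule coarse_ultrafilter_pushforward[OF X f u])
  have "corona_map X Y (close_rel X Y `` {f}) p = asymp_alike Y `` {pushforward X Y f (corona_sets p)}"
    using corona_map_class[OF X Y f u] corona_rep[OF X p] by simp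
  moreover have "pushforward X Y f (corona_sets p) \<in> asymp_alike Y `` {pushforward X Y f (corona_sets p)}"
    using v by (auto simp: asymp_alike_def coarse_ultrafilter_def)
  moreover have "B \<in> pushforward X Y f (corona_sets p)" using B by (simp add: pushforward_def)
  ultimately show ?thesis unfolding corona_sets_def using UnionI by metis
qed

lemma corona_map_image:
  assumes X: "mspace X \<noteq> {}" and Y: "mspace Y \<noteq> {}" and f: "coarse_map X Y f" and p: "p \<in> corona X"
    and A: "A \<in> corona_sets p"
  shows "f ` A \<in> corona_sets (corona_map X Y (close_rel X Y `` {f}) p)"
proof (rule corona_map_vimage[OF X Y f p])
  have "A \<subseteq> mspace X" using corona_mem_subset[OF X p A] .
  then show "f ` A \<subseteq> mspace Y" using f by (auto simp: coarse_map_def)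
  show "{x \<in> mspace X. f x \<in> f ` A} \<in> corona_sets p"
    using \<open>A \<subseteq> mspace X\<close> by (intro corona_mem_mono[OF X p A]) auto
qed

text \<open>The preimage of the witness \<open>B\<close> is not a suitable witness in
  \<open>X\<close>, since \<open>B\<close> belonging to the image of a point does not put the
  preimage of \<open>B\<close> into that point. \<open>B\<close> is therefore enlarged: separate it
  from a member \<open>A\<close> of the image of \<open>p\<close> by a cover
  \<open>D \<union> C\<close>. The preimage of \<open>C\<close> is excluded from \<open>p\<close> by
  \<open>A\<close>; it belongs to every \<open>q\<close> mapped outside \<open>U\<close>, because
  \<open>B\<close> excludes the preimage of \<open>D\<close>.\<close>

lemma corona_map_continuous:
  assumes X: "mspace X \<noteq> {}" and Y: "mspace Y \<noteq> {}" and f: "coarse_map X Y f"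
  shows "continuous_map (corona_space X) (corona_space Y) (corona_map X Y (close_rel X Y `` {f}))"
proof -
  let ?f = "corona_map X Y (close_rel X Y `` {f})"
  note mem = corona_map_mem[OF X Y f] and vi = corona_map_vimage[OF X Y f]
  have "openin (corona_space X) {p \<in> corona X. ?f p \<in> U}" if U: "openin (corona_space Y) U" for U
    unfolding openin_corona_space[OF X]
  proof (intro conjI ballI)
    show "{p \<in> corona X. ?f p \<in> U} \<subseteq> corona X" by blast
    fix p assume "p \<in> {p \<in> corona X. ?f p \<in> U}"
    then have p: "p \<in> corona X" "?f p \<in> U" by auto
    then obtain B where B: "B \<subseteq> mspace Y" "B \<notin> corona_sets (?f p)" "corona Y - U \<subseteq> corona_cl Y B"
      using U unfolding openin_corona_space[OF Y] by blast
    then obtain A where A: "A \<in> corona_sets (?f p)" "coarsely_disjoint Y B A"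
      using corona_notin_iff[OF Y mem[OF p(1)]] by blast
    have As: "A \<subseteq> mspace Y" using corona_mem_subset[OF Y mem[OF p(1)] A(1)] .
    obtain D C where CD: "D \<union> C = mspace Y" "coarsely_disjoint Y B D" "coarsely_disjoint Y A C"
      using coarsely_disjoint_separation[OF Y B(1) As A(2)] by blast
    let ?C = "{x \<in> mspace X. f x \<in> C}" and ?D = "{x \<in> mspace X. f x \<in> D}"
    have cs: "C \<subseteq> mspace Y" "D \<subseteq> mspace Y" using CD by auto
    have "?C \<notin> corona_sets p"
      using vi[OF p(1) cs(1)] corona_mem_not_disjoint[OF Y mem[OF p(1)] A(1)] CD(3) by blast
    moreover have "?C \<in> corona_sets q" if q: "q \<in> corona X" "?f q \<notin> U" for q
    proof -
      have "?f q \<in> corona_cl Y B" using B mem q by blast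
      then have "B \<in> corona_sets (?f q)" by (simp add: corona_cl_iff)
      then have "?D \<notin> corona_sets q"
        using vi[OF q(1) cs(2)] corona_mem_not_disjoint[OF Y mem[OF q(1)]] CD(2) by blast
      moreover have "?D \<union> ?C = mspace X" using CD(1) f by (auto simp: coarse_map_def)
      ultimately show ?thesis
        using coarse_ultrafilter_cases[OF corona_rep(1)[OF X q(1)]] by blast
    qed
    moreover have "?C \<subseteq> mspace X" by blast
    ultimately show "\<exists>B. B \<subseteq> mspace X \<and> B \<notin> corona_sets p \<and>
        corona X - {p \<in> corona X. ?f p \<in> U} \<subseteq> corona_cl X B"
      by (intro exI[of _ ?C]) (simp add: subset_iff corona_cl_iff)
  qed
  then show ?thesis
    using mem by (auto simp: continuous_map_def topspace_corona_space[OF X] topspace_corona_space[OF Y])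
qed

lemma corona_map_hom:
  assumes "mspace X \<noteq> {}" "mspace Y \<noteq> {}" "\<phi> \<in> mcoarse_hom X Y"
  shows "corona_map X Y \<phi> \<in> top_hom (corona_space X) (corona_space Y)"
  using mcoarse_homE[OF assms(3)] corona_map_continuous[OF assms(1,2)]
  by (auto simp: top_hom_def topspace_corona_space assms corona_map_def)

lemma coarse_map_id: "coarse_map X X id"
  by (auto simp: coarse_map_def map_prod.id cbounded_def entourage_def)

lemma corona_functorial: "corona_is_functor TYPE('a)"
  unfolding corona_is_functor_def
proof (intro conjI allI impI)
  fix X Y :: "'a metric" and \<phi>
  assume "mcoarse_obj X \<and> mcoarse_obj Y \<and> \<phi> \<in> mcoarse_hom X Y"
  then show "corona_map X Y \<phi> \<in> top_hom (corona_space X) (corona_space Y)"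
    by (simp add: mcoarse_obj_def corona_map_hom)
next
  fix X :: "'a metric" assume "mcoarse_obj X"
  then have X: "mspace X \<noteq> {}" by (simp add: mcoarse_obj_def)
  show "corona_map X X (mcoarse_id X) = top_id (corona_space X)"
  proof
    fix p
    show "corona_map X X (mcoarse_id X) p = top_id (corona_space X) p"
    proof (cases "p \<in> corona X")
      case True
      note r = corona_rep[OF X True]
      have "pushforward X X id (corona_sets p) = corona_sets p"
      proof -
        have "A \<subseteq> mspace X \<and> {x \<in> mspace X. id x \<in> A} \<in> corona_sets p \<longleftrightarrow> A \<in> corona_sets p" for A
        proof (cases "A \<subseteq> mspace X")
          case True
          then have "{x \<in> mspace X. id x \<in> A} = A" by auto
          then show ?thesis using True by metis
        next
          case False
          then show ?thesis using coarse_ultrafilter_subset[OF r(1)] by blast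
        qed
        then show ?thesis unfolding pushforward_def by blast
      qed
      then show ?thesis
        using corona_map_class[OF X X coarse_map_id r(1)] r(2) True
        by (simp add: mcoarse_id_def top_id_def topspace_corona_space[OF X])
    qed (simp add: corona_map_def top_id_def topspace_corona_space[OF X])
  qed
next
  fix X Y Z :: "'a metric" and \<phi> \<psi>
  assume "mcoarse_obj X \<and> mcoarse_obj Y \<and> mcoarse_obj Z \<and>
    \<phi> \<in> mcoarse_hom X Y \<and> \<psi> \<in> mcoarse_hom Y Z"
  then have X: "mspace X \<noteq> {}" and Y: "mspace Y \<noteq> {}" and Z: "mspace Z \<noteq> {}"
    and h: "\<phi> \<in> mcoarse_hom X Y" "\<psi> \<in> mcoarse_hom Y Z" by (auto simp: mcoarse_obj_def)
  obtain f where f: "coarse_map X Y f" "\<phi> = close_rel X Y `` {f}" using mcoarse_homE[OF h(1)] .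
  obtain g where g: "coarse_map Y Z g" "\<psi> = close_rel Y Z `` {g}" using mcoarse_homE[OF h(2)] .
  show "corona_map X Z (mcoarse_comp X Z \<psi> \<phi>) =
        top_comp (corona_space X) (corona_map Y Z \<psi>) (corona_map X Y \<phi>)"
  proof
    fix p
    show "corona_map X Z (mcoarse_comp X Z \<psi> \<phi>) p =
      top_comp (corona_space X) (corona_map Y Z \<psi>) (corona_map X Y \<phi>) p"
    proof (cases "p \<in> corona X")
      case True
      note r = corona_rep[OF X True]
      have "{x \<in> mspace X. (g \<circ> f) x \<in> A} = {x \<in> mspace X. f x \<in> {y \<in> mspace Y. g y \<in> A}}" for A
        using f by (auto simp: coarse_map_def)
      then have pp: "pushforward X Z (g \<circ> f) (corona_sets p) = pushforward Y Z g (pushforward X Y f (corona_sets p))"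
        unfolding pushforward_def by auto
      have u: "coarse_ultrafilter Y (pushforward X Y f (corona_sets p))"
        by (rule coarse_ultrafilter_pushforward[OF X f(1) r(1)])
      have "corona_map X Z (mcoarse_comp X Z \<psi> \<phi>) p = asymp_alike Z `` {pushforward X Z (g \<circ> f) (corona_sets p)}"
        using corona_map_class[OF X Z coarse_map_comp[OF f(1) g(1)] r(1)] r(2)
        by (simp add: f(2) g(2) mcoarse_comp_class[OF f(1) g(1) X])
      also have "\<dots> = corona_map Y Z \<psi> (corona_map X Y \<phi> p)"
        using corona_map_class[OF X Y f(1) r(1)] corona_map_class[OF Y Z g(1) u] r(2)
        by (simp add: f(2) g(2) pp)
      finally show ?thesis
        using True by (simp add: top_comp_def topspace_corona_space[OF X] compose_def)
    qed (simp add: corona_map_def top_comp_def topspace_corona_space[OF X] compose_def)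
  qed
qed

section \<open>Coproducts of metric spaces\<close>

text \<open>The base point \<open>z\<close> in the last clause only matters when \<open>I\<close> is empty.\<close>

definition coarse_sum ::
  "'i set \<Rightarrow> ('i \<Rightarrow> 'a metric) \<Rightarrow> 'b metric \<Rightarrow> 'b \<Rightarrow> ('i \<Rightarrow> 'a \<Rightarrow> 'b) \<Rightarrow> bool" where
  "coarse_sum I X Z z f \<longleftrightarrow>
     (\<forall>R. \<exists>C. \<forall>i\<in>I. \<forall>x\<in>mspace (X i). \<forall>y\<in>mspace (X i).
        mdist Z (f i x) (f i y) \<le> R \<longrightarrow> mdist (X i) x y \<le> C) \<and>
     (\<forall>R. \<exists>C. \<forall>i\<in>I. \<forall>k\<in>I. \<forall>x\<in>mspace (X i). \<forall>y\<in>mspace (X k).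
        i \<noteq> k \<longrightarrow> mdist Z (f i x) (f k y) \<le> R \<longrightarrow> mdist Z z (f i x) \<le> C) \<and>
     (\<exists>R. \<forall>w\<in>mspace Z. mdist Z z w \<le> R \<or> (\<exists>i\<in>I. \<exists>x\<in>mspace (X i). mdist Z (f i x) w \<le> R))"

lemma coarse_sumD:
  assumes "coarse_sum I X Z z f"
  shows "\<exists>C. \<forall>i\<in>I. \<forall>x\<in>mspace (X i). \<forall>y\<in>mspace (X i).
      mdist Z (f i x) (f i y) \<le> R \<longrightarrow> mdist (X i) x y \<le> C"
    and "\<exists>C. \<forall>i\<in>I. \<forall>k\<in>I. \<forall>x\<in>mspace (X i). \<forall>y\<in>mspace (X k).
      i \<noteq> k \<longrightarrow> mdist Z (f i x) (f k y) \<le> R \<longrightarrow> mdist Z z (f i x) \<le> C"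
    and "\<exists>R. \<forall>w\<in>mspace Z. mdist Z z w \<le> R \<or> (\<exists>i\<in>I. \<exists>x\<in>mspace (X i). mdist Z (f i x) w \<le> R)"
  using spec[OF conjunct1[OF assms[unfolded coarse_sum_def]], of R]
    spec[OF conjunct1[OF conjunct2[OF assms[unfolded coarse_sum_def]]], of R]
    conjunct2[OF conjunct2[OF assms[unfolded coarse_sum_def]]] by this+

section \<open>Constants uniform over a finite family of coarse maps\<close>

lemma finite_uniform_bound:
  fixes P :: "'i \<Rightarrow> real \<Rightarrow> bool"
  assumes "finite I" "\<And>i. i \<in> I \<Longrightarrow> \<exists>C. P i C" "\<And>i C D. P i C \<Longrightarrow> C \<le> D \<Longrightarrow> P i D"
  shows "\<exists>C. \<forall>i\<in>I. P i C"
  using assms(1,2)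
proof (induction I rule: finite_induct)
  case (insert i I)
  then obtain C D where "P i C" "\<forall>k\<in>I. P k D" by blast
  then have "\<forall>k\<in>insert i I. P k (max C D)"
    using assms(3) by (metis insertE max.cobounded1 max.cobounded2)
  then show ?case by blast
qed simp

lemma coarse_map_bornologous:
  assumes "coarse_map X Y f"
  shows "\<exists>C. \<forall>x\<in>mspace X. \<forall>y\<in>mspace X. mdist X x y \<le> R \<longrightarrow> mdist Y (f x) (f y) \<le> C"
proof (cases "mspace X = {}")
  case False
  then obtain p where p: "p \<in> mspace X" by blast
  then have "f p \<in> mspace Y" using assms by (auto simp: coarse_map_def)
  then show ?thesis using assms unfolding coarse_map_iff[OF p \<open>f p \<in> mspace Y\<close>] by blast
qed simp

lemma coarse_map_proper:
  assumes "coarse_map X Y f" "p \<in> mspace X" "q \<in> mspace Y"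
  shows "\<exists>C. \<forall>x\<in>mspace X. mdist Y q (f x) \<le> R \<longrightarrow> mdist X p x \<le> C"
  using assms(1) unfolding coarse_map_iff[OF assms(2,3)] by blast

lemma coarse_map_bornologous_uniform:
  assumes "finite I" "\<And>i. i \<in> I \<Longrightarrow> coarse_map (X i) Y (g i)"
  shows "\<exists>C. \<forall>i\<in>I. \<forall>x\<in>mspace (X i). \<forall>y\<in>mspace (X i).
    mdist (X i) x y \<le> R \<longrightarrow> mdist Y (g i x) (g i y) \<le> C"
proof (rule finite_uniform_bound[OF assms(1)])
  fix i assume i: "i \<in> I"
  then show "\<exists>C. \<forall>x\<in>mspace (X i). \<forall>y\<in>mspace (X i).
    mdist (X i) x y \<le> R \<longrightarrow> mdist Y (g i x) (g i y) \<le> C"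
    by (intro coarse_map_bornologous assms(2) i)
qed (meson order_trans)

lemma coarse_map_proper_uniform:
  assumes "finite I" "\<And>i. i \<in> I \<Longrightarrow> p i \<in> mspace (X i) \<and> coarse_map (X i) Y (g i)" "y \<in> mspace Y"
  shows "\<exists>C. \<forall>i\<in>I. \<forall>x\<in>mspace (X i). mdist Y y (g i x) \<le> R \<longrightarrow> mdist (X i) (p i) x \<le> C"
proof (rule finite_uniform_bound[OF assms(1)])
  fix i assume i: "i \<in> I"
  show "\<exists>C. \<forall>x\<in>mspace (X i). mdist Y y (g i x) \<le> R \<longrightarrow> mdist (X i) (p i) x \<le> C"
    using coarse_map_proper[of "X i" Y "g i" "p i" y] assms(2)[OF i] assms(3) by blast
qed (meson order_trans)

lemma coarse_map_bounded_uniform: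
  assumes "finite I" "\<And>i. i \<in> I \<Longrightarrow> p i \<in> mspace (X i) \<and> coarse_map (X i) Y (g i)" "y \<in> mspace Y"
  shows "\<exists>C. \<forall>i\<in>I. \<forall>x\<in>mspace (X i). mdist (X i) (p i) x \<le> R \<longrightarrow> mdist Y y (g i x) \<le> C"
proof -
  have "\<exists>C. \<forall>i\<in>I. \<forall>x\<in>mspace (X i). \<forall>y\<in>mspace (X i).
      mdist (X i) x y \<le> R \<longrightarrow> mdist Y (g i x) (g i y) \<le> C"
    using assms by (intro coarse_map_bornologous_uniform) auto
  then obtain C where C: "\<forall>i\<in>I. \<forall>x\<in>mspace (X i). \<forall>y\<in>mspace (X i).
      mdist (X i) x y \<le> R \<longrightarrow> mdist Y (g i x) (g i y) \<le> C" by blast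
  obtain D where D: "\<forall>i\<in>I. mdist Y y (g i (p i)) \<le> D"
    using finite_uniform_bound[OF assms(1), of "\<lambda>i C. mdist Y y (g i (p i)) \<le> C"]
    by (meson order_refl order_trans)
  have "mdist Y y (g i x) \<le> D + C"
    if "i \<in> I" "x \<in> mspace (X i)" "mdist (X i) (p i) x \<le> R" for i x
  proof -
    have "g i (p i) \<in> mspace Y" "g i x \<in> mspace Y"
      using assms(2)[OF that(1)] that(2) by (auto simp: coarse_map_def)
    then have "mdist Y y (g i x) \<le> mdist Y y (g i (p i)) + mdist Y (g i (p i)) (g i x)"
      using assms(3) by (intro mdist_triangle)
    also have "\<dots> \<le> D + C" using C D assms(2) that by (intro add_mono) blast+
    finally show ?thesis .
  qed
  then show ?thesis by blast
qed

lemma close_maps_uniform: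
  assumes "finite I" and f: "\<And>i. i \<in> I \<Longrightarrow> coarse_map (X i) Y (f i)"
    and g: "\<And>i. i \<in> I \<Longrightarrow> coarse_map (X i) Y (g i)"
    and cl: "\<And>i. i \<in> I \<Longrightarrow> close_maps (X i) Y (f i) (g i)"
  obtains C where "\<And>i x. i \<in> I \<Longrightarrow> x \<in> mspace (X i) \<Longrightarrow> mdist Y (f i x) (g i x) \<le> C"
proof -
  have "\<exists>C. \<forall>i\<in>I. \<forall>x\<in>mspace (X i). mdist Y (f i x) (g i x) \<le> C"
  proof (rule finite_uniform_bound[OF assms(1)])
    fix i assume i: "i \<in> I"
    have "f i \<in> mspace (X i) \<rightarrow> mspace Y" "g i \<in> mspace (X i) \<rightarrow> mspace Y"
      using f[OF i] g[OF i] by (simp_all add: coarse_map_def)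
    then show "\<exists>C. \<forall>x\<in>mspace (X i). mdist Y (f i x) (g i x) \<le> C"
      using cl[OF i] close_maps_iff by blast
  qed (meson order_trans)
  then show thesis using that by blast
qed

text \<open>\<open>J\<close> and \<open>G\<close> sample \<open>Z\<close> and \<open>Y\<close> over
  a common index set \<open>S\<close>. The map \<open>h\<close> sends \<open>w\<close> to the
  \<open>G\<close>-value of a sample whose \<open>J\<close>-value is near \<open>w\<close>;
  \<open>J\<close> may repeat values, and \<open>a\<close> says that the choice of sample matters
  only up to a bounded error.\<close>

lemma coarse_extension:
  assumes z: "z \<in> mspace Z" and y: "y \<in> mspace Y"
    and J: "J \<in> S \<rightarrow> mspace Z" and G: "G \<in> S \<rightarrow> mspace Y"
    and a: "\<And>R. \<exists>C. \<forall>s\<in>S. \<forall>t\<in>S. mdist Z (J s) (J t) \<le> R \<longrightarrow> mdist Y (G s) (G t) \<le> C"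
    and b: "\<And>R. \<exists>C. \<forall>s\<in>S. mdist Y y (G s) \<le> R \<longrightarrow> mdist Z z (J s) \<le> C"
    and dense: "\<forall>w\<in>mspace Z. \<exists>s\<in>S. mdist Z (J s) w \<le> K"
  obtains h C where "coarse_map Z Y h" "\<forall>s\<in>S. mdist Y (h (J s)) (G s) \<le> C"
proof -
  obtain \<sigma> where sg: "\<And>w. w \<in> mspace Z \<Longrightarrow> \<sigma> w \<in> S" "\<And>w. w \<in> mspace Z \<Longrightarrow> mdist Z (J (\<sigma> w)) w \<le> K"
    using dense by metis
  have Jm: "J s \<in> mspace Z" and Gm: "G s \<in> mspace Y" if "s \<in> S" for s using J G that by auto
  have "coarse_map Z Y (G \<circ> \<sigma>)"
    unfolding coarse_map_iff[OF z y]
  proof (intro conjI allI)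
    show "G \<circ> \<sigma> \<in> mspace Z \<rightarrow> mspace Y" using sg Gm by auto
    fix R
    \<comment> \<open>Replacing \<open>v\<close> and \<open>w\<close> by their chosen samples costs
      \<open>K\<close> at either end.\<close>
    obtain C where C: "\<forall>s\<in>S. \<forall>t\<in>S. mdist Z (J s) (J t) \<le> K + R + K \<longrightarrow> mdist Y (G s) (G t) \<le> C"
      using a by blast
    have "mdist Y ((G \<circ> \<sigma>) v) ((G \<circ> \<sigma>) w) \<le> C" if "v \<in> mspace Z" "w \<in> mspace Z" "mdist Z v w \<le> R" for v w
    proof -
      have "mdist Z (J (\<sigma> v)) (J (\<sigma> w)) \<le> K + R + K"
        using mdist_triangle[of "J (\<sigma> v)" Z v "J (\<sigma> w)"] mdist_triangle[of v Z w "J (\<sigma> w)"]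
          mdist_commute[of Z "J (\<sigma> w)" w] sg(1,2)[OF that(1)] sg(1,2)[OF that(2)] Jm that by force
      then show ?thesis using C sg(1) that by simp
    qed
    then show "\<exists>C. \<forall>x\<in>mspace Z. \<forall>y\<in>mspace Z. mdist Z x y \<le> R \<longrightarrow> mdist Y ((G \<circ> \<sigma>) x) ((G \<circ> \<sigma>) y) \<le> C"
      by blast
    obtain C where C: "\<forall>s\<in>S. mdist Y y (G s) \<le> R \<longrightarrow> mdist Z z (J s) \<le> C" using b by blast
    have "mdist Z z w \<le> C + K" if "w \<in> mspace Z" "mdist Y y ((G \<circ> \<sigma>) w) \<le> R" for w
      using mdist_triangle[of z Z "J (\<sigma> w)" w] C sg(1,2)[OF that(1)] Jm that z by force
    then show "\<exists>C. \<forall>x\<in>mspace Z. mdist Y y ((G \<circ> \<sigma>) x) \<le> R \<longrightarrow> mdist Z z x \<le> C" by blast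
  qed
  \<comment> \<open>The sample chosen for the point \<open>J s\<close> may differ from
    \<open>s\<close>, but its \<open>J\<close>-value lies within \<open>K\<close> of
    \<open>J s\<close>.\<close>
  moreover obtain C where "\<forall>s\<in>S. \<forall>t\<in>S. mdist Z (J s) (J t) \<le> K \<longrightarrow> mdist Y (G s) (G t) \<le> C"
    using a by blast
  then have "\<forall>s\<in>S. mdist Y ((G \<circ> \<sigma>) (J s)) (G s) \<le> C" using sg Jm by simp
  ultimately show thesis using that by blast
qed

text \<open>The disjoint union with one extra point. \<open>None\<close> stands for the base point
  of \<open>Z\<close> in extensions and for the centre of the hedgehog; it also keeps the explicit
  coproduct nonempty when \<open>I\<close> is empty.\<close>

definition sum_points :: "'i set \<Rightarrow> ('i \<Rightarrow> 'a metric) \<Rightarrow> ('i \<times> 'a) option set" where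
  "sum_points I X = insert None (Some ` (SIGMA i:I. mspace (X i)))"

lemma sum_points_cases:
  assumes "s \<in> sum_points I X"
  obtains "s = None" | i x where "s = Some (i, x)" "i \<in> I" "x \<in> mspace (X i)"
  using assms by (auto simp: sum_points_def)

lemma sum_points_simps [simp]:
  "None \<in> sum_points I X" "Some (i, x) \<in> sum_points I X \<longleftrightarrow> i \<in> I \<and> x \<in> mspace (X i)"
  by (auto simp: sum_points_def)

text \<open>It has to be seen that \<open>J\<close>-near samples are \<open>G\<close>-near. Inside
  one summand the first clause of \<open>coarse_sum\<close> bounds the distance in
  \<open>X i\<close>, and \<open>g i\<close> preserves such bounds. Across summands the second
  clause confines both points to a ball about \<open>z\<close>, whose counterparts in
  \<open>Y\<close> lie in a ball about \<open>y\<close>.\<close>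

lemma coarse_sum_extend:
  assumes sum: "coarse_sum I X Z z f" and I: "finite I" and z: "z \<in> mspace Z" and Y: "mspace Y \<noteq> {}"
    and X: "\<And>i. i \<in> I \<Longrightarrow> mspace (X i) \<noteq> {}" and f: "\<And>i. i \<in> I \<Longrightarrow> coarse_map (X i) Z (f i)"
    and g: "\<And>i. i \<in> I \<Longrightarrow> coarse_map (X i) Y (g i)"
  obtains h where "coarse_map Z Y h" "\<And>i. i \<in> I \<Longrightarrow> close_maps (X i) Y (h \<circ> f i) (g i)"
proof -
  obtain y where y: "y \<in> mspace Y" using Y by blast
  have "\<forall>i\<in>I. \<exists>x. x \<in> mspace (X i)" using X by blast
  then obtain p where p: "\<And>i. i \<in> I \<Longrightarrow> p i \<in> mspace (X i)" by metis
  have fm: "f i x \<in> mspace Z" and gm: "g i x \<in> mspace Y" if "i \<in> I" "x \<in> mspace (X i)" for i x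
    using f[OF that(1)] g[OF that(1)] that(2) by (auto simp: coarse_map_def)
  \<comment> \<open>The passage between balls about \<open>z\<close> and balls about
    \<open>y\<close> goes through \<open>X i\<close>: one map is proper, the other sends bounded
    sets to bounded sets.\<close>
  have zy: "\<exists>C. \<forall>i\<in>I. \<forall>x\<in>mspace (X i). mdist Z z (f i x) \<le> R \<longrightarrow> mdist Y y (g i x) \<le> C" for R
  proof -
    obtain C where "\<forall>i\<in>I. \<forall>x\<in>mspace (X i). mdist Z z (f i x) \<le> R \<longrightarrow> mdist (X i) (p i) x \<le> C"
      using coarse_map_proper_uniform[OF I, of p X Z f] p f z by blast
    moreover obtain D where "\<forall>i\<in>I. \<forall>x\<in>mspace (X i). mdist (X i) (p i) x \<le> C \<longrightarrow> mdist Y y (g i x) \<le> D"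
      using coarse_map_bounded_uniform[OF I, of p X Y g] p g y by blast
    ultimately show ?thesis by blast
  qed
  have yz: "\<exists>C. \<forall>i\<in>I. \<forall>x\<in>mspace (X i). mdist Y y (g i x) \<le> R \<longrightarrow> mdist Z z (f i x) \<le> C" for R
  proof -
    obtain C where "\<forall>i\<in>I. \<forall>x\<in>mspace (X i). mdist Y y (g i x) \<le> R \<longrightarrow> mdist (X i) (p i) x \<le> C"
      using coarse_map_proper_uniform[OF I, of p X Y g] p g y by blast
    moreover obtain D where "\<forall>i\<in>I. \<forall>x\<in>mspace (X i). mdist (X i) (p i) x \<le> C \<longrightarrow> mdist Z z (f i x) \<le> D"
      using coarse_map_bounded_uniform[OF I, of p X Z f] p f z by blast
    ultimately show ?thesis by blast
  qed
  define J where "J s = (case s of None \<Rightarrow> z | Some (i, x) \<Rightarrow> f i x)" for s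
  define G where "G s = (case s of None \<Rightarrow> y | Some (i, x) \<Rightarrow> g i x)" for s
  have [simp]: "J None = z" "J (Some (i, x)) = f i x" "G None = y" "G (Some (i, x)) = g i x" for i x
    by (simp_all add: J_def G_def)
  let ?S = "sum_points I X"
  have a: "\<exists>C. \<forall>s\<in>?S. \<forall>t\<in>?S. mdist Z (J s) (J t) \<le> R \<longrightarrow> mdist Y (G s) (G t) \<le> C" for R
  proof -
    obtain A where A: "\<forall>i\<in>I. \<forall>x\<in>mspace (X i). \<forall>x'\<in>mspace (X i).
        mdist Z (f i x) (f i x') \<le> R \<longrightarrow> mdist (X i) x x' \<le> A"
      using coarse_sumD(1)[OF sum, of R] by blast
    obtain B where B: "\<forall>i\<in>I. \<forall>x\<in>mspace (X i). \<forall>x'\<in>mspace (X i).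
        mdist (X i) x x' \<le> A \<longrightarrow> mdist Y (g i x) (g i x') \<le> B"
      using coarse_map_bornologous_uniform[OF I, of X Y g A] g by blast
    obtain D where D: "\<forall>i\<in>I. \<forall>k\<in>I. \<forall>x\<in>mspace (X i). \<forall>x'\<in>mspace (X k).
        i \<noteq> k \<longrightarrow> mdist Z (f i x) (f k x') \<le> R \<longrightarrow> mdist Z z (f i x) \<le> D"
      using coarse_sumD(2)[OF sum, of R] by blast
    \<comment> \<open>\<open>D\<close> covers a partner in another summand, \<open>R\<close> the
      partner \<open>None\<close>, whose sample is \<open>z\<close> itself.\<close>
    obtain E where E: "\<forall>i\<in>I. \<forall>x\<in>mspace (X i). mdist Z z (f i x) \<le> max D R \<longrightarrow> mdist Y y (g i x) \<le> E"
      using zy by blast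
    \<comment> \<open>\<open>B\<close> is for pairs in one summand, \<open>E + E\<close> for pairs
      in two summands via \<open>y\<close>, \<open>E\<close> for \<open>None\<close> and a point,
      and 0 for \<open>None\<close> with itself.\<close>
    define C where "C = max (max B (E + E)) (max E 0)"
    have "mdist Y (G s) (G t) \<le> C" if st: "s \<in> ?S" "t \<in> ?S" and le: "mdist Z (J s) (J t) \<le> R" for s t
      using st(1)
    proof (cases rule: sum_points_cases)
      case s: 1
      from st(2) show ?thesis
      proof (cases rule: sum_points_cases)
        case 1
        then show ?thesis using s y by (simp add: C_def)
      next
        case (2 k x')
        then have "mdist Z z (f k x') \<le> max D R" using s le by simp
        then have "mdist Y y (g k x') \<le> E" using E 2 by blast
        then show ?thesis using s 2 by (simp add: C_def)
      qed
    next
      case s: (2 i x)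
      from st(2) show ?thesis
      proof (cases rule: sum_points_cases)
        case 1
        then have "mdist Z z (f i x) \<le> max D R" using s le mdist_commute[of Z z] by simp
        then have "mdist Y y (g i x) \<le> E" using E s by blast
        then show ?thesis using 1 s mdist_commute[of Y y] by (simp add: C_def)
      next
        case t: (2 k x')
        show ?thesis
        proof (cases "i = k")
          case True
          then have "mdist (X i) x x' \<le> A" using A s t le by simp
          then have "mdist Y (g i x) (g i x') \<le> B" using B s t True by blast
          then show ?thesis using s t True by (simp add: C_def)
        next
          case False
          \<comment> \<open>The second clause bounds only the first point of a pair, so it is
            applied in both orders.\<close>
          have le': "mdist Z (f i x) (f k x') \<le> R" "mdist Z (f k x') (f i x) \<le> R"
            using le s t mdist_commute[of Z "f i x"] by auto
          then have "mdist Z z (f i x) \<le> D" "mdist Z z (f k x') \<le> D"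
            using D s t False by metis+
          then have "mdist Y y (g i x) \<le> E" "mdist Y y (g k x') \<le> E"
            using E s t by (meson max.coboundedI1)+
          then have "mdist Y (g i x) (g k x') \<le> E + E"
            using mdist_triangle[of "g i x" Y y "g k x'"] mdist_commute[of Y "g i x" y] gm s t y by force
          then show ?thesis using s t by (simp add: C_def)
        qed
      qed
    qed
    then show ?thesis by blast
  qed
  have b: "\<exists>C. \<forall>s\<in>?S. mdist Y y (G s) \<le> R \<longrightarrow> mdist Z z (J s) \<le> C" for R
  proof -
    obtain C where "\<forall>i\<in>I. \<forall>x\<in>mspace (X i). mdist Y y (g i x) \<le> R \<longrightarrow> mdist Z z (f i x) \<le> C"
      using yz by blast
    then have "\<forall>s\<in>?S. mdist Y y (G s) \<le> R \<longrightarrow> mdist Z z (J s) \<le> max 0 C"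
      using z by (auto simp: sum_points_def le_max_iff_disj)
    then show ?thesis by blast
  qed
  obtain K where "\<forall>w\<in>mspace Z. mdist Z z w \<le> K \<or> (\<exists>i\<in>I. \<exists>x\<in>mspace (X i). mdist Z (f i x) w \<le> K)"
    using coarse_sumD(3)[OF sum] by blast
  then have c: "\<forall>w\<in>mspace Z. \<exists>s\<in>?S. mdist Z (J s) w \<le> K" by (auto simp: sum_points_def)
  have "J \<in> ?S \<rightarrow> mspace Z" "G \<in> ?S \<rightarrow> mspace Y" using z y fm gm by (auto simp: sum_points_def)
  from coarse_extension[OF z y this a b c]
  obtain h C where h: "coarse_map Z Y h" "\<forall>s\<in>?S. mdist Y (h (J s)) (G s) \<le> C" by metis
  show thesis
  proof (rule that[OF h(1)])
    fix i assume i: "i \<in> I"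
    have "mdist Y (h (f i x)) (g i x) \<le> C" if "x \<in> mspace (X i)" for x
      using bspec[OF h(2), of "Some (i, x)"] i that by simp
    then show "close_maps (X i) Y (h \<circ> f i) (g i)"
      using coarse_map_comp[OF f[OF i] h(1)] g[OF i] by (subst close_maps_iff) (auto simp: coarse_map_def)
  qed
qed

text \<open>Every point of \<open>Z\<close> is within \<open>K\<close> of \<open>z\<close> or of a
  point in some image, and there \<open>h\<close> and \<open>h'\<close> differ by at most
  \<open>C'\<close>. Since both maps are bornologous, moving by \<open>K\<close> adds only
  \<open>A\<close> and \<open>B\<close>.\<close>

lemma coarse_sum_unique:
  assumes sum: "coarse_sum I X Z z f" and I: "finite I" and z: "z \<in> mspace Z"
    and f: "\<And>i. i \<in> I \<Longrightarrow> coarse_map (X i) Z (f i)"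
    and h: "coarse_map Z Y h" and h': "coarse_map Z Y h'"
    and cl: "\<And>i. i \<in> I \<Longrightarrow> close_maps (X i) Y (h \<circ> f i) (h' \<circ> f i)"
  shows "close_maps Z Y h h'"
proof -
  have m: "h \<in> mspace Z \<rightarrow> mspace Y" "h' \<in> mspace Z \<rightarrow> mspace Y" using h h' by (auto simp: coarse_map_def)
  have fm: "f i x \<in> mspace Z" if "i \<in> I" "x \<in> mspace (X i)" for i x
    using f[OF that(1)] that(2) by (auto simp: coarse_map_def)
  obtain C where C: "\<And>i x. i \<in> I \<Longrightarrow> x \<in> mspace (X i) \<Longrightarrow> mdist Y ((h \<circ> f i) x) ((h' \<circ> f i) x) \<le> C"
    using close_maps_uniform[of I X Y "\<lambda>i. h \<circ> f i" "\<lambda>i. h' \<circ> f i"] I cl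
      coarse_map_comp[OF f h] coarse_map_comp[OF f h'] by blast
  obtain K where K: "\<forall>w\<in>mspace Z. mdist Z z w \<le> K \<or> (\<exists>i\<in>I. \<exists>x\<in>mspace (X i). mdist Z (f i x) w \<le> K)"
    using coarse_sumD(3)[OF sum] by blast
  define C' where "C' = max C (mdist Y (h z) (h' z))"
  have K': "\<exists>v\<in>mspace Z. mdist Z v w \<le> K \<and> mdist Y (h v) (h' v) \<le> C'" if w: "w \<in> mspace Z" for w
  proof (cases "mdist Z z w \<le> K")
    case True
    then show ?thesis using z by (auto simp: C'_def)
  next
    case False
    then obtain i x where "i \<in> I" "x \<in> mspace (X i)" "mdist Z (f i x) w \<le> K" using K w by blast
    then show ?thesis using C[of i x] fm by (intro bexI[of _ "f i x"]) (auto simp: C'_def le_max_iff_disj)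
  qed
  obtain A where A: "\<forall>v\<in>mspace Z. \<forall>w\<in>mspace Z. mdist Z v w \<le> K \<longrightarrow> mdist Y (h v) (h w) \<le> A"
    using coarse_map_bornologous[OF h, of K] by blast
  obtain B where B: "\<forall>v\<in>mspace Z. \<forall>w\<in>mspace Z. mdist Z v w \<le> K \<longrightarrow> mdist Y (h' v) (h' w) \<le> B"
    using coarse_map_bornologous[OF h', of K] by blast
  have "mdist Y (h w) (h' w) \<le> A + C' + B" if w: "w \<in> mspace Z" for w
  proof -
    obtain v where v: "v \<in> mspace Z" "mdist Z v w \<le> K" "mdist Y (h v) (h' v) \<le> C'" using K' w by blast
    have "mdist Y (h v) (h w) \<le> A" "mdist Y (h' v) (h' w) \<le> B" using A B v w by blast+
    moreover have "h v \<in> mspace Y" "h w \<in> mspace Y" "h' v \<in> mspace Y" "h' w \<in> mspace Y"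
      using m v w by auto
    ultimately show ?thesis
      using mdist_triangle[of "h w" Y "h v" "h' w"] mdist_triangle[of "h v" Y "h' v" "h' w"]
        mdist_commute[of Y "h w"] v by force
  qed
  then show ?thesis using close_maps_iff[OF m] by blast
qed

section \<open>The universal property in terms of representatives\<close>

lemma mcoarse_cocone_reps:
  assumes "mcoarse_cocone I X Z j"
  obtains f where "\<And>i. i \<in> I \<Longrightarrow> coarse_map (X i) Z (f i)"
    "\<And>i. i \<in> I \<Longrightarrow> j i = close_rel (X i) Z `` {f i}"
proof -
  have "\<forall>i\<in>I. \<exists>f. coarse_map (X i) Z f \<and> j i = close_rel (X i) Z `` {f}"
    using assms by (auto simp: mcoarse_cocone_def elim!: mcoarse_homE)
  then show thesis using that by metis
qed

text \<open>Estimates are made with maps, whereas the coproduct speaks of closeness classes.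
  Uniqueness for maps comes from testing the cocone of the composites \<open>h' \<circ> f i\<close>,
  which the classes of \<open>h\<close> and \<open>h'\<close> both extend.\<close>

lemma mcoarse_coproduct_iff:
  assumes Z: "mspace Z \<noteq> {}" and X: "\<And>i. i \<in> I \<Longrightarrow> mspace (X i) \<noteq> {}"
    and f: "\<And>i. i \<in> I \<Longrightarrow> coarse_map (X i) Z (f i)"
    and j: "\<And>i. i \<in> I \<Longrightarrow> j i = close_rel (X i) Z `` {f i}"
  shows "mcoarse_coproduct TYPE('y) I X Z j \<longleftrightarrow> (\<forall>Y :: 'y metric. mspace Y \<noteq> {} \<longrightarrow>
    (\<forall>g. (\<forall>i\<in>I. coarse_map (X i) Y (g i)) \<longrightarrow>
      (\<exists>h. coarse_map Z Y h \<and> (\<forall>i\<in>I. close_maps (X i) Y (h \<circ> f i) (g i)))) \<and>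
    (\<forall>h h'. coarse_map Z Y h \<and> coarse_map Z Y h' \<and>
      (\<forall>i\<in>I. close_maps (X i) Y (h \<circ> f i) (h' \<circ> f i)) \<longrightarrow> close_maps Z Y h h'))"
    (is "?L \<longleftrightarrow> ?R")
proof -
  have comp: "mcoarse_comp (X i) Y (close_rel Z Y `` {h}) (j i) = close_rel (X i) Y `` {h \<circ> f i}"
    if "i \<in> I" "coarse_map Z Y h" for i h and Y :: "'y metric"
    using j that by (simp add: mcoarse_comp_class[OF f that(2) X])
  have ceq: "mcoarse_comp (X i) Y (close_rel Z Y `` {h}) (j i) = close_rel (X i) Y `` {g} \<longleftrightarrow>
      close_maps (X i) Y (h \<circ> f i) g"
    if "i \<in> I" "coarse_map Z Y h" "coarse_map (X i) Y g" for i h g and Y :: "'y metric"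
    using comp[OF that(1,2)] close_rel_class_eq[OF coarse_map_comp[OF f[OF that(1)] that(2)] that(3)] by simp
  show ?thesis
  proof
    assume L: ?L
    show ?R
    proof (intro allI impI conjI)
      fix Y :: "'y metric" and g
      assume Y: "mspace Y \<noteq> {}" and g: "\<forall>i\<in>I. coarse_map (X i) Y (g i)"
      have "mcoarse_cocone I X Y (\<lambda>i. close_rel (X i) Y `` {g i})"
        using X Y g by (auto simp: mcoarse_cocone_def mcoarse_obj_def mcoarse_homI)
      then obtain \<eta> where eta: "\<eta> \<in> mcoarse_hom Z Y"
          "\<forall>i\<in>I. mcoarse_comp (X i) Y \<eta> (j i) = close_rel (X i) Y `` {g i}"
        using L unfolding mcoarse_coproduct_def by blast
      then obtain h where h: "coarse_map Z Y h" "\<eta> = close_rel Z Y `` {h}"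
        by (auto elim: mcoarse_homE)
      show "\<exists>h. coarse_map Z Y h \<and> (\<forall>i\<in>I. close_maps (X i) Y (h \<circ> f i) (g i))"
        using h eta(2) ceq g by blast
    next
      fix Y :: "'y metric" and h h'
      assume Y: "mspace Y \<noteq> {}" and h: "coarse_map Z Y h \<and> coarse_map Z Y h' \<and>
        (\<forall>i\<in>I. close_maps (X i) Y (h \<circ> f i) (h' \<circ> f i))"
      let ?g = "\<lambda>i. close_rel (X i) Y `` {h' \<circ> f i}"
      have hf: "coarse_map (X i) Y (h' \<circ> f i)" if "i \<in> I" for i
        using coarse_map_comp[OF f[OF that]] h by blast
      then have "mcoarse_cocone I X Y ?g"
        using X Y by (auto simp: mcoarse_cocone_def mcoarse_obj_def intro!: mcoarse_homI)
      then have "\<exists>!\<eta>. \<eta> \<in> mcoarse_hom Z Y \<and> (\<forall>i\<in>I. mcoarse_comp (X i) Y \<eta> (j i) = ?g i)"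
        using L unfolding mcoarse_coproduct_def by blast
      moreover have "\<forall>i\<in>I. mcoarse_comp (X i) Y (close_rel Z Y `` {h}) (j i) = ?g i"
        using ceq hf h by blast
      moreover have "\<forall>i\<in>I. mcoarse_comp (X i) Y (close_rel Z Y `` {h'}) (j i) = ?g i"
        using comp h by blast
      ultimately have "close_rel Z Y `` {h} = close_rel Z Y `` {h'}"
        using mcoarse_homI h by (metis (no_types, lifting))
      then show "close_maps Z Y h h'" using close_rel_class_eq h by blast
    qed
  next
    assume R: ?R
    have "mcoarse_cocone I X Z j"
      using X Z f j by (auto simp: mcoarse_cocone_def mcoarse_obj_def mcoarse_homI)
    moreover have "\<exists>!\<eta>. \<eta> \<in> mcoarse_hom Z Y \<and> (\<forall>i\<in>I. mcoarse_comp (X i) Y \<eta> (j i) = \<gamma> i)"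
      if co: "mcoarse_cocone I X Y \<gamma>" for Y :: "'y metric" and \<gamma>
    proof -
      have Y: "mspace Y \<noteq> {}" using co by (simp add: mcoarse_cocone_def mcoarse_obj_def)
      obtain g where g: "\<And>i. i \<in> I \<Longrightarrow> coarse_map (X i) Y (g i)"
          "\<And>i. i \<in> I \<Longrightarrow> \<gamma> i = close_rel (X i) Y `` {g i}"
        using mcoarse_cocone_reps[OF co] by metis
      obtain h where h: "coarse_map Z Y h" "\<forall>i\<in>I. close_maps (X i) Y (h \<circ> f i) (g i)"
        using R Y g(1) by blast
      show ?thesis
      proof (rule ex1I[of _ "close_rel Z Y `` {h}"])
        show "close_rel Z Y `` {h} \<in> mcoarse_hom Z Y \<and>
            (\<forall>i\<in>I. mcoarse_comp (X i) Y (close_rel Z Y `` {h}) (j i) = \<gamma> i)"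
          using h g ceq mcoarse_homI[OF h(1)] by simp
        fix \<eta> assume eta: "\<eta> \<in> mcoarse_hom Z Y \<and> (\<forall>i\<in>I. mcoarse_comp (X i) Y \<eta> (j i) = \<gamma> i)"
        then obtain h' where h': "coarse_map Z Y h'" "\<eta> = close_rel Z Y `` {h'}"
          by (auto elim: mcoarse_homE)
        have "close_maps (X i) Y (h' \<circ> f i) (h \<circ> f i)" if i: "i \<in> I" for i
        proof -
          have "close_rel (X i) Y `` {h' \<circ> f i} = close_rel (X i) Y `` {h \<circ> f i}"
            using comp[OF i h(1)] comp[OF i h'(1)] eta h' ceq[OF i h(1) g(1)[OF i]] h(2) g(2)[OF i] i by metis
          then show ?thesis
            using close_rel_class_eq coarse_map_comp[OF f[OF i]] h(1) h'(1) by blast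
        qed
        then have "close_maps Z Y h' h" using R Y h(1) h'(1) by blast
        then show "\<eta> = close_rel Z Y `` {h}" using h' close_rel_class_eq[OF h'(1) h(1)] by blast
      qed
    qed
    ultimately show ?L unfolding mcoarse_coproduct_def by blast
  qed
qed

lemma coarse_sum_coproduct:
  assumes "coarse_sum I X Z z f" "finite I" "z \<in> mspace Z" "\<And>i. i \<in> I \<Longrightarrow> mspace (X i) \<noteq> {}"
    and f: "\<And>i. i \<in> I \<Longrightarrow> coarse_map (X i) Z (f i)"
    and j: "\<And>i. i \<in> I \<Longrightarrow> j i = close_rel (X i) Z `` {f i}"
  shows "mcoarse_coproduct TYPE('y) I X Z j"
proof -
  have Z: "mspace Z \<noteq> {}" using assms(3) by blast
  show ?thesis
  proof (rule iffD2[OF mcoarse_coproduct_iff[of Z I X f j]], fact Z, fact assms(4), fact f, fact j,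
      intro allI impI conjI)
    fix Y :: "'y metric" and g
    assume Y: "mspace Y \<noteq> {}" and g: "\<forall>i\<in>I. coarse_map (X i) Y (g i)"
    show "\<exists>h. coarse_map Z Y h \<and> (\<forall>i\<in>I. close_maps (X i) Y (h \<circ> f i) (g i))"
      using coarse_sum_extend[of I X Z z f Y g] assms(1-4) f Y g by metis
  next
    fix Y :: "'y metric" and h h'
    assume "coarse_map Z Y h \<and> coarse_map Z Y h' \<and> (\<forall>i\<in>I. close_maps (X i) Y (h \<circ> f i) (h' \<circ> f i))"
    then show "close_maps Z Y h h'" using coarse_sum_unique[of I X Z z f Y h h'] assms(1-3) f by blast
  qed
qed

text \<open>The hedgehog metric: distinct summands are joined through an extra point \<open>None\<close>, which
  lies at distance 1 from every base point \<open>p i\<close>.\<close>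

definition hedgehog_norm :: "('i \<Rightarrow> 'a metric) \<Rightarrow> ('i \<Rightarrow> 'a) \<Rightarrow> ('i \<times> 'a) option \<Rightarrow> real" where
  "hedgehog_norm X p s = (case s of None \<Rightarrow> 0 | Some (i, x) \<Rightarrow> 1 + mdist (X i) (p i) x)"

definition hedgehog_dist ::
  "('i \<Rightarrow> 'a metric) \<Rightarrow> ('i \<Rightarrow> 'a) \<Rightarrow> ('i \<times> 'a) option \<Rightarrow> ('i \<times> 'a) option \<Rightarrow> real" where
  "hedgehog_dist X p s t =
     (if s \<noteq> None \<and> t \<noteq> None \<and> fst (the s) = fst (the t)
      then mdist (X (fst (the s))) (snd (the s)) (snd (the t))
      else hedgehog_norm X p s + hedgehog_norm X p t)"

lemma hedgehog_simps [simp]: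
  "hedgehog_norm X p None = 0"
  "hedgehog_norm X p (Some (i, x)) = 1 + mdist (X i) (p i) x"
  "hedgehog_dist X p None t = hedgehog_norm X p t"
  "hedgehog_dist X p s None = hedgehog_norm X p s"
  "hedgehog_dist X p (Some (i, x)) (Some (k, y)) =
     (if i = k then mdist (X i) x y else (1 + mdist (X i) (p i) x) + (1 + mdist (X k) (p k) y))"
  by (simp_all add: hedgehog_norm_def hedgehog_dist_def)

lemma hedgehog_norm_nonneg: "0 \<le> hedgehog_norm X p s"
  by (cases s) auto

lemma hedgehog_dist_nonneg: "0 \<le> hedgehog_dist X p s t"
  by (simp add: hedgehog_dist_def hedgehog_norm_nonneg)

lemma hedgehog_dist_commute: "hedgehog_dist X p s t = hedgehog_dist X p t s"
  by (auto simp: hedgehog_dist_def mdist_commute)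

lemma hedgehog_norm_triangle:
  assumes p: "\<And>i. i \<in> I \<Longrightarrow> p i \<in> mspace (X i)" and st: "s \<in> sum_points I X" "t \<in> sum_points I X"
  shows "hedgehog_norm X p t \<le> hedgehog_norm X p s + hedgehog_dist X p s t"
  using st(1)
proof (cases rule: sum_points_cases)
  case 1
  then show ?thesis by simp
next
  case s: (2 i x)
  from st(2) show ?thesis
  proof (cases rule: sum_points_cases)
    case 1
    then show ?thesis using s by (simp add: add_nonneg_nonneg)
  next
    case t: (2 k y)
    show ?thesis using s t p mdist_triangle[of "p i" "X i" x y] by (cases "i = k") simp_all
  qed
qed

lemma hedgehog_Metric_space:
  assumes p: "\<And>i. i \<in> I \<Longrightarrow> p i \<in> mspace (X i)"
  shows "Metric_space (sum_points I X) (hedgehog_dist X p)"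
proof
  show "0 \<le> hedgehog_dist X p s t" for s t by (rule hedgehog_dist_nonneg)
  show "hedgehog_dist X p s t = hedgehog_dist X p t s" for s t by (rule hedgehog_dist_commute)
next
  fix s t assume "s \<in> sum_points I X" "t \<in> sum_points I X"
  \<comment> \<open>The summand 1 keeps \<open>None\<close> at positive distance from the base
    points, and points of different summands at positive distance from each other.\<close>
  moreover have "1 + mdist (X i) x y \<noteq> 0" "(1 + mdist (X i) x y) + (1 + mdist (X k) u v) \<noteq> 0" for i k x y u v
    using mdist_nonneg[of "X i" x y] mdist_nonneg[of "X k" u v] by linarith+
  ultimately show "hedgehog_dist X p s t = 0 \<longleftrightarrow> s = t"
    by (auto elim!: sum_points_cases split: if_splits simp del: add_0)
next
  fix s t u assume m: "s \<in> sum_points I X" "t \<in> sum_points I X" "u \<in> sum_points I X"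
  have tri: "hedgehog_norm X p b \<le> hedgehog_norm X p a + hedgehog_dist X p a b"
    if "a \<in> sum_points I X" "b \<in> sum_points I X" for a b
    using that by (intro hedgehog_norm_triangle p)
  have le: "hedgehog_dist X p s u \<le> hedgehog_norm X p s + hedgehog_norm X p u"
    using m(1)
  proof (cases rule: sum_points_cases)
    case s: (2 i x)
    from m(3) show ?thesis
    proof (cases rule: sum_points_cases)
      case u: (2 k y)
      show ?thesis
        using s u p mdist_triangle[of x "X i" "p i" y] mdist_commute[of "X i" x "p i"]
        by (cases "i = k") simp_all
    qed simp
  qed simp
  show "hedgehog_dist X p s u \<le> hedgehog_dist X p s t + hedgehog_dist X p t u"
  proof (cases "\<exists>i x y z. s = Some (i, x) \<and> t = Some (i, y) \<and> u = Some (i, z)")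
    case True
    then show ?thesis using m mdist_triangle by fastforce
  next
    case False
    \<comment> \<open>Unless all three points share a summand, at least one leg runs through
      \<open>None\<close> and splits into two norms; \<open>tri\<close> handles the other
      leg.\<close>
    then have "hedgehog_dist X p s t = hedgehog_norm X p s + hedgehog_norm X p t \<or>
        hedgehog_dist X p t u = hedgehog_norm X p t + hedgehog_norm X p u"
      by (auto simp: hedgehog_dist_def)
    then show ?thesis
      using le tri[OF m(2,3)] tri[OF m(2,1)] hedgehog_dist_commute[of X p t s] by auto
  qed
qed

section \<open>Copying the hedgehog into the type of the summands\<close>

lemma Metric_space_transfer:
  assumes "Metric_space S d" "inj_on e S"
  shows "Metric_space (e ` S) (\<lambda>a b. d (inv_into S e a) (inv_into S e b))"
proof -
  interpret Metric_space S d by fact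
  show ?thesis
    by standard (use commute triangle assms(2) in \<open>auto simp: inv_into_f_f\<close>)
qed

text \<open>A finite disjoint union of subsets of an infinite type is no larger than the type. This
  is what allows the explicit coproduct to serve as a test space on \<open>'a\<close>.\<close>

lemma sum_points_inj:
  assumes "finite I" "infinite (UNIV :: 'a set)"
  obtains e :: "('i \<times> 'a) option \<Rightarrow> 'a" where "inj_on e (sum_points I X)"
proof -
  have "(card_of I, card_of (UNIV :: 'a set)) \<in> ordLeq"
    using assms card_of_ordLeq_finite ordLeq_total[OF card_of_Well_order card_of_Well_order] by blast
  then have "(card_of (SIGMA i:I. mspace (X i)), card_of (UNIV :: 'a set)) \<in> ordLeq"
    using assms(2) by (intro card_of_Sigma_ordLeq_infinite ballI card_of_mono1) auto
  then obtain g :: "'i \<times> 'a \<Rightarrow> 'a" where g: "inj_on g (SIGMA i:I. mspace (X i))"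
    by (auto simp: card_of_ordLeq[symmetric])
  \<comment> \<open>The shift \<open>h\<close> frees the value \<open>undefined\<close> for the
    image of \<open>None\<close>.\<close>
  obtain h :: "'a \<Rightarrow> 'a" where h: "bij_betw h UNIV (UNIV - {undefined})"
    using infinite_imp_bij_betw[OF assms(2)] by blast
  define e where "e s = (case s of None \<Rightarrow> undefined | Some q \<Rightarrow> h (g q))" for s
  have "inj h" "\<forall>a. undefined \<noteq> h a" "\<forall>a. h a \<noteq> undefined"
    using h unfolding bij_betw_def by blast+
  then have "inj_on e (sum_points I X)"
    using g by (auto simp: e_def sum_points_def inj_on_def)
  then show thesis by (rule that)
qed

lemma coarse_map_isometry:
  assumes "f \<in> mspace X \<rightarrow> mspace Y"
    and "\<And>x y. x \<in> mspace X \<Longrightarrow> y \<in> mspace X \<Longrightarrow> mdist Y (f x) (f y) = mdist X x y"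
  shows "coarse_map X Y f"
proof (cases "mspace X = {}")
  case True
  then have "E = {}" if "entourage X E" for E using that by (auto simp: entourage_def)
  then show ?thesis using True by (auto simp: coarse_map_def entourage_def cbounded_def)
next
  case False
  then obtain p where p: "p \<in> mspace X" by blast
  then have "f p \<in> mspace Y" using assms(1) by blast
  from coarse_map_iff[OF p this] show ?thesis using assms p by auto
qed

text \<open>Covers the case in which the hedgehog may be too large for \<open>'a\<close>. On a
  finite type all distances are bounded, so constant bounds satisfy all three clauses.\<close>

lemma coarse_sum_finite_type:
  fixes X :: "'i \<Rightarrow> 'a metric"
  assumes "finite (UNIV :: 'a set)" "finite I"
  shows "coarse_sum I X (Z :: 'a metric) z f"
proof -
  have bd: "\<exists>C. \<forall>x y. mdist W x y \<le> C" for W :: "'a metric"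
  proof -
    have "finite (range (\<lambda>(x, y). mdist W x y))"
      using assms(1) by (intro finite_imageI) (simp add: finite_prod)
    then have "bdd_above (range (\<lambda>(x, y). mdist W x y))" by (rule bdd_above_finite)
    then show ?thesis by (auto simp: bdd_above_def)
  qed
  have "\<exists>C. \<forall>i\<in>I. \<forall>x y. mdist (X i) x y \<le> C"
    by (rule finite_uniform_bound[OF assms(2)]) (use bd in \<open>blast, meson order_trans\<close>)
  then obtain C where C: "\<forall>i\<in>I. \<forall>x y. mdist (X i) x y \<le> C" by blast
  obtain D where D: "\<forall>x y. mdist Z x y \<le> D" using bd by blast
  show ?thesis
    unfolding coarse_sum_def
    by (intro conjI allI exI[of _ C] exI[of _ D]) (simp_all add: C D)
qed

text \<open>The hedgehog \<open>H\<close> satisfies \<open>coarse_sum\<close> by inspection. The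
  universal property of \<open>Z\<close>, tested on \<open>H\<close>, gives \<open>h\<close>, and
  \<open>coarse_sum_extend\<close> gives \<open>\<kappa>\<close> in the other direction, both
  compatible with the inclusions up to closeness. Uniqueness, tested on \<open>Z\<close> itself,
  makes \<open>\<kappa> \<circ> h\<close> close to the identity, and the three clauses pass from
  \<open>H\<close> to \<open>Z\<close>.\<close>

lemma coarse_coproduct_sum:
  fixes X :: "'i \<Rightarrow> 'a metric" and Z :: "'a metric"
  assumes cop: "mcoarse_coproduct TYPE('a) I X Z j" and I: "finite I" and z: "z \<in> mspace Z"
    and X: "\<And>i. i \<in> I \<Longrightarrow> mspace (X i) \<noteq> {}"
    and f: "\<And>i. i \<in> I \<Longrightarrow> coarse_map (X i) Z (f i)"
    and j: "\<And>i. i \<in> I \<Longrightarrow> j i = close_rel (X i) Z `` {f i}"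
  shows "coarse_sum I X Z z f"
proof (cases "finite (UNIV :: 'a set)")
  case True
  then show ?thesis using I by (rule coarse_sum_finite_type)
next
  case False
  have Z: "mspace Z \<noteq> {}" using z by blast
  have "\<forall>i\<in>I. \<exists>x. x \<in> mspace (X i)" using X by blast
  then obtain p where p: "\<And>i. i \<in> I \<Longrightarrow> p i \<in> mspace (X i)" by metis
  let ?S = "sum_points I X"
  obtain e :: "('i \<times> 'a) option \<Rightarrow> 'a" where e: "inj_on e ?S"
    using sum_points_inj[OF I False] .
  define H where "H = metric (e ` ?S, \<lambda>a b. hedgehog_dist X p (inv_into ?S e a) (inv_into ?S e b))"
  have ms: "Metric_space (e ` ?S) (\<lambda>a b. hedgehog_dist X p (inv_into ?S e a) (inv_into ?S e b))"
    by (rule Metric_space_transfer[OF hedgehog_Metric_space[of I p X] e]) (rule p)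
  have Hm: "mspace H = e ` ?S"
    and Hd': "mdist H = (\<lambda>a b. hedgehog_dist X p (inv_into ?S e a) (inv_into ?S e b))"
    unfolding H_def by (rule Metric_space.mspace_metric[OF ms], rule Metric_space.mdist_metric[OF ms])
  have Hd: "mdist H (e s) (e t) = hedgehog_dist X p s t" if "s \<in> ?S" "t \<in> ?S" for s t
    using that e by (simp add: Hd')
  define \<iota> where "\<iota> i x = e (Some (i, x))" for i x
  have iota: "coarse_map (X i) H (\<iota> i)" if "i \<in> I" for i
    by (rule coarse_map_isometry) (use that in \<open>auto simp: \<iota>_def Hm Hd\<close>)
  have o: "e None \<in> mspace H" by (simp add: Hm)
  have Hsum: "coarse_sum I X H (e None) \<iota>"
    unfolding coarse_sum_def
  proof (intro conjI allI)
    fix R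
    show "\<exists>C. \<forall>i\<in>I. \<forall>x\<in>mspace (X i). \<forall>y\<in>mspace (X i). mdist H (\<iota> i x) (\<iota> i y) \<le> R \<longrightarrow> mdist (X i) x y \<le> C"
      by (intro exI[of _ R]) (simp add: \<iota>_def Hd)
    have "1 + mdist (X i) (p i) x \<le> R" if "1 + mdist (X i) (p i) x + (1 + mdist (X k) (p k) y) \<le> R" for i k x y
      using that mdist_nonneg[of "X k" "p k" y] by linarith
    then show "\<exists>C. \<forall>i\<in>I. \<forall>k\<in>I. \<forall>x\<in>mspace (X i). \<forall>y\<in>mspace (X k). i \<noteq> k \<longrightarrow>
        mdist H (\<iota> i x) (\<iota> k y) \<le> R \<longrightarrow> mdist H (e None) (\<iota> i x) \<le> C"
      by (intro exI[of _ R]) (auto simp: \<iota>_def Hd)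
  next
    have "mdist H a a \<le> 0" if "a \<in> mspace H" for a using that by simp
    then show "\<exists>R. \<forall>w\<in>mspace H. mdist H (e None) w \<le> R \<or> (\<exists>i\<in>I. \<exists>x\<in>mspace (X i). mdist H (\<iota> i x) w \<le> R)"
      by (intro exI[of _ 0]) (fastforce simp: Hm \<iota>_def elim!: sum_points_cases)
  qed
  note iff = mcoarse_coproduct_iff[where ?'y = 'a, of Z I X f j, OF Z X f j, THEN iffD1, OF _ _ _ cop]
  have ex: "\<exists>h. coarse_map Z Y h \<and> (\<forall>i\<in>I. close_maps (X i) Y (h \<circ> f i) (g i))"
    if "mspace Y \<noteq> {}" "\<forall>i\<in>I. coarse_map (X i) Y (g i)" for Y :: "'a metric" and g
    using iff that by blast
  have un: "close_maps Z Y h h'"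
    if "mspace Y \<noteq> {}" "coarse_map Z Y h" "coarse_map Z Y h'"
      "\<forall>i\<in>I. close_maps (X i) Y (h \<circ> f i) (h' \<circ> f i)" for Y :: "'a metric" and h h'
    using iff that by blast
  have Hne: "mspace H \<noteq> {}" using o by blast
  obtain \<kappa> where \<kappa>: "coarse_map H Z \<kappa>" "\<And>i. i \<in> I \<Longrightarrow> close_maps (X i) Z (\<kappa> \<circ> \<iota> i) (f i)"
    using coarse_sum_extend[of I X H "e None" \<iota> Z f] Hsum I o Z X iota f by blast
  obtain h where h: "coarse_map Z H h" "\<And>i. i \<in> I \<Longrightarrow> close_maps (X i) H (h \<circ> f i) (\<iota> i)"
    using ex[OF Hne, of \<iota>] iota by blast
  have \<kappa>h: "coarse_map Z Z (\<kappa> \<circ> h)" using coarse_map_comp[OF h(1) \<kappa>(1)] .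
  have "close_maps Z Z (\<kappa> \<circ> h) id"
  proof (rule un[OF Z \<kappa>h coarse_map_id], rule ballI)
    fix i assume i: "i \<in> I"
    note hf = coarse_map_comp[OF f[OF i] h(1)] and \<kappa>\<iota> = coarse_map_comp[OF iota[OF i] \<kappa>(1)]
    have "close_maps (X i) Z (\<kappa> \<circ> (h \<circ> f i)) (\<kappa> \<circ> \<iota> i)"
      using \<kappa>(1) by (intro close_maps_comp[OF hf iota[OF i] h(2)[OF i] \<kappa>(1) \<kappa>(1)] close_maps_refl X i)
        (simp add: coarse_map_def)
    then have "close_rel (X i) Z `` {\<kappa> \<circ> (h \<circ> f i)} = close_rel (X i) Z `` {f i}"
      using close_rel_class_eq[OF coarse_map_comp[OF hf \<kappa>(1)] \<kappa>\<iota>]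
        close_rel_class_eq[OF \<kappa>\<iota> f[OF i]] \<kappa>(2)[OF i] by simp
    then show "close_maps (X i) Z (\<kappa> \<circ> h \<circ> f i) (id \<circ> f i)"
      using close_rel_class_eq[OF coarse_map_comp[OF hf \<kappa>(1)] f[OF i]] by (simp add: comp_assoc)
  qed
  then obtain L where L: "\<And>w. w \<in> mspace Z \<Longrightarrow> mdist Z (\<kappa> (h w)) w \<le> L"
    using close_maps_iff[of "\<kappa> \<circ> h" Z Z id] \<kappa>h by (auto simp: coarse_map_def)
  obtain K where K: "\<And>i x. i \<in> I \<Longrightarrow> x \<in> mspace (X i) \<Longrightarrow> mdist H ((h \<circ> f i) x) (\<iota> i x) \<le> K"
    using close_maps_uniform[of I X H "\<lambda>i. h \<circ> f i" \<iota>] I h(2) coarse_map_comp[OF f h(1)] iota by blast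
  obtain M where M: "\<And>i x. i \<in> I \<Longrightarrow> x \<in> mspace (X i) \<Longrightarrow> mdist Z ((\<kappa> \<circ> \<iota> i) x) (f i x) \<le> M"
    using close_maps_uniform[of I X Z "\<lambda>i. \<kappa> \<circ> \<iota> i" f] I \<kappa>(2) coarse_map_comp[OF iota \<kappa>(1)] f by blast
  have hm: "h w \<in> mspace H" if "w \<in> mspace Z" for w using h(1) that by (auto simp: coarse_map_def)
  have \<kappa>m: "\<kappa> a \<in> mspace Z" if "a \<in> mspace H" for a using \<kappa>(1) that by (auto simp: coarse_map_def)
  have fm: "f i x \<in> mspace Z" and im: "\<iota> i x \<in> mspace H" if "i \<in> I" "x \<in> mspace (X i)" for i x
    using f[OF that(1)] iota[OF that(1)] that(2) by (auto simp: coarse_map_def)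
  \<comment> \<open>Since \<open>h\<close> sends \<open>f i x\<close> near
    \<open>\<iota> i x\<close>, nearness in \<open>Z\<close> is inherited by \<open>H\<close>, where
    the clauses can be read off.\<close>
  have reflect: "\<exists>C. \<forall>i\<in>I. \<forall>k\<in>I. \<forall>x\<in>mspace (X i). \<forall>y\<in>mspace (X k).
      mdist Z (f i x) (f k y) \<le> R \<longrightarrow> mdist H (\<iota> i x) (\<iota> k y) \<le> C" for R
  proof -
    obtain A where A: "\<forall>v\<in>mspace Z. \<forall>w\<in>mspace Z. mdist Z v w \<le> R \<longrightarrow> mdist H (h v) (h w) \<le> A"
      using coarse_map_bornologous[OF h(1), of R] by blast
    have "mdist H (\<iota> i x) (\<iota> k y) \<le> K + A + K"
      if ik: "i \<in> I" "k \<in> I" "x \<in> mspace (X i)" "y \<in> mspace (X k)" and R: "mdist Z (f i x) (f k y) \<le> R"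
      for i k x y
    proof -
      have "mdist H (h (f i x)) (h (f k y)) \<le> A" using A fm ik R by blast
      then show ?thesis
        using mdist_triangle[of "\<iota> i x" H "h (f i x)" "\<iota> k y"]
          mdist_triangle[of "h (f i x)" H "h (f k y)" "\<iota> k y"] K[of i x] K[of k y] ik
          mdist_commute[of H "\<iota> i x"] hm[OF fm] im by fastforce
    qed
    then show ?thesis by blast
  qed
  show ?thesis
    unfolding coarse_sum_def
  proof (intro conjI allI)
    fix R
    obtain C where C: "\<forall>i\<in>I. \<forall>k\<in>I. \<forall>x\<in>mspace (X i). \<forall>y\<in>mspace (X k).
      mdist Z (f i x) (f k y) \<le> R \<longrightarrow> mdist H (\<iota> i x) (\<iota> k y) \<le> C" using reflect by blast
    have "mdist (X i) x y \<le> C"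
      if "i \<in> I" "x \<in> mspace (X i)" "y \<in> mspace (X i)" "mdist Z (f i x) (f i y) \<le> R" for i x y
    proof -
      have "mdist H (\<iota> i x) (\<iota> i y) \<le> C" using C that by blast
      then show ?thesis using that by (simp add: \<iota>_def Hd)
    qed
    then show "\<exists>C. \<forall>i\<in>I. \<forall>x\<in>mspace (X i). \<forall>y\<in>mspace (X i).
        mdist Z (f i x) (f i y) \<le> R \<longrightarrow> mdist (X i) x y \<le> C"
      by blast
    obtain D where D: "\<forall>i\<in>I. \<forall>k\<in>I. \<forall>x\<in>mspace (X i). \<forall>y\<in>mspace (X k). i \<noteq> k \<longrightarrow>
        mdist H (\<iota> i x) (\<iota> k y) \<le> C \<longrightarrow> mdist H (e None) (\<iota> i x) \<le> D"
      using coarse_sumD(2)[OF Hsum, of C] by blast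
    obtain B where B: "\<forall>a\<in>mspace H. \<forall>b\<in>mspace H. mdist H a b \<le> D \<longrightarrow> mdist Z (\<kappa> a) (\<kappa> b) \<le> B"
      using coarse_map_bornologous[OF \<kappa>(1), of D] by blast
    have "mdist Z z (f i x) \<le> mdist Z z (\<kappa> (e None)) + B + M"
      if ik: "i \<in> I" "k \<in> I" "x \<in> mspace (X i)" "y \<in> mspace (X k)" "i \<noteq> k"
        and R: "mdist Z (f i x) (f k y) \<le> R" for i k x y
    proof -
      have "mdist H (\<iota> i x) (\<iota> k y) \<le> C" using C ik R by blast
      then have "mdist H (e None) (\<iota> i x) \<le> D" using D ik by metis
      then have "mdist Z (\<kappa> (e None)) (\<kappa> (\<iota> i x)) \<le> B" using B o im ik by blast
      then show ?thesis
        using mdist_triangle[of z Z "\<kappa> (e None)" "f i x"]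
          mdist_triangle[of "\<kappa> (e None)" Z "\<kappa> (\<iota> i x)" "f i x"] M[of i x] ik z \<kappa>m[OF o] \<kappa>m[OF im] fm
        by fastforce
    qed
    then show "\<exists>C. \<forall>i\<in>I. \<forall>k\<in>I. \<forall>x\<in>mspace (X i). \<forall>y\<in>mspace (X k). i \<noteq> k \<longrightarrow>
        mdist Z (f i x) (f k y) \<le> R \<longrightarrow> mdist Z z (f i x) \<le> C"
      by blast
  next
    \<comment> \<open>If \<open>h w\<close> is the centre of \<open>H\<close>, then \<open>w\<close>
      is within \<open>L\<close> of \<open>\<kappa> (e None)\<close>, which gives the first term.
      Otherwise \<open>h w = \<iota> i x\<close>, and \<open>w\<close> is within
      \<open>M + L\<close> of \<open>f i x\<close>.\<close>
    let ?N = "max (mdist Z z (\<kappa> (e None)) + L) (M + L)"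
    have "mdist Z z w \<le> ?N \<or> (\<exists>i\<in>I. \<exists>x\<in>mspace (X i). mdist Z (f i x) w \<le> ?N)"
      if w: "w \<in> mspace Z" for w
    proof -
      obtain s where s: "s \<in> ?S" "h w = e s" using hm[OF w] Hm by blast
      from s(1) show ?thesis
      proof (cases rule: sum_points_cases)
        case 1
        then show ?thesis
          using mdist_triangle[OF z \<kappa>m[OF o] w] L[OF w] s(2) by auto
      next
        case (2 i x)
        then have "mdist Z (f i x) w \<le> mdist Z (f i x) (\<kappa> (\<iota> i x)) + mdist Z (\<kappa> (\<iota> i x)) w"
          using fm im \<kappa>m w by (intro mdist_triangle) auto
        also have "\<dots> \<le> M + L"
          using M[OF 2(2,3)] L[OF w] s(2) 2(1) mdist_commute[of Z "f i x"] by (simp add: \<iota>_def)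
        finally show ?thesis using 2 by fastforce
      qed
    qed
    then show "\<exists>R. \<forall>w\<in>mspace Z. mdist Z z w \<le> R \<or> (\<exists>i\<in>I. \<exists>x\<in>mspace (X i). mdist Z (f i x) w \<le> R)"
      by blast
  qed
qed

section \<open>Coproducts of topological spaces\<close>

text \<open>The disjoint union of the \<open>S i\<close> corresponds bijectively to
  \<open>T\<close>, which determines the mediating map; that \<open>T\<close> carries the final
  topology for the maps \<open>k i\<close> makes it continuous.\<close>

lemma top_coproductI:
  assumes k: "\<And>i. i \<in> I \<Longrightarrow> k i \<in> top_hom (S i) T"
    and inj: "\<And>i i' q q'. i \<in> I \<Longrightarrow> i' \<in> I \<Longrightarrow> q \<in> topspace (S i) \<Longrightarrow> q' \<in> topspace (S i') \<Longrightarrow>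
      k i q = k i' q' \<Longrightarrow> i = i' \<and> q = q'"
    and surj: "\<And>p. p \<in> topspace T \<Longrightarrow> \<exists>i\<in>I. \<exists>q\<in>topspace (S i). k i q = p"
    and final: "\<And>U. U \<subseteq> topspace T \<Longrightarrow>
      (\<And>i. i \<in> I \<Longrightarrow> openin (S i) {q \<in> topspace (S i). k i q \<in> U}) \<Longrightarrow> openin T U"
  shows "top_coproduct TYPE('t) I S T k"
proof -
  have km: "k i q \<in> topspace T" if "i \<in> I" "q \<in> topspace (S i)" for i q
    using k[OF that(1)] that(2) by (auto simp: top_hom_def continuous_map_def)
  have "\<exists>!h. h \<in> top_hom T W \<and> (\<forall>i\<in>I. top_comp (S i) h (k i) = g i)"
    if co: "top_cocone I S W g" for W :: "'t topology" and g
  proof -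
    have g: "g i \<in> extensional (topspace (S i))" "continuous_map (S i) W (g i)" if "i \<in> I" for i
      using co that by (auto simp: top_cocone_def top_hom_def)
    obtain a b where ab: "\<And>p. p \<in> topspace T \<Longrightarrow> a p \<in> I \<and> b p \<in> topspace (S (a p)) \<and> k (a p) (b p) = p"
      using surj by metis
    define h where "h = (\<lambda>p\<in>topspace T. g (a p) (b p))"
    have hk: "h (k i q) = g i q" if "i \<in> I" "q \<in> topspace (S i)" for i q
    proof -
      have "a (k i q) = i \<and> b (k i q) = q"
        using ab[OF km[OF that]] inj[of "a (k i q)" i "b (k i q)" q] that by simp
      then show ?thesis using km[OF that] by (simp add: h_def)
    qed
    have "continuous_map T W h"
      unfolding continuous_map_def
    proof (intro conjI allI impI)
      show "h \<in> topspace T \<rightarrow> topspace W"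
        using ab g(2) by (auto simp: h_def continuous_map_def)
      fix V assume V: "openin W V"
      show "openin T {p \<in> topspace T. h p \<in> V}"
      proof (rule final)
        fix i assume i: "i \<in> I"
        have "{q \<in> topspace (S i). k i q \<in> {p \<in> topspace T. h p \<in> V}} = {q \<in> topspace (S i). g i q \<in> V}"
          using hk[OF i] km[OF i] by auto
        then show "openin (S i) {q \<in> topspace (S i). k i q \<in> {p \<in> topspace T. h p \<in> V}}"
          using openin_continuous_map_preimage[OF g(2)[OF i] V] by simp
      qed auto
    qed
    then have hT: "h \<in> top_hom T W" by (simp add: top_hom_def h_def)
    show ?thesis
    proof (rule ex1I[of _ h])
      show "h \<in> top_hom T W \<and> (\<forall>i\<in>I. top_comp (S i) h (k i) = g i)"
        using hT hk g(1) by (auto simp: top_comp_def compose_def extensional_def)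
      fix h' assume h': "h' \<in> top_hom T W \<and> (\<forall>i\<in>I. top_comp (S i) h' (k i) = g i)"
      show "h' = h"
      proof (rule extensionalityI[of h' "topspace T"])
        show "h' \<in> extensional (topspace T)" "h \<in> extensional (topspace T)"
          using h' hT by (auto simp: top_hom_def)
        fix p assume "p \<in> topspace T"
        then obtain i q where iq: "i \<in> I" "q \<in> topspace (S i)" "k i q = p" using surj by blast
        have "top_comp (S i) h' (k i) q = g i q" using h' iq(1) by simp
        then show "h' p = h p" using hk[OF iq(1,2)] iq by (simp add: top_comp_def compose_def)
      qed
    qed
  qed
  then show ?thesis using k by (simp add: top_coproduct_def top_cocone_def)
qed

text \<open>Every map into an indiscrete space is continuous, so a two-element universe of test points
  already detects the underlying bijection.\<close>

lemma top_coproduct_bijection: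
  fixes a b :: 'u
  assumes cop: "top_coproduct TYPE('u) I S T k" and ab: "a \<noteq> b"
  shows top_coproduct_inj: "\<And>i i' q q'. i \<in> I \<Longrightarrow> i' \<in> I \<Longrightarrow> q \<in> topspace (S i) \<Longrightarrow>
      q' \<in> topspace (S i') \<Longrightarrow> k i q = k i' q' \<Longrightarrow> i = i' \<and> q = q'"
    and top_coproduct_surj: "\<And>p. p \<in> topspace T \<Longrightarrow> \<exists>i\<in>I. \<exists>q\<in>topspace (S i). k i q = p"
proof -
  \<comment> \<open>Pulling back along the constant map yields the indiscrete topology on the whole
    type.\<close>
  define W where "W = pullback_topology UNIV (\<lambda>_ :: 'u. ()) (discrete_topology UNIV)"
  have cont: "continuous_map V W \<phi>" for V :: "'v topology" and \<phi>
    unfolding W_def by (intro continuous_map_pullback') (auto simp: comp_def)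
  have hom: "restrict \<phi> (topspace V) \<in> top_hom V W" for V :: "'v topology" and \<phi>
    by (simp add: top_hom_def cont)
  have ex1: "\<exists>!h. h \<in> top_hom T W \<and> (\<forall>i\<in>I. top_comp (S i) h (k i) = g i)"
    if "top_cocone I S W g" for g
    using cop that unfolding top_coproduct_def by blast
  have km: "k i q \<in> topspace T" if "i \<in> I" "q \<in> topspace (S i)" for i q
    using cop that by (auto simp: top_coproduct_def top_cocone_def top_hom_def continuous_map_def)
  show "i = i' \<and> q = q'"
    if i: "i \<in> I" "i' \<in> I" "q \<in> topspace (S i)" "q' \<in> topspace (S i')" "k i q = k i' q'" for i i' q q'
  proof (rule ccontr)
    assume ne: "\<not> (i = i' \<and> q = q')"
    \<comment> \<open>The cocone marks the single point \<open>q\<close> of \<open>S i\<close>. A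
      mediating map would have to take both values at the common image
      \<open>k i q = k i' q'\<close>.\<close>
    define g where "g l = (\<lambda>s\<in>topspace (S l). if l = i \<and> s = q then a else b)" for l
    have "top_cocone I S W g" unfolding top_cocone_def g_def by (intro ballI hom)
    then obtain h where "\<forall>l\<in>I. top_comp (S l) h (k l) = g l" using ex1 by blast
    then have "top_comp (S i) h (k i) q = g i q" "top_comp (S i') h (k i') q' = g i' q'"
      using i by simp_all
    then show False using i ne ab by (auto simp: top_comp_def compose_def g_def split: if_splits)
  qed
  show "\<exists>i\<in>I. \<exists>q\<in>topspace (S i). k i q = p" if p: "p \<in> topspace T" for p
  proof (rule ccontr)
    assume ne: "\<not> ?thesis"
    define g where "g l = (\<lambda>s\<in>topspace (S l). a)" for l
    \<comment> \<open>The two maps differ only at \<open>p\<close>, which no \<open>k i\<close>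
      reaches, so they mediate the same cocone.\<close>
    define h h' where "h = (\<lambda>t\<in>topspace T. a)" and "h' = (\<lambda>t\<in>topspace T. if t = p then b else a)"
    have "top_cocone I S W g" unfolding top_cocone_def g_def by (intro ballI hom)
    moreover have "h \<in> top_hom T W" "h' \<in> top_hom T W" unfolding h_def h'_def by (intro hom)+
    moreover have "\<forall>i\<in>I. top_comp (S i) h (k i) = g i"
      using km by (auto simp: top_comp_def compose_def g_def h_def restrict_def)
    moreover have "\<forall>i\<in>I. top_comp (S i) h' (k i) = g i"
      using km ne by (fastforce simp: top_comp_def compose_def g_def h'_def restrict_def)
    ultimately have "h = h'" using ex1 by metis
    then have "h p = h' p" by simp
    then show False using p ab by (simp add: h_def h'_def)
  qed
qed

section \<open>Preservation\<close>

text \<open>A thickened point within \<open>R\<close> of \<open>B\<close> comes from a point of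
  \<open>A\<close> within \<open>K + R\<close> of \<open>B\<close>. This permits passing from a
  neighbourhood of an image to the image itself.\<close>

lemma coarsely_disjoint_thicken:
  assumes z: "z \<in> mspace Z" and A: "A \<subseteq> mspace Z" and B: "B \<subseteq> mspace Z" and AB: "coarsely_disjoint Z A B"
  shows "coarsely_disjoint Z {w \<in> mspace Z. \<exists>a\<in>A. mdist Z a w \<le> K} B"
proof (subst coarsely_disjoint_iff[OF z _ B], blast, rule allI)
  fix R
  obtain C where C: "\<forall>a\<in>A. \<forall>b\<in>B. mdist Z a b \<le> K + R \<longrightarrow> mdist Z z a \<le> C"
    using spec[OF iffD1[OF coarsely_disjoint_iff[OF z A B] AB], of "K + R"] by blast
  have "mdist Z z w \<le> C + K"
    if "a \<in> A" "w \<in> mspace Z" "mdist Z a w \<le> K" "b \<in> B" "mdist Z w b \<le> R" for a b w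
  proof -
    have m: "a \<in> mspace Z" "b \<in> mspace Z" using that A B by auto
    have "mdist Z a b \<le> K + R" using mdist_triangle[OF m(1) that(2) m(2)] that by simp
    then have "mdist Z z a \<le> C" using C that by blast
    then show ?thesis using mdist_triangle[OF z m(1) that(2)] that by simp
  qed
  then show "\<exists>C. \<forall>w\<in>{w \<in> mspace Z. \<exists>a\<in>A. mdist Z a w \<le> K}. \<forall>b\<in>B. mdist Z w b \<le> R \<longrightarrow> mdist Z z w \<le> C"
    by blast
qed

lemma corona_class_mem:
  assumes "coarse_ultrafilter X \<F>" "A \<in> \<F>"
  shows "A \<in> corona_sets (asymp_alike X `` {\<F>})"
  using assms by (auto simp: corona_sets_def asymp_alike_def coarse_ultrafilter_def)

section \<open>Injectivity, surjectivity and the final topology on coronas\<close>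

context
  fixes I :: "'i set" and X :: "'i \<Rightarrow> 'a metric" and Z :: "'b metric" and z :: 'b and f
  assumes sum: "coarse_sum I X Z z f" and I: "finite I" and z: "z \<in> mspace Z"
    and X: "\<And>i. i \<in> I \<Longrightarrow> mspace (X i) \<noteq> {}" and f: "\<And>i. i \<in> I \<Longrightarrow> coarse_map (X i) Z (f i)"
begin

lemma coarse_sum_map_mem: "i \<in> I \<Longrightarrow> A \<subseteq> mspace (X i) \<Longrightarrow> f i ` A \<subseteq> mspace Z"
  using f[of i] unfolding coarse_map_def by blast

text \<open>The first clause pulls near points of the two images back to near points of
  \<open>A\<close> and \<open>B\<close>. Coarse disjointness confines these to a ball in
  \<open>X i\<close>, which \<open>f i\<close> maps into a ball about \<open>z\<close>.\<close>

lemma coarse_sum_image_disjoint: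
  assumes i: "i \<in> I" and A: "A \<subseteq> mspace (X i)" and B: "B \<subseteq> mspace (X i)"
    and AB: "coarsely_disjoint (X i) A B"
  shows "coarsely_disjoint Z (f i ` A) (f i ` B)"
proof -
  obtain p where p: "p \<in> mspace (X i)" using X[OF i] by blast
  show ?thesis
  proof (subst coarsely_disjoint_iff[OF z coarse_sum_map_mem[OF i A] coarse_sum_map_mem[OF i B]], rule allI)
    fix R
    obtain C where C: "\<forall>i\<in>I. \<forall>x\<in>mspace (X i). \<forall>y\<in>mspace (X i).
      mdist Z (f i x) (f i y) \<le> R \<longrightarrow> mdist (X i) x y \<le> C"
      using coarse_sumD(1)[OF sum, of R] by blast
    obtain D where D: "\<forall>a\<in>A. \<forall>b\<in>B. mdist (X i) a b \<le> C \<longrightarrow> mdist (X i) p a \<le> D"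
      using spec[OF iffD1[OF coarsely_disjoint_iff[OF p A B] AB], of C] by blast
    obtain E where "\<forall>k\<in>{i}. \<forall>x\<in>mspace (X k). mdist (X k) p x \<le> D \<longrightarrow> mdist Z z (f k x) \<le> E"
      using coarse_map_bounded_uniform[of "{i}" "\<lambda>_. p" X Z f z D] p f[OF i] z by auto
    then have E: "mdist Z z (f i x) \<le> E" if "x \<in> mspace (X i)" "mdist (X i) p x \<le> D" for x using that by blast
    have "mdist Z z (f i a) \<le> E" if "a \<in> A" "b \<in> B" "mdist Z (f i a) (f i b) \<le> R" for a b
    proof -
      have "mdist (X i) a b \<le> C" using C i A B that by blast
      then show ?thesis using D E A that by blast
    qed
    then show "\<exists>C. \<forall>a\<in>f i ` A. \<forall>b\<in>f i ` B. mdist Z a b \<le> R \<longrightarrow> mdist Z z a \<le> C" by blast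
  qed
qed

lemma coarse_sum_cross_disjoint:
  assumes i: "i \<in> I" and k: "k \<in> I" and ne: "i \<noteq> k" and A: "A \<subseteq> mspace (X i)" and B: "B \<subseteq> mspace (X k)"
  shows "coarsely_disjoint Z (f i ` A) (f k ` B)"
proof (subst coarsely_disjoint_iff[OF z coarse_sum_map_mem[OF i A] coarse_sum_map_mem[OF k B]], rule allI)
  fix R
  obtain C where C: "\<forall>i\<in>I. \<forall>k\<in>I. \<forall>x\<in>mspace (X i). \<forall>y\<in>mspace (X k). i \<noteq> k \<longrightarrow>
      mdist Z (f i x) (f k y) \<le> R \<longrightarrow> mdist Z z (f i x) \<le> C"
    using coarse_sumD(2)[OF sum, of R] by blast
  have "mdist Z z (f i a) \<le> C" if "a \<in> A" "b \<in> B" "mdist Z (f i a) (f k b) \<le> R" for a b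
    using C i k ne A B that by (meson subsetD)
  then show "\<exists>C. \<forall>a\<in>f i ` A. \<forall>b\<in>f k ` B. mdist Z a b \<le> R \<longrightarrow> mdist Z z a \<le> C" by blast
qed

abbreviation corona_incl :: "'i \<Rightarrow> 'a set set set \<Rightarrow> 'b set set set" where
  "corona_incl i \<equiv> corona_map (X i) Z (close_rel (X i) Z `` {f i})"

lemma Z_nonempty: "mspace Z \<noteq> {}"
  using z by blast

lemma corona_incl_mem: "i \<in> I \<Longrightarrow> q \<in> corona (X i) \<Longrightarrow> corona_incl i q \<in> corona Z"
    by (rule corona_map_mem[OF X Z_nonempty f])

lemma corona_incl_image:
  "i \<in> I \<Longrightarrow> q \<in> corona (X i) \<Longrightarrow> A \<in> corona_sets q \<Longrightarrow> f i ` A \<in> corona_sets (corona_incl i q)"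
    by (rule corona_map_image[OF X Z_nonempty f])

text \<open>If the image points agree, the images of members of \<open>q\<close> and
  \<open>q'\<close> are close. For different summands this contradicts the second clause already for
  the whole spaces; within one summand the embedding property reflects closeness back to
  \<open>X i\<close>.\<close>

lemma corona_incl_inj:
  assumes i: "i \<in> I" "i' \<in> I" and q: "q \<in> corona (X i)" "q' \<in> corona (X i')"
    and eq: "corona_incl i q = corona_incl i' q'"
  shows "i = i' \<and> q = q'"
proof
  have nd: "\<not> coarsely_disjoint Z (f i ` A) (f i' ` B)" if "A \<in> corona_sets q" "B \<in> corona_sets q'" for A B
    using corona_mem_not_disjoint[OF Z_nonempty corona_incl_mem[OF i(1) q(1)]
        corona_incl_image[OF i(1) q(1) that(1)], of "f i' ` B"]
      corona_incl_image[OF i(2) q(2) that(2)] eq by simp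
  show "i = i'"
    using nd[OF corona_mem_mspace[OF X[OF i(1)] q(1)] corona_mem_mspace[OF X[OF i(2)] q(2)]]
      coarse_sum_cross_disjoint[OF i] by blast
  show "q = q'"
  proof (rule corona_eqI[OF X[OF i(1)] q(1)])
    show q': "q' \<in> corona (X i)" using q(2) \<open>i = i'\<close> by simp
    fix A B assume AB: "A \<in> corona_sets q" "B \<in> corona_sets q'"
    show "\<not> coarsely_disjoint (X i) A B"
      using nd[OF AB] coarse_sum_image_disjoint[OF i(1) corona_mem_subset[OF X[OF i(1)] q(1) AB(1)]
          corona_mem_subset[OF X[OF i(1)] q' AB(2)]] \<open>i = i'\<close> by blast
  qed
qed

text \<open>Up to the bounded set \<open>B\<close>, the space \<open>Z\<close> is a finite union of
  neighbourhoods \<open>N i\<close> of the images, so \<open>p\<close> contains some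
  \<open>N i\<close>. It then contains the image itself, since a member coarsely disjoint from the
  image would be coarsely disjoint from \<open>N i\<close>. Now \<open>p\<close> can be pulled back
  along \<open>f i\<close>.\<close>

lemma corona_incl_surj:
  assumes p: "p \<in> corona Z"
  obtains i q where "i \<in> I" "q \<in> corona (X i)" "corona_incl i q = p"
proof -
  obtain K where K: "\<forall>w\<in>mspace Z. mdist Z z w \<le> K \<or> (\<exists>i\<in>I. \<exists>x\<in>mspace (X i). mdist Z (f i x) w \<le> K)"
    using coarse_sumD(3)[OF sum] by blast
  define B where "B = {w \<in> mspace Z. mdist Z z w \<le> K}"
  define N where "N i = {w \<in> mspace Z. \<exists>a\<in>f i ` mspace (X i). mdist Z a w \<le> K}" for i
  have "mspace Z = B \<union> (\<Union>i\<in>I. N i)"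
    using K by (auto simp: B_def N_def)
  then have "B \<union> (\<Union>i\<in>I. N i) \<in> corona_sets p" using corona_mem_mspace[OF Z_nonempty p] by simp
  moreover have "B \<notin> corona_sets p"
    using z by (intro corona_not_mem_bounded[OF Z_nonempty p]) (auto simp: B_def cbounded_iff)
  moreover have "B \<subseteq> mspace Z" "(\<Union>i\<in>I. N i) \<subseteq> mspace Z" by (auto simp: B_def N_def)
  ultimately have "(\<Union>i\<in>I. N i) \<in> corona_sets p" using corona_mem_Un[OF Z_nonempty p] by blast
  then obtain i where i: "i \<in> I" and Ni: "N i \<in> corona_sets p"
    using corona_mem_UN[OF Z_nonempty p I, of N] by (auto simp: N_def)
  have fX: "f i ` mspace (X i) \<subseteq> mspace Z" by (rule coarse_sum_map_mem[OF i order_refl])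
  have img: "f i ` mspace (X i) \<in> corona_sets p"
  proof (rule ccontr)
    assume "f i ` mspace (X i) \<notin> corona_sets p"
    then obtain C where C: "C \<in> corona_sets p" "coarsely_disjoint Z (f i ` mspace (X i)) C"
      using corona_notin_iff[OF Z_nonempty p fX] by blast
    then have "coarsely_disjoint Z (N i) C"
      unfolding N_def by (intro coarsely_disjoint_thicken[OF z fX] corona_mem_subset[OF Z_nonempty p])
    then show False using corona_mem_not_disjoint[OF Z_nonempty p Ni C(1)] by blast
  qed
  \<comment> \<open>Images are used because taking preimages of the members of \<open>p\<close>
    would fail: a member may miss the image of \<open>f i\<close> altogether.\<close>
  define \<F> where "\<F> = {A. A \<subseteq> mspace (X i) \<and> f i ` A \<in> corona_sets p}"
  have "\<not> coarsely_disjoint (X i) A C" if "A \<in> \<F>" "C \<in> \<F>" for A C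
    using that coarse_sum_image_disjoint[OF i, of A C] corona_mem_not_disjoint[OF Z_nonempty p]
    unfolding \<F>_def by blast
  moreover have "A \<in> \<F> \<or> C \<in> \<F>" if "A \<subseteq> mspace (X i)" "C \<subseteq> mspace (X i)" "A \<union> C \<in> \<F>" for A C
    using that corona_mem_Un[OF Z_nonempty p, of "f i ` A" "f i ` C"] coarse_sum_map_mem[OF i]
    by (simp add: \<F>_def image_Un)
  ultimately have F: "coarse_ultrafilter (X i) \<F>"
    using img unfolding coarse_ultrafilter_def by (auto simp: \<F>_def)
  have "corona_incl i (asymp_alike (X i) `` {\<F>}) = p"
  proof (rule corona_eqI[OF Z_nonempty corona_incl_mem[OF i corona_classI[OF F]] p])
    have u: "coarse_ultrafilter Z (pushforward (X i) Z (f i) \<F>)"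
      by (rule coarse_ultrafilter_pushforward[OF X[OF i] f[OF i] F])
    have eq: "corona_incl i (asymp_alike (X i) `` {\<F>}) = asymp_alike Z `` {pushforward (X i) Z (f i) \<F>}"
    by (rule corona_map_class[OF X[OF i] Z_nonempty f[OF i] F])
    have rep: "coarse_ultrafilter Z (corona_sets p)" "asymp_alike Z `` {corona_sets p} = p"
      using corona_rep[OF Z_nonempty p] by auto
    have "\<not> coarsely_disjoint Z A C" if A: "A \<in> pushforward (X i) Z (f i) \<F>" and C: "C \<in> corona_sets p" for A C
    proof -
      \<comment> \<open>\<open>A\<close> contains the image of its own preimage, and that image
        belongs to \<open>p\<close> by the definition of \<open>\<F>\<close>.\<close>
      have "f i ` {x \<in> mspace (X i). f i x \<in> A} \<in> corona_sets p"
        using A by (simp add: pushforward_def \<F>_def)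
      moreover have "f i ` {x \<in> mspace (X i). f i x \<in> A} \<subseteq> A" by blast
      ultimately show ?thesis
        using corona_mem_not_disjoint[OF Z_nonempty p _ C] coarsely_disjoint_mono[OF _ _ order_refl] by blast
    qed
    then have "(pushforward (X i) Z (f i) \<F>, corona_sets p) \<in> asymp_alike Z"
      using u rep(1) by (simp add: asymp_alike_def)
    then have "corona_incl i (asymp_alike (X i) `` {\<F>}) = p"
      using eq rep corona_class_eq[OF Z_nonempty u rep(1)] by simp
    then show "\<not> coarsely_disjoint Z A C"
      if "A \<in> corona_sets (corona_incl i (asymp_alike (X i) `` {\<F>}))" "C \<in> corona_sets p" for A C
      using corona_mem_not_disjoint[OF Z_nonempty p] that by simp
  qed
  then show thesis using that i corona_classI[OF F] by blast
qed

text \<open>The witness \<open>D\<close> joins the image of a witness \<open>B\<close> from the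
  summand of \<open>p\<close> to the whole images of all other summands. A member of
  \<open>p\<close> coming from its own summand is coarsely disjoint from \<open>D\<close>. A point
  outside \<open>U\<close> comes either from the same summand, and then contains the image of
  \<open>B\<close>, or from another one, and then contains that entire image.\<close>

lemma corona_incl_final:
  assumes U: "U \<subseteq> corona Z"
    and op: "\<And>i. i \<in> I \<Longrightarrow> openin (corona_space (X i)) {q \<in> corona (X i). corona_incl i q \<in> U}"
  shows "openin (corona_space Z) U"
  unfolding openin_corona_space[OF Z_nonempty]
proof (intro conjI U ballI)
  fix p assume pU: "p \<in> U"
  then have p: "p \<in> corona Z" using U by blast
  obtain i q where i: "i \<in> I" and q: "q \<in> corona (X i)" and pq: "corona_incl i q = p"
    using corona_incl_surj[OF p] .
  let ?V = "{q \<in> corona (X i). corona_incl i q \<in> U}"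
  have "q \<in> ?V" using q pq pU by simp
  then obtain B where B: "B \<subseteq> mspace (X i)" "B \<notin> corona_sets q" "corona (X i) - ?V \<subseteq> corona_cl (X i) B"
    using op[OF i] unfolding openin_corona_space[OF X[OF i]] by blast
  obtain A where A: "A \<in> corona_sets q" "coarsely_disjoint (X i) B A"
    using corona_notin_iff[OF X[OF i] q B(1)] B(2) by blast
  have As: "A \<subseteq> mspace (X i)" by (rule corona_mem_subset[OF X[OF i] q A(1)])
  define D where "D = f i ` B \<union> (\<Union>k\<in>I - {i}. f k ` mspace (X k))"
  have Ds: "D \<subseteq> mspace Z" using coarse_sum_map_mem i B(1) unfolding D_def by blast
  have "coarsely_disjoint Z (f i ` A) D"
    unfolding D_def
  proof (rule coarsely_disjoint_Un_right[OF Z_nonempty])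
    show "coarsely_disjoint Z (f i ` A) (f i ` B)"
      by (rule coarse_sum_image_disjoint[OF i As B(1) coarsely_disjoint_sym[OF A(2)]])
    show "coarsely_disjoint Z (f i ` A) (\<Union>k\<in>I - {i}. f k ` mspace (X k))"
      using I i As by (intro coarsely_disjoint_UN_right[OF Z_nonempty] coarse_sum_cross_disjoint) auto
  qed
  moreover have "f i ` A \<in> corona_sets p" using corona_incl_image[OF i q A(1)] pq by simp
  ultimately have "D \<notin> corona_sets p" using corona_mem_not_disjoint[OF Z_nonempty p] by blast
  moreover have "corona Z - U \<subseteq> corona_cl Z D"
  proof
    fix r assume r: "r \<in> corona Z - U"
    then obtain l s where l: "l \<in> I" and s: "s \<in> corona (X l)" and rs: "corona_incl l s = r"
      using corona_incl_surj by blast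
    have "\<exists>E\<in>corona_sets r. E \<subseteq> D"
    proof (cases "l = i")
      case True
      then have "s \<in> corona_cl (X i) B" using B(3) s rs r by blast
      then have "f i ` B \<in> corona_sets r"
        using corona_incl_image[OF l s, of B] rs True by (simp add: corona_cl_iff)
      then show ?thesis unfolding D_def by blast
    next
      case False
      have "f l ` mspace (X l) \<in> corona_sets r"
        using corona_incl_image[OF l s corona_mem_mspace[OF X[OF l] s]] rs by simp
      then show ?thesis using False l unfolding D_def by blast
    qed
    then have "D \<in> corona_sets r" using corona_mem_mono[OF Z_nonempty, of r] r Ds by blast
    then show "r \<in> corona_cl Z D" using r by (simp add: corona_cl_iff)
  qed
  ultimately show "\<exists>B. B \<subseteq> mspace Z \<and> B \<notin> corona_sets p \<and> corona Z - U \<subseteq> corona_cl Z B"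
    using Ds by blast
qed

lemma coarse_sum_top_coproduct:
  "top_coproduct TYPE('t) I (\<lambda>i. corona_space (X i)) (corona_space Z) corona_incl"
proof (rule top_coproductI)
  show "corona_incl i \<in> top_hom (corona_space (X i)) (corona_space Z)" if "i \<in> I" for i
    by (intro corona_map_hom X that Z_nonempty mcoarse_homI f)
  show "i = i' \<and> q = q'"
    if "i \<in> I" "i' \<in> I" "q \<in> topspace (corona_space (X i))" "q' \<in> topspace (corona_space (X i'))"
      "corona_incl i q = corona_incl i' q'" for i i' q q'
    using corona_incl_inj that by (simp add: topspace_corona_space X)
  show "\<exists>i\<in>I. \<exists>q\<in>topspace (corona_space (X i)). corona_incl i q = p"
    if "p \<in> topspace (corona_space Z)" for p
    using corona_incl_surj[of p] that by (metis topspace_corona_space X Z_nonempty)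
  show "openin (corona_space Z) U"
    if "U \<subseteq> topspace (corona_space Z)"
      "\<And>i. i \<in> I \<Longrightarrow> openin (corona_space (X i)) {q \<in> topspace (corona_space (X i)). corona_incl i q \<in> U}" for U
    using corona_incl_final[of U] that by (simp add: topspace_corona_space X Z_nonempty)
qed

end

lemma top_coproduct_cong:
  assumes "top_coproduct TYPE('t) I S T k" "\<And>i. i \<in> I \<Longrightarrow> k i = k' i"
  shows "top_coproduct TYPE('t) I S T k'"
  using assms unfolding top_coproduct_def top_cocone_def by simp

lemma corona_preserves: "corona_preserves_finite_coproducts TYPE('i) TYPE('a) TYPE('t)"
  unfolding corona_preserves_finite_coproducts_def
proof (intro allI impI, elim conjE)
  fix I :: "'i set" and X :: "'i \<Rightarrow> 'a metric" and Z :: "'a metric" and j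
  assume I: "finite I" and cop: "mcoarse_coproduct TYPE('a) I X Z j"
  then have co: "mcoarse_cocone I X Z j" by (simp add: mcoarse_coproduct_def)
  have X: "mspace (X i) \<noteq> {}" if "i \<in> I" for i using co that by (simp add: mcoarse_cocone_def mcoarse_obj_def)
  obtain z where z: "z \<in> mspace Z" using co by (auto simp: mcoarse_cocone_def mcoarse_obj_def)
  obtain f where f: "\<And>i. i \<in> I \<Longrightarrow> coarse_map (X i) Z (f i)"
      and j: "\<And>i. i \<in> I \<Longrightarrow> j i = close_rel (X i) Z `` {f i}"
    using mcoarse_cocone_reps[OF co] by metis
  have "coarse_sum I X Z z f" by (rule coarse_coproduct_sum[OF cop I z X f j])
  from coarse_sum_top_coproduct[OF this I z X f]
  have "top_coproduct TYPE('t) I (\<lambda>i. corona_space (X i)) (corona_space Z)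
      (\<lambda>i. corona_map (X i) Z (close_rel (X i) Z `` {f i}))" .
  then show "top_coproduct TYPE('t) I (\<lambda>i. corona_space (X i)) (corona_space Z) (\<lambda>i. corona_map (X i) Z (j i))"
    by (rule top_coproduct_cong) (use j in metis)
qed

section \<open>Points of the corona given by sequences\<close>

text \<open>A nonprincipal ultrafilter. Upward closure follows: of a set and its complement one is a
  member, and the complement of a superset of a member would meet that member in the empty
  set.\<close>

definition free_ultrafilter :: "nat set set \<Rightarrow> bool" where
  "free_ultrafilter \<U> \<longleftrightarrow> (\<forall>A\<in>\<U>. infinite A) \<and> UNIV \<in> \<U> \<and> (\<forall>A\<in>\<U>. \<forall>B\<in>\<U>. A \<inter> B \<in> \<U>) \<and>
    (\<forall>A B. A \<union> B \<in> \<U> \<longrightarrow> A \<in> \<U> \<or> B \<in> \<U>)"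

lemma free_ultrafilter_exists: "\<exists>\<U>. free_ultrafilter \<U>"
proof -
  define \<A> where "\<A> = {F :: nat set set. (\<forall>A\<in>F. infinite A) \<and> UNIV \<in> F \<and>
    (\<forall>A\<in>F. \<forall>B\<in>F. A \<inter> B \<in> F) \<and> (\<forall>A\<in>F. \<forall>B. A \<subseteq> B \<longrightarrow> B \<in> F)}"
  have "\<exists>M\<in>\<A>. \<forall>F\<in>\<A>. M \<subseteq> F \<longrightarrow> F = M"
  proof (rule subset_Zorn_nonempty)
    have "{UNIV} \<in> \<A>" by (auto simp: \<A>_def)
    then show "\<A> \<noteq> {}" by blast
    fix \<C> assume C: "\<C> \<noteq> {}" "subset.chain \<A> \<C>"
    have CA: "F \<in> \<A>" if "F \<in> \<C>" for F using C(2) that by (auto simp: subset_chain_def)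
    have "A \<inter> B \<in> \<Union>\<C>" if AB: "A \<in> \<Union>\<C>" "B \<in> \<Union>\<C>" for A B
    proof -
      obtain F G where "F \<in> \<C>" "A \<in> F" "G \<in> \<C>" "B \<in> G" using AB by blast
      moreover have "F \<subseteq> G \<or> G \<subseteq> F" using C(2) calculation by (auto simp: subset_chain_def)
      ultimately obtain H where H: "H \<in> \<C>" "A \<in> H" "B \<in> H" by blast
      then have "A \<inter> B \<in> H" using CA[OF H(1)] by (simp add: \<A>_def)
      then show ?thesis using H(1) by blast
    qed
    moreover have "infinite A" if "A \<in> \<Union>\<C>" for A using that CA by (auto simp: \<A>_def)
    moreover have "UNIV \<in> \<Union>\<C>" using C(1) CA by (auto simp: \<A>_def)
    moreover have "B \<in> \<Union>\<C>" if A: "A \<in> \<Union>\<C>" "A \<subseteq> B" for A B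
    proof -
      obtain F where F: "F \<in> \<C>" "A \<in> F" using A by blast
      then have "B \<in> F" using CA[OF F(1)] A(2) by (auto simp: \<A>_def)
      then show ?thesis using F(1) by blast
    qed
    ultimately show "\<Union>\<C> \<in> \<A>" unfolding \<A>_def by blast
  qed
  then obtain M where M: "M \<in> \<A>" and max: "\<And>F. F \<in> \<A> \<Longrightarrow> M \<subseteq> F \<Longrightarrow> F = M" by blast
  have Minf: "\<And>A. A \<in> M \<Longrightarrow> infinite A" and MU: "UNIV \<in> M"
    and MI: "\<And>A B. A \<in> M \<Longrightarrow> B \<in> M \<Longrightarrow> A \<inter> B \<in> M" and Mup: "\<And>A B. A \<in> M \<Longrightarrow> A \<subseteq> B \<Longrightarrow> B \<in> M"
    using M unfolding \<A>_def by auto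
  have small: "\<exists>D\<in>M. finite (D \<inter> A)" if A: "A \<notin> M" for A
  proof (rule ccontr)
    assume ne: "\<not> ?thesis"
    \<comment> \<open>The filter generated by \<open>M\<close> and \<open>A\<close>. If
      \<open>A\<close> met every member of \<open>M\<close> in an infinite set, it would be a proper
      extension of \<open>M\<close> without finite members.\<close>
    define F where "F = {C. \<exists>D\<in>M. D \<inter> A \<subseteq> C}"
    have "infinite C" if "C \<in> F" for C using that ne finite_subset unfolding F_def by blast
    moreover have "B \<inter> C \<in> F" if "B \<in> F" "C \<in> F" for B C
    proof -
      obtain D E where "D \<in> M" "D \<inter> A \<subseteq> B" "E \<in> M" "E \<inter> A \<subseteq> C" using \<open>B \<in> F\<close> \<open>C \<in> F\<close> unfolding F_def by blast
      then show ?thesis unfolding F_def using MI[of D E] by blast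
    qed
    moreover have "UNIV \<in> F" using MU unfolding F_def by blast
    moreover have "C \<in> F" if "B \<in> F" "B \<subseteq> C" for B C using that unfolding F_def by blast
    ultimately have "F \<in> \<A>" unfolding \<A>_def by blast
    moreover have "M \<subseteq> F" unfolding F_def by blast
    ultimately have "F = M" by (rule max)
    moreover have "A \<in> F" using MU unfolding F_def by blast
    ultimately show False using A by blast
  qed
  have "A \<in> M \<or> B \<in> M" if AB: "A \<union> B \<in> M" for A B
  proof (rule ccontr)
    assume "\<not> ?thesis"
    then obtain D E where D: "D \<in> M" "finite (D \<inter> A)" and E: "E \<in> M" "finite (E \<inter> B)"
      using small by meson
    \<comment> \<open>A member of \<open>M\<close> that is covered by two finite sets.\<close>
    have "(D \<inter> E) \<inter> (A \<union> B) \<in> M" using MI D E AB by blast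
    moreover have "(D \<inter> E) \<inter> (A \<union> B) \<subseteq> (D \<inter> A) \<union> (E \<inter> B)" by blast
    ultimately show False using Minf D(2) E(2) finite_subset by blast
  qed
  then have "free_ultrafilter M" using Minf MU MI by (simp add: free_ultrafilter_def)
  then show ?thesis ..
qed

section \<open>Sequences that leave every ball\<close>

definition escaping :: "'a metric \<Rightarrow> (nat \<Rightarrow> 'a) \<Rightarrow> bool" where
  "escaping X x \<longleftrightarrow> range x \<subseteq> mspace X \<and> (\<forall>p\<in>mspace X. \<forall>R. finite {n. mdist X p (x n) \<le> R})"

lemma escaping_mem: "escaping X x \<Longrightarrow> x n \<in> mspace X"
  by (auto simp: escaping_def)

lemma escapingI:
  assumes "p \<in> mspace X" and x: "\<And>n. x n \<in> mspace X" and fin: "\<And>R. finite {n. mdist X p (x n) \<le> R}"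
  shows "escaping X x"
  unfolding escaping_def
proof (intro conjI ballI allI)
  show "range x \<subseteq> mspace X" using x by blast
  fix q R assume q: "q \<in> mspace X"
  have "{n. mdist X q (x n) \<le> R} \<subseteq> {n. mdist X p (x n) \<le> mdist X p q + R}"
  proof
    fix n assume "n \<in> {n. mdist X q (x n) \<le> R}"
    then show "n \<in> {n. mdist X p (x n) \<le> mdist X p q + R}"
      using mdist_triangle[OF assms(1) q x, of n] by simp
  qed
  then show "finite {n. mdist X q (x n) \<le> R}" using fin finite_subset by blast
qed

lemma escaping_ge:
  assumes "p \<in> mspace X" "\<And>n. x n \<in> mspace X" "\<And>n. real n \<le> mdist X p (x n)"
  shows "escaping X x"
proof (rule escapingI[OF assms(1,2)])
  fix R
  have "{n. mdist X p (x n) \<le> R} \<subseteq> {..nat \<lceil>R\<rceil>}"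
  proof
    fix n assume "n \<in> {n. mdist X p (x n) \<le> R}"
    then have "real n \<le> R" using assms(3)[of n] by simp
    then show "n \<in> {..nat \<lceil>R\<rceil>}" by (simp add: le_nat_iff) linarith
  qed
  then show "finite {n. mdist X p (x n) \<le> R}" using finite_subset by blast
qed

lemma escaping_close:
  assumes x: "escaping X x" and y: "\<And>n. y n \<in> mspace X" and K: "\<And>n. mdist X (x n) (y n) \<le> K"
  shows "escaping X y"
proof (rule escapingI[OF escaping_mem[OF x] y])
  fix R
  have "mdist X (x 0) (x n) \<le> R + K" if "mdist X (x 0) (y n) \<le> R" for n
    using mdist_triangle[OF escaping_mem[OF x, of 0] y[of n] escaping_mem[OF x, of n]] that K[of n]
      mdist_commute[of X "x n" "y n"] by simp
  then have "{n. mdist X (x 0) (y n) \<le> R} \<subseteq> {n. mdist X (x 0) (x n) \<le> R + K}" by blast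
  moreover have "finite {n. mdist X (x 0) (x n) \<le> R + K}"
    using x escaping_mem[OF x, of 0] by (simp add: escaping_def)
  ultimately show "finite {n. mdist X (x 0) (y n) \<le> R}" by (rule finite_subset)
qed

text \<open>Properness carries escape forward along \<open>f\<close>, and bornologousness pulls it
  back.\<close>

lemma escaping_image:
  assumes f: "coarse_map X Y f" and x: "\<And>n. x n \<in> mspace X"
  shows "escaping Y (f \<circ> x) \<longleftrightarrow> escaping X x"
proof -
  have y: "f (x n) \<in> mspace Y" for n using f x[of n] by (auto simp: coarse_map_def)
  show ?thesis
  proof
    assume e: "escaping Y (f \<circ> x)"
    show "escaping X x"
    proof (rule escapingI[OF x[of 0] x])
      fix R
      obtain C where C: "\<forall>a\<in>mspace X. \<forall>b\<in>mspace X. mdist X a b \<le> R \<longrightarrow> mdist Y (f a) (f b) \<le> C"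
        using coarse_map_bornologous[OF f, of R] by blast
      have "{n. mdist X (x 0) (x n) \<le> R} \<subseteq> {n. mdist Y (f (x 0)) ((f \<circ> x) n) \<le> C}" using C x by auto
      moreover have "finite {n. mdist Y (f (x 0)) ((f \<circ> x) n) \<le> C}"
        using e y[of 0] unfolding escaping_def by blast
      ultimately show "finite {n. mdist X (x 0) (x n) \<le> R}" by (rule finite_subset)
    qed
  next
    assume e: "escaping X x"
    show "escaping Y (f \<circ> x)"
    proof (rule escapingI[OF y[of 0]])
      show "(f \<circ> x) n \<in> mspace Y" for n using y by simp
      fix R
      obtain C where C: "\<forall>a\<in>mspace X. mdist Y (f (x 0)) (f a) \<le> R \<longrightarrow> mdist X (x 0) a \<le> C"
        using coarse_map_proper[OF f x[of 0] y[of 0], of R] by blast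
      have "{n. mdist Y (f (x 0)) ((f \<circ> x) n) \<le> R} \<subseteq> {n. mdist X (x 0) (x n) \<le> C}" using C x by auto
      moreover have "finite {n. mdist X (x 0) (x n) \<le> C}"
        using e x[of 0] unfolding escaping_def by blast
      ultimately show "finite {n. mdist Y (f (x 0)) ((f \<circ> x) n) \<le> R}" by (rule finite_subset)
    qed
  qed
qed

definition sequence_sets :: "nat set set \<Rightarrow> 'a metric \<Rightarrow> (nat \<Rightarrow> 'a) \<Rightarrow> 'a set set" where
  "sequence_sets \<U> X x = {A. A \<subseteq> mspace X \<and> {n. x n \<in> A} \<in> \<U>}"

text \<open>Both families use the same ultrafilter, so \<open>x n\<close> lies in \<open>A\<close>
  and \<open>y n\<close> in \<open>B\<close> for infinitely many common indices \<open>n\<close>.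
  Coarse disjointness would confine these infinitely many \<open>x n\<close> to a ball. Taking
  \<open>y = x\<close> gives the closeness axiom, the general case the equality of points of close
  sequences.\<close>

lemma sequence_sets_not_disjoint:
  assumes U: "free_ultrafilter \<U>" and x: "escaping X x" and K: "\<And>n. mdist X (x n) (y n) \<le> K"
    and A: "A \<in> sequence_sets \<U> X x" and B: "B \<in> sequence_sets \<U> X y"
  shows "\<not> coarsely_disjoint X A B"
proof
  assume AB: "coarsely_disjoint X A B"
  have s: "A \<subseteq> mspace X" "B \<subseteq> mspace X" using A B by (auto simp: sequence_sets_def)
  have p: "x 0 \<in> mspace X" by (rule escaping_mem[OF x])
  obtain C where C: "\<forall>a\<in>A. \<forall>b\<in>B. mdist X a b \<le> K \<longrightarrow> mdist X (x 0) a \<le> C"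
    using spec[OF iffD1[OF coarsely_disjoint_iff[OF p s] AB], of K] by blast
  have "{n. x n \<in> A} \<inter> {n. y n \<in> B} \<in> \<U>"
    using U A B by (simp add: free_ultrafilter_def sequence_sets_def)
  then have "infinite ({n. x n \<in> A} \<inter> {n. y n \<in> B})" using U by (simp add: free_ultrafilter_def)
  moreover have "{n. x n \<in> A} \<inter> {n. y n \<in> B} \<subseteq> {n. mdist X (x 0) (x n) \<le> C}" using C K by blast
  moreover have "finite {n. mdist X (x 0) (x n) \<le> C}" using x p by (simp add: escaping_def)
  ultimately show False using finite_subset by blast
qed

lemma sequence_sets_ultrafilter:
  assumes U: "free_ultrafilter \<U>" and x: "escaping X x"
  shows "coarse_ultrafilter X (sequence_sets \<U> X x)"
proof -
  have "\<not> coarsely_disjoint X A B" if "A \<in> sequence_sets \<U> X x" "B \<in> sequence_sets \<U> X x" for A B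
    using sequence_sets_not_disjoint[OF U x _ that, of 0] escaping_mem[OF x] by simp
  moreover have "A \<in> sequence_sets \<U> X x \<or> B \<in> sequence_sets \<U> X x"
    if "A \<subseteq> mspace X" "B \<subseteq> mspace X" "A \<union> B \<in> sequence_sets \<U> X x" for A B
  proof -
    have "{n. x n \<in> A} \<union> {n. x n \<in> B} \<in> \<U>"
      using that by (simp add: sequence_sets_def Collect_disj_eq)
    then have "{n. x n \<in> A} \<in> \<U> \<or> {n. x n \<in> B} \<in> \<U>" using U by (simp add: free_ultrafilter_def)
    then show ?thesis using that by (simp add: sequence_sets_def)
  qed
  moreover have "mspace X \<in> sequence_sets \<U> X x"
    using U escaping_mem[OF x] by (simp add: sequence_sets_def free_ultrafilter_def)
  moreover have "sequence_sets \<U> X x \<subseteq> Pow (mspace X)" by (auto simp: sequence_sets_def)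
  ultimately show ?thesis unfolding coarse_ultrafilter_def by blast
qed

definition sequence_point :: "nat set set \<Rightarrow> 'a metric \<Rightarrow> (nat \<Rightarrow> 'a) \<Rightarrow> 'a set set set" where
  "sequence_point \<U> X x = asymp_alike X `` {sequence_sets \<U> X x}"

lemma sequence_point_corona: "free_ultrafilter \<U> \<Longrightarrow> escaping X x \<Longrightarrow> sequence_point \<U> X x \<in> corona X"
  unfolding sequence_point_def by (intro corona_classI sequence_sets_ultrafilter)

lemma sequence_point_range:
  assumes U: "free_ultrafilter \<U>" and x: "escaping X x"
  shows "range x \<in> corona_sets (sequence_point \<U> X x)"
  unfolding sequence_point_def
proof (rule corona_class_mem[OF sequence_sets_ultrafilter[OF U x]])
  show "range x \<in> sequence_sets \<U> X x"
    using U x by (simp add: sequence_sets_def free_ultrafilter_def escaping_def)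
qed

lemma sequence_point_map:
  assumes U: "free_ultrafilter \<U>" and f: "coarse_map X Y f" and x: "escaping X x"
  shows "corona_map X Y (close_rel X Y `` {f}) (sequence_point \<U> X x) = sequence_point \<U> Y (f \<circ> x)"
proof -
  have X: "mspace X \<noteq> {}" using escaping_mem[OF x] by blast
  then have Y: "mspace Y \<noteq> {}" using f by (auto simp: coarse_map_def)
  have "pushforward X Y f (sequence_sets \<U> X x) = sequence_sets \<U> Y (f \<circ> x)"
    using escaping_mem[OF x] by (simp add: pushforward_def sequence_sets_def Collect_conj_eq subset_iff)
  then show ?thesis
    unfolding sequence_point_def using corona_map_class[OF X Y f sequence_sets_ultrafilter[OF U x]] by simp
qed

lemma sequence_point_close:
  assumes U: "free_ultrafilter \<U>" and x: "escaping X x" and y: "\<And>n. y n \<in> mspace X"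
    and K: "\<And>n. mdist X (x n) (y n) \<le> K"
  shows "sequence_point \<U> X x = sequence_point \<U> X y"
proof -
  have X: "mspace X \<noteq> {}" using escaping_mem[OF x] by blast
  have e: "escaping X y" by (rule escaping_close[OF x y K])
  have "(sequence_sets \<U> X x, sequence_sets \<U> X y) \<in> asymp_alike X"
    using sequence_sets_ultrafilter[OF U x] sequence_sets_ultrafilter[OF U e]
      sequence_sets_not_disjoint[OF U x K] by (simp add: asymp_alike_def)
  then show ?thesis
    unfolding sequence_point_def
    using corona_class_eq[OF X sequence_sets_ultrafilter[OF U x] sequence_sets_ultrafilter[OF U e]] by simp
qed

section \<open>Reflection\<close>

text \<open>Passing to a rapidly growing subsequence makes all mixed distances large, not only those
  between partners.\<close>

lemma separated_sequences:
  assumes p: "p \<in> mspace X" and big: "\<And>r. \<exists>x\<in>mspace X. \<exists>y\<in>mspace X. P x y \<and>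
      r < mdist X p x \<and> r < mdist X p y \<and> r < mdist X x y"
  obtains x y :: "nat \<Rightarrow> 'a" where "escaping X x" "escaping X y" "\<And>n. P (x n) (y n)"
    "coarsely_disjoint X (range x) (range y)"
proof -
  obtain a b where a: "\<And>r. a r \<in> mspace X" and b: "\<And>r. b r \<in> mspace X" and P: "\<And>r. P (a r) (b r)"
      and ab: "\<And>r. r < mdist X p (a r)" "\<And>r. r < mdist X p (b r)" "\<And>r. r < mdist X (a r) (b r)"
    using big by metis
  \<comment> \<open>\<open>r (Suc n)\<close> bounds the distances of the \<open>n\<close>-th pair
    from \<open>p\<close>, and pair \<open>n\<close> is chosen with these distances and its mutual
    distance above \<open>2 * r n\<close>. Subtracting the distance of an earlier point, at most
    \<open>r n\<close>, still leaves more than \<open>r n\<close>, which is at least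
    \<open>n\<close>.\<close>
  define r where "r = rec_nat 0 (\<lambda>_ s. s + 1 + mdist X p (a (2 * s)) + mdist X p (b (2 * s)))"
  have r0: "r 0 = 0"
    and rS: "r (Suc n) = r n + 1 + mdist X p (a (2 * r n)) + mdist X p (b (2 * r n))" for n
    by (simp_all add: r_def)
  define x y where "x n = a (2 * r n)" and "y n = b (2 * r n)" for n
  have rn: "real n \<le> r n" for n
  proof (induction n)
    case (Suc n)
    have "0 \<le> mdist X p (a (2 * r n))" "0 \<le> mdist X p (b (2 * r n))" by simp_all
    with Suc show ?case unfolding rS by linarith
  qed (simp add: r0)
  have "r n \<le> r (Suc n)" for n unfolding rS
    using mdist_nonneg[of X p "a (2 * r n)"] mdist_nonneg[of X p "b (2 * r n)"] by linarith
  then have mono: "r m \<le> r n" if "m \<le> n" for m n using that by (rule lift_Suc_mono_le)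
  have up: "mdist X p (x n) \<le> r (Suc n)" "mdist X p (y n) \<le> r (Suc n)" for n
    unfolding rS x_def y_def using rn[of n] by simp_all
  have low: "2 * r n < mdist X p (x n)" "2 * r n < mdist X p (y n)" "2 * r n < mdist X (x n) (y n)" for n
    unfolding x_def y_def by (rule ab)+
  have xm: "x n \<in> mspace X" and ym: "y n \<in> mspace X" for n unfolding x_def y_def by (rule a b)+
  \<comment> \<open>A bound in the first index is what is wanted: if \<open>x m\<close> is within
    \<open>R\<close> of any \<open>y n\<close>, then \<open>m\<close> is bounded by
    \<open>R\<close>, and only finitely many \<open>x m\<close> remain.\<close>
  have ge: "real m \<le> mdist X (x m) (y n)" for m n
  proof -
    consider "m < n" | "n < m" | "m = n" by linarith
    then show ?thesis
    proof cases
      case 1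
      then have "r (Suc m) \<le> r n" by (intro mono) simp
      then show ?thesis
        using mdist_triangle[OF p xm[of m] ym[of n]] low(2)[of n] up(1)[of m] rn[of n] 1 by simp
    next
      case 2
      then have "r (Suc n) \<le> r m" by (intro mono) simp
      then show ?thesis
        using mdist_triangle[OF p ym[of n] xm[of m]] mdist_commute[of X "x m" "y n"]
          low(1)[of m] up(2)[of n] rn[of m] by simp
    next
      case 3
      then show ?thesis using low(3)[of n] rn[of n] by simp
    qed
  qed
  have "coarsely_disjoint X (range x) (range y)"
  proof (subst coarsely_disjoint_iff[OF p])
    show "\<forall>R. \<exists>C. \<forall>u\<in>range x. \<forall>v\<in>range y. mdist X u v \<le> R \<longrightarrow> mdist X p u \<le> C"
    proof
      fix R
      have "mdist X p (x m) \<le> r (Suc (nat \<lceil>R\<rceil>))" if "mdist X (x m) (y n) \<le> R" for m n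
      proof -
        have "real m \<le> R" using ge[of m n] that by simp
        then have "m \<le> nat \<lceil>R\<rceil>" by linarith
        then show ?thesis using up(1)[of m] mono[of "Suc m" "Suc (nat \<lceil>R\<rceil>)"] by simp
      qed
      then show "\<exists>C. \<forall>u\<in>range x. \<forall>v\<in>range y. mdist X u v \<le> R \<longrightarrow> mdist X p u \<le> C" by blast
    qed
  qed (use xm ym in auto)
  moreover have "real n \<le> mdist X p (x n)" "real n \<le> mdist X p (y n)" for n
    using low(1,2)[of n] rn[of n] by simp_all
  then have "escaping X x" "escaping X y" by (auto intro!: escaping_ge[OF p] xm ym)
  moreover have "P (x n) (y n)" for n unfolding x_def y_def by (rule P)
  ultimately show thesis using that by blast
qed

text \<open>Each clause of \<open>coarse_sum\<close> is proved by contradiction: its failure yields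
  a sequence whose corona point violates injectivity or surjectivity. Only the bijection of points
  enters, so the topology of the coronas has done its work at this stage.\<close>

lemma corona_bijection_sum:
  fixes X :: "'i \<Rightarrow> 'a metric" and Z :: "'b metric"
  assumes I: "finite I" and z: "z \<in> mspace Z" and X: "\<And>i. i \<in> I \<Longrightarrow> mspace (X i) \<noteq> {}"
    and f: "\<And>i. i \<in> I \<Longrightarrow> coarse_map (X i) Z (f i)"
    and inj: "\<And>i i' q q'. i \<in> I \<Longrightarrow> i' \<in> I \<Longrightarrow> q \<in> corona (X i) \<Longrightarrow> q' \<in> corona (X i') \<Longrightarrow>
      corona_map (X i) Z (close_rel (X i) Z `` {f i}) q =
      corona_map (X i') Z (close_rel (X i') Z `` {f i'}) q' \<Longrightarrow> i = i' \<and> q = q'"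
    and surj: "\<And>p. p \<in> corona Z \<Longrightarrow>
      \<exists>i\<in>I. \<exists>q\<in>corona (X i). corona_map (X i) Z (close_rel (X i) Z `` {f i}) q = p"
  shows "coarse_sum I X Z z f"
proof -
  obtain \<U> where U: "free_ultrafilter \<U>" using free_ultrafilter_exists ..
  have Z: "mspace Z \<noteq> {}" using z by blast
  have fm: "f i x \<in> mspace Z" if "i \<in> I" "x \<in> mspace (X i)" for i x
    using f[OF that(1)] that(2) by (auto simp: coarse_map_def)
  \<comment> \<open>Sequences at bounded distance in \<open>Z\<close> define the same point of its
    corona; injectivity then identifies both the summands and the points above it.\<close>
  have near: "i = k \<and> sequence_point \<U> (X i) x = sequence_point \<U> (X k) y"
    if ik: "i \<in> I" "k \<in> I" and x: "escaping (X i) x" and y: "\<And>n. y n \<in> mspace (X k)"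
      and K: "\<And>n. mdist Z (f i (x n)) (f k (y n)) \<le> K" for i k x y K
  proof -
    have fx: "escaping Z (f i \<circ> x)" using escaping_image[OF f[OF ik(1)] escaping_mem[OF x]] x by simp
    have fy: "(f k \<circ> y) n \<in> mspace Z" for n using fm[OF ik(2) y] by simp
    have K': "mdist Z ((f i \<circ> x) n) ((f k \<circ> y) n) \<le> K" for n using K by simp
    have "escaping Z (f k \<circ> y)" by (rule escaping_close[OF fx fy K'])
    then have ey: "escaping (X k) y" using escaping_image[OF f[OF ik(2)] y] by simp
    have "sequence_point \<U> Z (f i \<circ> x) = sequence_point \<U> Z (f k \<circ> y)"
      by (rule sequence_point_close[OF U fx fy K'])
    then show ?thesis
      using sequence_point_map[OF U f[OF ik(1)] x] sequence_point_map[OF U f[OF ik(2)] ey]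
      by (intro inj[OF ik sequence_point_corona[OF U x] sequence_point_corona[OF U ey]]) simp
  qed
  have C1: "\<exists>C. \<forall>x\<in>mspace (X i). \<forall>y\<in>mspace (X i). mdist Z (f i x) (f i y) \<le> R \<longrightarrow> mdist (X i) x y \<le> C"
    if i: "i \<in> I" for i R
  proof (rule ccontr)
    assume "\<not> ?thesis"
    then have ne: "\<exists>x\<in>mspace (X i). \<exists>y\<in>mspace (X i). mdist Z (f i x) (f i y) \<le> R \<and> C < mdist (X i) x y" for C
      by (meson not_le)
    obtain p where p: "p \<in> mspace (X i)" using X[OF i] by blast
    have q: "f i p \<in> mspace Z" by (rule fm[OF i p])
    \<comment> \<open>Both partners must be far from \<open>p\<close>. If \<open>x\<close> were
      within \<open>r\<close> of \<open>p\<close>, then \<open>f i x\<close> would be within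
      \<open>B\<close> of \<open>f i p\<close> and \<open>f i y\<close> within \<open>B + R\<close>;
      properness would put \<open>y\<close> within \<open>D\<close> of \<open>p\<close>, so
      \<open>x\<close> and \<open>y\<close> would be at most \<open>r + D\<close> apart.\<close>
    have "\<exists>x\<in>mspace (X i). \<exists>y\<in>mspace (X i). mdist Z (f i x) (f i y) \<le> R \<and>
        r < mdist (X i) p x \<and> r < mdist (X i) p y \<and> r < mdist (X i) x y" for r
    proof -
      obtain B where B: "\<forall>x\<in>mspace (X i). \<forall>y\<in>mspace (X i). mdist (X i) x y \<le> r \<longrightarrow> mdist Z (f i x) (f i y) \<le> B"
        using coarse_map_bornologous[OF f[OF i], of r] by blast
      obtain D where D: "\<forall>x\<in>mspace (X i). mdist Z (f i p) (f i x) \<le> B + R \<longrightarrow> mdist (X i) p x \<le> D"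
        using coarse_map_proper[OF f[OF i] p q, of "B + R"] by blast
      have far: "mdist (X i) x y \<le> r + D"
        if xy: "x \<in> mspace (X i)" "y \<in> mspace (X i)" "mdist Z (f i x) (f i y) \<le> R" "mdist (X i) p x \<le> r" for x y
      proof -
        have "mdist Z (f i p) (f i x) \<le> B" using B p xy by blast
        then have "mdist Z (f i p) (f i y) \<le> B + R"
          using mdist_triangle[OF q fm[OF i xy(1)] fm[OF i xy(2)]] xy(3) by simp
        then have "mdist (X i) p y \<le> D" using D xy(2) by blast
        then show ?thesis
          using mdist_triangle[OF xy(1) p xy(2)] mdist_commute[of "X i" x p] xy(4) by simp
      qed
      obtain x y where xy: "x \<in> mspace (X i)" "y \<in> mspace (X i)" "mdist Z (f i x) (f i y) \<le> R"
          "max r (r + D) < mdist (X i) x y" using ne by meson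
      have "r < mdist (X i) p x" using far[OF xy(1-3)] xy(4) by linarith
      moreover have "r < mdist (X i) p y"
        using far[OF xy(2,1)] xy(3,4) mdist_commute[of Z "f i x"] mdist_commute[of "X i" x y] by fastforce
      ultimately show ?thesis using xy by auto
    qed
    then obtain x y where xy: "escaping (X i) x" "escaping (X i) y" "\<And>n. mdist Z (f i (x n)) (f i (y n)) \<le> R"
        "coarsely_disjoint (X i) (range x) (range y)"
      using separated_sequences[OF p, of "\<lambda>x y. mdist Z (f i x) (f i y) \<le> R"] by metis
    have "sequence_point \<U> (X i) x = sequence_point \<U> (X i) y"
      using near[OF i i xy(1) escaping_mem[OF xy(2)] xy(3)] by blast
    then show False
      using corona_mem_not_disjoint[OF X[OF i] sequence_point_corona[OF U xy(1)] sequence_point_range[OF U xy(1)]]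
        sequence_point_range[OF U xy(2)] xy(4) by simp
  qed
  have C3: "\<exists>C. \<forall>x\<in>mspace (X i). \<forall>y\<in>mspace (X k). i \<noteq> k \<longrightarrow> mdist Z (f i x) (f k y) \<le> R \<longrightarrow> mdist Z z (f i x) \<le> C"
    if ik: "i \<in> I" "k \<in> I" for i k R
  proof (rule ccontr)
    assume "\<not> ?thesis"
    then have nb: "\<And>C. \<exists>x\<in>mspace (X i). \<exists>y\<in>mspace (X k).
        i \<noteq> k \<and> mdist Z (f i x) (f k y) \<le> R \<and> C < mdist Z z (f i x)"
      by (simp add: not_le)
    then have "i \<noteq> k" by blast
    obtain x y where xy: "\<And>n. x n \<in> mspace (X i)" "\<And>n. y n \<in> mspace (X k)"
        "\<And>n. mdist Z (f i (x n)) (f k (y n)) \<le> R" "\<And>n. real n < mdist Z z (f i (x n))"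
    proof -
      have "\<forall>n. \<exists>u v. u \<in> mspace (X i) \<and> v \<in> mspace (X k) \<and>
          mdist Z (f i u) (f k v) \<le> R \<and> real n < mdist Z z (f i u)" using nb by blast
      then show thesis using that by metis
    qed
    have "escaping Z (f i \<circ> x)"
      by (rule escaping_ge[OF z]) (use xy(1,4) fm[OF ik(1)] in \<open>auto intro: less_imp_le\<close>)
    then have "escaping (X i) x" using escaping_image[OF f[OF ik(1)] xy(1)] by simp
    from near[OF ik this xy(2,3)] show False using \<open>i \<noteq> k\<close> by blast
  qed
  have C2: "\<exists>R. \<forall>w\<in>mspace Z. mdist Z z w \<le> R \<or> (\<exists>i\<in>I. \<exists>x\<in>mspace (X i). mdist Z (f i x) w \<le> R)"
  proof (rule ccontr)
    assume "\<not> ?thesis"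
    then have ex: "\<exists>w\<in>mspace Z. R < mdist Z z w \<and> (\<forall>i\<in>I. \<forall>x\<in>mspace (X i). R < mdist Z (f i x) w)" for R
      by (meson not_le)
    have "\<forall>n. \<exists>w. w \<in> mspace Z \<and> real n < mdist Z z w \<and>
        (\<forall>i\<in>I. \<forall>x\<in>mspace (X i). real n < mdist Z (f i x) w)"
      using ex by blast
    \<comment> \<open>By surjectivity the point of \<open>w\<close> comes from some summand
      \<open>i\<close> and contains the image of \<open>f i\<close> besides the range of
      \<open>w\<close>. These two sets are coarsely disjoint, because the distance of
      \<open>w n\<close> from the image exceeds \<open>n\<close>.\<close>
    from choice[OF this] obtain w where w: "\<And>n. w n \<in> mspace Z" "\<And>n. real n < mdist Z z (w n)"
        "\<And>n i x. i \<in> I \<Longrightarrow> x \<in> mspace (X i) \<Longrightarrow> real n < mdist Z (f i x) (w n)"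
      by blast
    have e: "escaping Z w"
      by (rule escaping_ge[OF z w(1)]) (use w(2) in \<open>auto intro: less_imp_le\<close>)
    note p = sequence_point_corona[OF U e]
    obtain i q where i: "i \<in> I" and q: "q \<in> corona (X i)"
        and eq: "corona_map (X i) Z (close_rel (X i) Z `` {f i}) q = sequence_point \<U> Z w"
      using surj[OF p] by blast
    have "f i ` mspace (X i) \<in> corona_sets (sequence_point \<U> Z w)"
      using corona_map_image[OF X[OF i] Z f[OF i] q corona_mem_mspace[OF X[OF i] q]] eq by simp
    moreover have "coarsely_disjoint Z (range w) (f i ` mspace (X i))"
    proof (subst coarsely_disjoint_iff[OF z])
      show "\<forall>R. \<exists>C. \<forall>u\<in>range w. \<forall>v\<in>f i ` mspace (X i). mdist Z u v \<le> R \<longrightarrow> mdist Z z u \<le> C"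
      proof
        fix R :: real
        \<comment> \<open>Only indices below \<open>R\<close> can have \<open>w n\<close> within
          \<open>R\<close> of the image, so a maximum over finitely many terms is enough.\<close>
        define C where "C = Max ((\<lambda>n. mdist Z z (w n)) ` {..nat \<lceil>R\<rceil>})"
        have "mdist Z z (w n) \<le> C" if x: "x \<in> mspace (X i)" "mdist Z (w n) (f i x) \<le> R" for n x
        proof -
          have "real n < R" using w(3)[OF i x(1), of n] x(2) mdist_commute[of Z "w n"] by simp
          then have "n \<le> nat \<lceil>R\<rceil>" by linarith
          then show ?thesis unfolding C_def by (intro Max_ge) auto
        qed
        then show "\<exists>C. \<forall>u\<in>range w. \<forall>v\<in>f i ` mspace (X i). mdist Z u v \<le> R \<longrightarrow> mdist Z z u \<le> C" by blast
      qed
    qed (use w(1) fm[OF i] in auto)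
    ultimately show False
      using corona_mem_not_disjoint[OF Z p sequence_point_range[OF U e]] by blast
  qed
  show ?thesis
    unfolding coarse_sum_def
  proof (intro conjI allI C2)
    show "\<exists>C. \<forall>i\<in>I. \<forall>x\<in>mspace (X i). \<forall>y\<in>mspace (X i).
        mdist Z (f i x) (f i y) \<le> R \<longrightarrow> mdist (X i) x y \<le> C" for R
      by (rule finite_uniform_bound[OF I C1]) (assumption, meson order_trans)
    show "\<exists>C. \<forall>i\<in>I. \<forall>k\<in>I. \<forall>x\<in>mspace (X i). \<forall>y\<in>mspace (X k). i \<noteq> k \<longrightarrow>
        mdist Z (f i x) (f k y) \<le> R \<longrightarrow> mdist Z z (f i x) \<le> C" for R
    proof (rule finite_uniform_bound[OF I])
      fix i assume "i \<in> I"
      then show "\<exists>C. \<forall>k\<in>I. \<forall>x\<in>mspace (X i). \<forall>y\<in>mspace (X k). i \<noteq> k \<longrightarrow>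
          mdist Z (f i x) (f k y) \<le> R \<longrightarrow> mdist Z z (f i x) \<le> C"
        by (intro finite_uniform_bound[OF I C3]) (assumption+, meson order_trans)
    qed (meson order_trans)
  qed
qed

lemma corona_reflects: "corona_reflects_finite_coproducts TYPE('i) TYPE('a) TYPE('y)"
  unfolding corona_reflects_finite_coproducts_def
proof (intro allI impI, elim conjE)
  fix I :: "'i set" and X :: "'i \<Rightarrow> 'a metric" and Z :: "'a metric" and j
  assume I: "finite I" and co: "mcoarse_cocone I X Z j"
    and cop: "top_coproduct TYPE('a set set set) I (\<lambda>i. corona_space (X i)) (corona_space Z)
      (\<lambda>i. corona_map (X i) Z (j i))"
  have X: "mspace (X i) \<noteq> {}" if "i \<in> I" for i using co that by (simp add: mcoarse_cocone_def mcoarse_obj_def)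
  obtain z where z: "z \<in> mspace Z" using co by (auto simp: mcoarse_cocone_def mcoarse_obj_def)
  then have Z: "mspace Z \<noteq> {}" by blast
  obtain f where f: "\<And>i. i \<in> I \<Longrightarrow> coarse_map (X i) Z (f i)"
      and j: "\<And>i. i \<in> I \<Longrightarrow> j i = close_rel (X i) Z `` {f i}"
    using mcoarse_cocone_reps[OF co] by metis
  \<comment> \<open>Two distinct test points for \<open>top_coproduct_bijection\<close>, available
    for every type \<open>'a\<close>.\<close>
  have ne: "({} :: 'a set set set) \<noteq> UNIV" by simp
  have "coarse_sum I X Z z f"
  proof (rule corona_bijection_sum[OF I z X f])
    show "i = i' \<and> q = q'"
      if "i \<in> I" "i' \<in> I" "q \<in> corona (X i)" "q' \<in> corona (X i')"
        "corona_map (X i) Z (close_rel (X i) Z `` {f i}) q =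
         corona_map (X i') Z (close_rel (X i') Z `` {f i'}) q'" for i i' q q'
      using top_coproduct_inj[OF cop ne that(1,2), of q q'] that topspace_corona_space[OF X] j by simp
    show "\<exists>i\<in>I. \<exists>q\<in>corona (X i). corona_map (X i) Z (close_rel (X i) Z `` {f i}) q = p"
      if "p \<in> corona Z" for p
      using top_coproduct_surj[OF cop ne, of p] that topspace_corona_space[OF X] topspace_corona_space[OF Z] j
      by auto
  qed
  then show "mcoarse_coproduct TYPE('y) I X Z j"
    by (rule coarse_sum_coproduct[OF _ I z X f j])
qed

theorem corollary33:
  "corona_is_functor TYPE('a) \<and>
   corona_preserves_finite_coproducts TYPE('i) TYPE('a) TYPE('t) \<and>
   corona_reflects_finite_coproducts TYPE('i) TYPE('a) TYPE('y)"
  using corona_functorial corona_preserves corona_reflects by blast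

end
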